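(* Let $G$ be a chordal graph and $H$ be a $C_4$-free spanning subgraph of $G$. Then $\mathrm{BBC}_2(G,H)\leq \frac{3}{2}\omega(G)+4$.
   Context: All graphs are finite and simple. A graph is chordal if it has no induced cycle of length at least $4$. $H$ is $C_4$-free if $H$ does not contain a cycle of length $4$ as a (not necessarily induced) subgraph. For a positive integer $k$, $[k]=\{1,\dots,k\}$. Given a graph $G$, a subgraph $H$ of $G$, and positive integers $q,k$, a $q$-backbone $k$-colouring of $(G,H)$ is a map $c:V(G)\to[k]$ such that $c(u)\neq c(v)$ for every edge $uv\in E(G)$ and $|c(u)-c(v)|\geq q$ for every edge $uv\in E(H)$. $\mathrm{BBC}_q(G,H)$ is the minimum $k$ for which a $q$-backbone $k$-colouring of $(G,H)$ exists. $\omega(G)$ is the clique number of $G$. *)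

theory Defs
  imports Complex_Main "Graph_Theory.Graph_Theory"
begin

(* A finite simple graph is a pair_graph: every undirected edge uv is represented by the two
   arcs (u,v) and (v,u).  Cycles are Graph_Theory's closed arc walks without repeated vertices;
   in a symmetric digraph those of length at least 3 are exactly the undirected cycles, each
   traversed in some direction from some starting vertex.  (Length 2 also occurs, as u,v,u,
   but is never used below.) *)

definition induced_cycle :: "'a pair_pre_digraph \<Rightarrow> ('a \<times> 'a) awalk \<Rightarrow> bool" where
  "induced_cycle G p \<longleftrightarrow>
     pre_digraph.cycle (with_proj G) p \<and>
     arcs (with_proj G \<restriction> (fst ` set p)) = set p \<union> (set p)\<inverse>"

definition chordal :: "'a pair_pre_digraph \<Rightarrow> bool" where
  "chordal G \<longleftrightarrow> \<not> (\<exists>p. 4 \<le> length p \<and> induced_cycle G p)"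

definition C4_free :: "'a pair_pre_digraph \<Rightarrow> bool" where
  "C4_free H \<longleftrightarrow> \<not> (\<exists>p. length p = 4 \<and> pre_digraph.cycle (with_proj H) p)"

definition is_clique :: "'a pair_pre_digraph \<Rightarrow> 'a set \<Rightarrow> bool" where
  "is_clique G K \<longleftrightarrow> K \<subseteq> pverts G \<and> pairwise (\<lambda>u v. (u, v) \<in> parcs G) K"

definition clique_number :: "'a pair_pre_digraph \<Rightarrow> nat" where
  "clique_number G = Max (card ` {K. is_clique G K})"

definition backbone_colouring ::
  "nat \<Rightarrow> nat \<Rightarrow> 'a pair_pre_digraph \<Rightarrow> 'a pair_pre_digraph \<Rightarrow> ('a \<Rightarrow> nat) \<Rightarrow> bool" where
  "backbone_colouring q k G H c \<longleftrightarrow>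
     (\<forall>v \<in> pverts G. c v \<in> {1..k}) \<and>
     (\<forall>(u, v) \<in> parcs G. c u \<noteq> c v) \<and>
     (\<forall>(u, v) \<in> parcs H. \<bar>int (c u) - int (c v)\<bar> \<ge> int q)"

definition BBC :: "nat \<Rightarrow> 'a pair_pre_digraph \<Rightarrow> 'a pair_pre_digraph \<Rightarrow> nat" where
  "BBC q G H = (LEAST k. 0 < k \<and> (\<exists>c. backbone_colouring q k G H c))"

(* The minimum in BBC is attained, so LEAST is never applied to an empty predicate. *)
lemma backbone_colouring_BBC:
  assumes G: "pair_graph G" and sub: "subgraph (with_proj H) (with_proj G)"
  shows "0 < BBC q G H \<and> (\<exists>c. backbone_colouring q (BBC q G H) G H c)"
proof -
  interpret pair_graph G by (fact G)
  obtain f :: "'a \<Rightarrow> nat" where inj: "inj_on f (pverts G)"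
    using finite_imp_inj_to_nat_seg[OF pair_finite_verts] by blast
  define c where "c v = 1 + (q + 1) * f v" for v
  define k where "k = Suc (\<Sum>v\<in>pverts G. c v)"
  have HG: "parcs H \<subseteq> parcs G"
    using sub by (auto simp: subgraph_def)
  have ne: "f u \<noteq> f v" if uv: "(u, v) \<in> parcs G" for u v
    using inj_onD[OF inj, of u v] no_loops'[OF uv] in_arcsD1[OF uv] in_arcsD2[OF uv] by blast
  have far: "int q \<le> \<bar>int (c u) - int (c v)\<bar>" if "(u, v) \<in> parcs G" for u v
  proof -
    have "1 \<le> \<bar>int (f u) - int (f v)\<bar>" using ne[OF that] by linarith
    then have "(int q + 1) * 1 \<le> (int q + 1) * \<bar>int (f u) - int (f v)\<bar>"
      by (intro mult_left_mono) auto
    also have "\<dots> = \<bar>(int q + 1) * (int (f u) - int (f v))\<bar>"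
      by (simp add: abs_mult)
    also have "(int q + 1) * (int (f u) - int (f v)) = int (c u) - int (c v)"
      by (simp add: c_def algebra_simps)
    finally show ?thesis by simp
  qed
  have range: "c v \<in> {1..k}" if "v \<in> pverts G" for v
  proof -
    have "c v \<le> (\<Sum>v\<in>pverts G. c v)"
      by (rule member_le_sum) (use that pair_finite_verts in simp_all)
    moreover have "1 \<le> c v" by (simp add: c_def)
    ultimately show ?thesis by (simp add: k_def)
  qed
  have proper: "c u \<noteq> c v" if "(u, v) \<in> parcs G" for u v
    using ne[OF that] mult_cancel1[of "Suc q" "f u" "f v"] by (simp add: c_def)
  have col: "backbone_colouring q k G H c"
    unfolding backbone_colouring_def using range proper far HG by blast
  define P where "P k \<longleftrightarrow> 0 < k \<and> (\<exists>c. backbone_colouring q k G H c)" for k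
  have "P k" using col by (auto simp: P_def k_def)
  then have "P (LEAST k. P k)" by (rule LeastI)
  then show ?thesis by (simp only: P_def BBC_def)
qed

end

theory Submission
  imports Defs
begin

text \<open>
  Suppose the bound fails for a chordal graph with clique number \<open>\<omega>\<close> and \<open>k = s + \<omega> - 1\<close> colours, where
  \<open>\<omega> \<le> 2s - 9\<close> and \<open>s \<ge> 10\<close> (for \<open>\<omega> \<le> 10\<close>, doubling a proper colouring is enough), and pass to
  a vertex-minimal counterexample with vertex set \<open>V\<close>. Colouring the colours in increasing order, and
  recolouring one part of the graph after another, one obtains for every \<open>W \<subseteq> V\<close>
  that the sum of \<open>k + deg\<^bsub>H[W]\<^esub> w\<close> over \<open>w \<in> W\<close> is at most the sum of \<open>deg\<^sub>G w + 2 deg\<^sub>H w\<close>.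
  So vertices low in a perfect elimination order have about \<open>s/2 \<approx> \<omega>/4\<close> backbone neighbours in one
  clique, while two vertices share at most one backbone neighbour. Four such vertices are (almost)
  too many for a clique of size \<open>\<omega>\<close>. Take \<open>u\<close> lowest such that the subtree \<open>T u\<close> of the elimination tree
  has at least four vertices. If the subtrees below \<open>u\<close> already contain four vertices, counting gives a
  contradiction. If \<open>T u\<close> has exactly four vertices, counting leaves only cases in which it is attained
  with equality; then the colours blocked at each vertex of \<open>T u\<close> are pairwise distinct, which forces the
  colours on the clique above \<open>u\<close> to be spread too thinly, or leaves lists that can be coloured directly.
\<close>

section \<open>List colourings and the density inequality\<close>

text \<open>Greedy colouring is too weak because a backbone neighbour can forbid three colours.
  Serving the colours in increasing order brings this down to two, and the density inequality is
  what the saving amounts to in a critical set. The constant 9 in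
  \<open>\<omega> + 9 \<le> 2 * s\<close> marks where counting stops. As |K u| \<le> \<omega> - 1
  \<le> 2s - 10, four vertices of a subtree give 20 \<le> e + 2h + 2p, where e and h are the numbers
  of edges and backbone edges among them and p adds up, over the six pairs, the backbone neighbours
  shared outside. Here h and p compete: a backbone path of two edges already uses up the only common
  neighbour that its ends may have. So h + p \<le> 7, except that a perfect matching in the backbone
  allows 8. With e \<le> 6 the first case is just attained, 20 = 6 + 14, and the second leaves some
  room. Degrees alone therefore cannot finish, and the colours and list sizes themselves have to be
  examined.\<close>

definition far :: "nat \<Rightarrow> nat \<Rightarrow> bool" where
  "far i j \<longleftrightarrow> i + 2 \<le> j \<or> j + 2 \<le> i"

lemma far_sym: "far i j \<longleftrightarrow> far j i"
  by (auto simp: far_def)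

locale backbone =
  fixes E D :: "'a \<Rightarrow> 'a \<Rightarrow> bool"
  assumes E_sym: "E u v \<Longrightarrow> E v u"
    and E_irrefl: "\<not> E u u"
    and D_sym: "D u v \<Longrightarrow> D v u"
    and D_imp_E: "D u v \<Longrightarrow> E u v"
begin

definition ok :: "('a \<Rightarrow> nat set) \<Rightarrow> 'a set \<Rightarrow> ('a \<Rightarrow> nat) \<Rightarrow> bool" where
  "ok A S c \<longleftrightarrow> (\<forall>v\<in>S. c v \<in> A v) \<and>
     (\<forall>u\<in>S. \<forall>v\<in>S. (E u v \<longrightarrow> c u \<noteq> c v) \<and> (D u v \<longrightarrow> far (c u) (c v)))"

definition lcol :: "('a \<Rightarrow> nat set) \<Rightarrow> 'a set \<Rightarrow> bool" where
  "lcol A S \<longleftrightarrow> (\<exists>c. ok A S c)"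

definition dE :: "'a set \<Rightarrow> 'a \<Rightarrow> nat" where
  "dE S w = card {v \<in> S. E w v}"

definition dD :: "'a set \<Rightarrow> 'a \<Rightarrow> nat" where
  "dD S w = card {v \<in> S. D w v}"

definition res :: "('a \<Rightarrow> nat set) \<Rightarrow> ('a \<Rightarrow> nat) \<Rightarrow> 'a set \<Rightarrow> 'a \<Rightarrow> nat set" where
  "res A c Y w = {i \<in> A w. \<forall>y\<in>Y. (E w y \<longrightarrow> i \<noteq> c y) \<and> (D w y \<longrightarrow> far i (c y))}"

lemma lcol_empty: "lcol A {}"
  by (simp add: lcol_def ok_def)

lemma ok_extend:
  assumes c: "ok A Y c" and d: "ok (res A c Y) Z d" and disj: "Y \<inter> Z = {}"
  shows "ok A (Y \<union> Z) (\<lambda>v. if v \<in> Y then c v else d v)" (is "ok A _ ?e")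
proof -
  have nZ: "v \<notin> Y" if "v \<in> Z" for v using that disj by blast
  have cross: "(E u v \<longrightarrow> d u \<noteq> c v) \<and> (D u v \<longrightarrow> far (d u) (c v))" if "u \<in> Z" "v \<in> Y" for u v
    using d that unfolding ok_def res_def by blast
  show ?thesis
    unfolding ok_def
  proof (intro conjI ballI)
    fix v assume "v \<in> Y \<union> Z"
    then show "?e v \<in> A v" using c d nZ unfolding ok_def res_def by auto
  next
    fix u v assume u: "u \<in> Y \<union> Z" and v: "v \<in> Y \<union> Z"
    have "(E u v \<longrightarrow> ?e u \<noteq> ?e v) \<and> (D u v \<longrightarrow> far (?e u) (?e v))"
    proof (cases "u \<in> Y"; cases "v \<in> Y")
      assume "u \<in> Y" "v \<in> Y" then show ?thesis using c unfolding ok_def by simp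
    next
      assume "u \<in> Y" "v \<notin> Y"
      then show ?thesis using cross[of v u] v E_sym D_sym by (auto simp: far_sym)
    next
      assume "u \<notin> Y" "v \<in> Y"
      then show ?thesis using cross[of u v] u by auto
    next
      assume "u \<notin> Y" "v \<notin> Y"
      then show ?thesis using d u v unfolding ok_def by auto
    qed
    then show "E u v \<longrightarrow> ?e u \<noteq> ?e v" "D u v \<longrightarrow> far (?e u) (?e v)" by blast+
  qed
qed

lemma lcol_extend:
  assumes "ok A Y c" "lcol (res A c Y) Z" "Y \<inter> Z = {}"
  shows "lcol A (Y \<union> Z)"
  using assms ok_extend unfolding lcol_def by blast

text \<open>A neighbour costs its own colour, a backbone neighbour also the two adjacent ones.
  Truncation in \<open>c y - 1\<close> is harmless: for \<open>c y = 0\<close> it only repeats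
  \<open>c y\<close>.\<close>

lemma card_res:
  assumes fY: "finite Y" and fA: "finite (A w)"
  shows "card (A w) \<le> card (res A c Y w) + dE Y w + 2 * dD Y w"
proof -
  let ?E = "{y \<in> Y. E w y}" and ?D = "{y \<in> Y. D w y}"
  have sub: "A w \<subseteq> res A c Y w \<union> c ` ?E \<union> (\<lambda>y. c y + 1) ` ?D \<union> (\<lambda>y. c y - 1) ` ?D"
  proof
    fix i assume i: "i \<in> A w"
    show "i \<in> res A c Y w \<union> c ` ?E \<union> (\<lambda>y. c y + 1) ` ?D \<union> (\<lambda>y. c y - 1) ` ?D"
    proof (rule ccontr)
      assume n: "\<not> ?thesis"
      have "far i (c y)" if "y \<in> Y" "D w y" for y
      proof (rule ccontr)
        assume "\<not> far i (c y)"
        then have "i = c y \<or> i = c y + 1 \<or> i = c y - 1" by (auto simp: far_def)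
        then show False using n that D_imp_E by auto
      qed
      then have "i \<in> res A c Y w" using n i by (auto simp: res_def)
      then show False using n by blast
    qed
  qed
  have f: "finite ?E" "finite ?D" "finite (res A c Y w)" using fY fA by (auto simp: res_def)
  have "card (A w) \<le> card (res A c Y w \<union> c ` ?E \<union> (\<lambda>y. c y + 1) ` ?D \<union> (\<lambda>y. c y - 1) ` ?D)"
    by (rule card_mono[OF _ sub]) (use f in auto)
  also have "\<dots> \<le> card (res A c Y w) + card (c ` ?E) + card ((\<lambda>y. c y + 1) ` ?D) + card ((\<lambda>y. c y - 1) ` ?D)"
    by (meson add_le_mono card_Un_le le_refl le_trans)
  also have "\<dots> \<le> card (res A c Y w) + card ?E + card ?D + card ?D"
    using card_image_le[OF f(1), of c] card_image_le[OF f(2), of "\<lambda>y. c y + 1"]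
      card_image_le[OF f(2), of "\<lambda>y. c y - 1"] by linarith
  finally show ?thesis by (simp add: dE_def dD_def)
qed

lemma dE_Un: "finite S \<Longrightarrow> finite T \<Longrightarrow> S \<inter> T = {} \<Longrightarrow> dE (S \<union> T) w = dE S w + dE T w"
  unfolding dE_def by (subst card_Un_disjoint[symmetric]) (auto intro: arg_cong[where f = card])

lemma dD_Un: "finite S \<Longrightarrow> finite T \<Longrightarrow> S \<inter> T = {} \<Longrightarrow> dD (S \<union> T) w = dD S w + dD T w"
  unfolding dD_def by (subst card_Un_disjoint[symmetric]) (auto intro: arg_cong[where f = card])

lemma dD_le_dE: "finite S \<Longrightarrow> dD S w \<le> dE S w"
  unfolding dE_def dD_def by (rule card_mono) (auto simp: D_imp_E)

lemma sum_card_swap: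
  assumes "finite S" "finite T" and sym: "\<And>u v. P u v \<Longrightarrow> P v u"
  shows "(\<Sum>w\<in>S. card {v \<in> T. P w v}) = (\<Sum>w\<in>T. card {v \<in> S. P w v})"
proof -
  have "(\<Sum>w\<in>S. card {v \<in> T. P w v}) = (\<Sum>w\<in>S. \<Sum>v\<in>T. if P w v then 1 else 0)"
    using assms(1,2) by (simp add: sum.If_cases Int_def)
  also have "\<dots> = (\<Sum>v\<in>T. \<Sum>w\<in>S. if P w v then 1 else 0)" by (rule sum.swap)
  also have "\<dots> = (\<Sum>v\<in>T. \<Sum>w\<in>S. if P v w then 1 else 0)"
    by (intro sum.cong refl) (use sym in auto)
  also have "\<dots> = (\<Sum>w\<in>T. card {v \<in> S. P w v})"
    using assms(1,2) by (simp add: sum.If_cases Int_def)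
  finally show ?thesis .
qed

lemma sum_dE_swap: "finite S \<Longrightarrow> finite T \<Longrightarrow> (\<Sum>w\<in>S. dE T w) = (\<Sum>w\<in>T. dE S w)"
  unfolding dE_def by (rule sum_card_swap) (use E_sym in auto)

lemma sum_dD_swap: "finite S \<Longrightarrow> finite T \<Longrightarrow> (\<Sum>w\<in>S. dD T w) = (\<Sum>w\<in>T. dD S w)"
  unfolding dD_def by (rule sum_card_swap) (use D_sym in auto)

text \<open>The smallest colour \<open>a\<close> in use goes to the lowest-ranked vertex \<open>w\<close> that has it. No list contains a colour
below \<open>a\<close>, so every backbone neighbour of \<open>w\<close> loses, besides \<open>a\<close>, only \<open>a + 1\<close>.\<close>

lemma lcol_rank:
  fixes r :: "'a \<Rightarrow> nat"
  assumes "finite S" and "inj_on r S"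
    and "\<And>w. w \<in> S \<Longrightarrow> finite (A w)"
    and "\<And>w. w \<in> S \<Longrightarrow> card {v \<in> S. E w v \<and> r v < r w} + dD S w < card (A w)"
  shows "lcol A S"
  using assms
proof (induction "card S" arbitrary: S A)
  case 0
  then show ?case by (simp add: lcol_empty)
next
  case (Suc n)
  note fin = Suc.prems(1) and inj = Suc.prems(2) and fA = Suc.prems(3) and big = Suc.prems(4)
  define U where "U = (\<Union>w\<in>S. A w)"
  have neS: "S \<noteq> {}" using Suc.hyps(2) by auto
  have neA: "A w \<noteq> {}" if "w \<in> S" for w using big[OF that] by auto
  have fU: "finite U" "U \<noteq> {}" using fin fA neS neA by (auto simp: U_def)
  define a where "a = Min U"
  have aU: "a \<in> U" and amin: "\<And>i. i \<in> U \<Longrightarrow> a \<le> i" using fU by (auto simp: a_def)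
  obtain w0 where "w0 \<in> S \<and> a \<in> A w0" using aU by (auto simp: U_def)
  from ex_has_least_nat[of "\<lambda>v. v \<in> S \<and> a \<in> A v", OF this, of r]
  obtain w where w: "w \<in> S" "a \<in> A w" and wl: "\<And>v. v \<in> S \<Longrightarrow> a \<in> A v \<Longrightarrow> r w \<le> r v"
    by blast
  let ?c = "\<lambda>_. a" and ?T = "S - {w}"
  have ok1: "ok A {w} ?c" using w E_irrefl D_imp_E by (auto simp: ok_def)
  have "lcol (res A ?c {w}) ?T"
  proof (rule Suc.hyps(1))
    show "n = card ?T" using Suc.hyps(2) w fin by simp
    show "finite ?T" using fin by simp
    show "inj_on r ?T" using inj by (rule inj_on_subset) auto
    fix v assume v: "v \<in> ?T"
    show "finite (res A ?c {w} v)" using fA v by (auto simp: res_def)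
    have vS: "v \<in> S" and vw: "v \<noteq> w" using v by auto
    let ?L = "{x \<in> S. E v x \<and> r x < r v}" and ?L' = "{x \<in> ?T. E v x \<and> r x < r v}"
    have fL: "finite ?L" using fin by simp
    have dDS: "dD S v = dD ?T v + (if D v w then 1 else 0)"
    proof -
      have "dD S v = dD (?T \<union> {w}) v" using w by (simp add: insert_absorb)
      also have "\<dots> = dD ?T v + dD {w} v" by (rule dD_Un) (use fin in auto)
      also have "dD {w} v = (if D v w then 1 else 0)"
      proof -
        have "{x \<in> {w}. D v x} = (if D v w then {w} else {})" by auto
        then show ?thesis by (simp add: dD_def)
      qed
      finally show ?thesis .
    qed
    have cL: "card ?L = card ?L' + (if E v w \<and> r w < r v then 1 else 0)"
    proof (cases "E v w \<and> r w < r v")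
      case True
      then have "?L = insert w ?L'" using w by auto
      then show ?thesis using True fL by simp
    next
      case False
      then have "?L = ?L'" using w by auto
      then show ?thesis using False by simp
    qed
    have sub: "A v \<subseteq> res A ?c {w} v \<union> (if E v w \<and> r w < r v then {a} else {}) \<union> (if D v w then {a + 1} else {})"
    proof
      fix i assume i: "i \<in> A v"
      have ai: "a \<le> i" using amin i vS by (auto simp: U_def)
      \<comment> \<open>By the choice of \<open>w\<close>, a vertex ranked below \<open>w\<close>
        does not have \<open>a\<close> in its list. So only vertices ranked above \<open>w\<close>
        lose \<open>a\<close>, and for them the number of earlier neighbours drops as well.\<close>
      have earlier: "r w < r v" if "i = a"
        using wl[of v] that i vS inj_onD[OF inj, of w v] w vw by fastforce
      show "i \<in> res A ?c {w} v \<union> (if E v w \<and> r w < r v then {a} else {}) \<union> (if D v w then {a + 1} else {})"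
        using i ai earlier D_imp_E
        by (cases "i = a"; cases "i = a + 1") (auto simp: res_def far_def)
    qed
    have "card (A v) \<le> card (res A ?c {w} v) + (if E v w \<and> r w < r v then 1 else 0) + (if D v w then 1 else 0)"
    proof -
      have "card (A v) \<le> card (res A ?c {w} v \<union> (if E v w \<and> r w < r v then {a} else {}) \<union> (if D v w then {a + 1} else {}))"
        by (rule card_mono[OF _ sub]) (use fA vS in \<open>auto simp: res_def\<close>)
      also have "\<dots> \<le> card (res A ?c {w} v) + card (if E v w \<and> r w < r v then {a} else {}) + card (if D v w then {a + 1} else {})"
        by (meson add_le_mono card_Un_le le_refl le_trans)
      finally show ?thesis by (auto split: if_splits)
    qed
    then show "card {x \<in> ?T. E v x \<and> r x < r v} + dD ?T v < card (res A ?c {w} v)"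
      using big[OF vS] dDS cL by linarith
  qed
  from lcol_extend[OF ok1 this] show ?case using w by (simp add: insert_absorb)
qed

text \<open>A degeneracy order: a vertex of small degree is ranked last and removed, and the rest is
  ranked in the same way.\<close>

lemma rank_exists:
  assumes "finite S" and "\<And>X. X \<subseteq> S \<Longrightarrow> X \<noteq> {} \<Longrightarrow> \<exists>w\<in>X. dE X w < b w"
  shows "\<exists>r :: 'a \<Rightarrow> nat. inj_on r S \<and> (\<forall>w\<in>S. r w < card S \<and> card {v \<in> S. E w v \<and> r v < r w} < b w)"
  using assms
proof (induction "card S" arbitrary: S)
  case 0
  then show ?case by simp
next
  case (Suc n)
  have "S \<noteq> {}" using Suc.hyps(2) by auto
  then obtain w where w: "w \<in> S" "dE S w < b w" using Suc.prems(2)[of S] by auto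
  let ?T = "S - {w}"
  have cT: "n = card ?T" using Suc.hyps(2) w Suc.prems(1) by simp
  have "\<exists>r :: 'a \<Rightarrow> nat. inj_on r ?T \<and> (\<forall>v\<in>?T. r v < card ?T \<and> card {x \<in> ?T. E v x \<and> r x < r v} < b v)"
    by (rule Suc.hyps(1)[OF cT]) (use Suc.prems in auto)
  then obtain r :: "'a \<Rightarrow> nat" where r: "inj_on r ?T" "\<forall>v\<in>?T. r v < card ?T \<and> card {x \<in> ?T. E v x \<and> r x < r v} < b v"
    by blast
  let ?r = "r(w := n)"
  have "inj_on ?r S"
  proof (rule inj_onI)
    fix x y assume "x \<in> S" "y \<in> S" "?r x = ?r y"
    moreover have "r v \<noteq> n" if "v \<in> S" "v \<noteq> w" for v using bspec[OF r(2), of v] cT that by auto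
    ultimately show "x = y" using inj_onD[OF r(1), of x y] by (auto split: if_splits)
  qed
  moreover have "?r v < card S \<and> card {x \<in> S. E v x \<and> ?r x < ?r v} < b v" if v: "v \<in> S" for v
  proof (cases "v = w")
    case True
    have "card {x \<in> S. E w x \<and> ?r x < ?r w} \<le> dE S w"
      unfolding dE_def by (rule card_mono) (use Suc.prems(1) in auto)
    then show ?thesis using True w Suc.hyps(2) by simp
  next
    case False
    then have "v \<in> ?T" using v by simp
    then have "r v < n" "card {x \<in> ?T. E v x \<and> r x < r v} < b v" using r cT by auto
    moreover have "{x \<in> S. E v x \<and> ?r x < ?r v} = {x \<in> ?T. E v x \<and> r x < r v}"
      using False \<open>r v < n\<close> by auto
    ultimately show ?thesis using False Suc.hyps(2) by simp
  qed
  ultimately show ?case by blast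
qed

text \<open>Since \<open>lcol_rank\<close> fails for every ranking, peeling off vertices of small
  degree must get stuck, and \<open>X\<close> is where it does. A ranking saves only on edges, so
  \<open>dE\<close> refers to \<open>X\<close> but \<open>dD\<close> to all of
  \<open>S\<close>.\<close>

lemma not_lcol_core:
  assumes "finite S" and "\<And>w. w \<in> S \<Longrightarrow> finite (A w)" and "\<not> lcol A S"
  obtains X where "X \<subseteq> S" "X \<noteq> {}" "\<And>w. w \<in> X \<Longrightarrow> card (A w) \<le> dE X w + dD S w"
proof -
  have "\<exists>X. X \<subseteq> S \<and> X \<noteq> {} \<and> (\<forall>w\<in>X. card (A w) \<le> dE X w + dD S w)"
  proof (rule ccontr)
    assume "\<not> ?thesis"
    then have "\<exists>w\<in>X. dE X w < card (A w) - dD S w" if "X \<subseteq> S" "X \<noteq> {}" for X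
      using that by (metis less_diff_conv linorder_not_le)
    from rank_exists[OF assms(1) this]
    obtain r :: "'a \<Rightarrow> nat" where "inj_on r S" "\<forall>w\<in>S. card {v \<in> S. E w v \<and> r v < r w} < card (A w) - dD S w"
      by blast
    then have "lcol A S" by (intro lcol_rank[of S r]) (use assms in \<open>auto simp: less_diff_conv\<close>)
    then show False using assms(3) by blast
  qed
  then show ?thesis using that by blast
qed

lemma minimal_not_lcol:
  assumes "finite M" and "\<not> lcol A M"
  obtains M' where "M' \<subseteq> M" "\<not> lcol A M'" "\<And>S. S \<subset> M' \<Longrightarrow> lcol A S"
proof -
  have "\<exists>M'. M' \<subseteq> M \<and> \<not> lcol A M' \<and> (\<forall>S. S \<subset> M' \<longrightarrow> lcol A S)"
    using assms
  proof (induction rule: finite_psubset_induct)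
    case (psubset M)
    show ?case
    proof (cases "\<forall>S. S \<subset> M \<longrightarrow> lcol A S")
      case True
      then show ?thesis using psubset.prems by blast
    next
      case False
      then obtain S where "S \<subset> M" "\<not> lcol A S" by blast
      from psubset.IH[OF this] obtain M' where "M' \<subseteq> S" "\<not> lcol A M'" "\<forall>T. T \<subset> M' \<longrightarrow> lcol A T"
        by auto
      moreover have "M' \<subseteq> M" using \<open>M' \<subseteq> S\<close> \<open>S \<subset> M\<close> by simp
      ultimately show ?thesis by auto
    qed
  qed
  then show ?thesis using that by blast
qed

text \<open>Accounting for one round: \<open>Y\<close> is coloured by \<open>c\<close>,
  \<open>M\<close> is a critical part of \<open>W\<close> for the lists that remain, and
  \<open>W - M\<close> obeys the inequality already. The lists on \<open>M\<close> are bounded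
  without the edges from \<open>M\<close> to \<open>W - M\<close>, so these stay on the left as a
  surplus. Later the surplus shows that four-vertex subtrees are critical for their residual
  lists.\<close>

lemma density_step:
  assumes fin: "finite Y" "finite W" and fA: "\<And>w. w \<in> W \<Longrightarrow> finite (A w)"
    and disj: "Y \<inter> W = {}" and MW: "M \<subseteq> W"
    and M: "(\<Sum>w\<in>M. card (res A c Y w)) \<le> (\<Sum>w\<in>M. dE M w + dD M w)"
    and R: "(\<Sum>w\<in>W - M. card (A w) + dD (W - M) w) \<le> (\<Sum>w\<in>W - M. dE (Y \<union> W) w + 2 * dD (Y \<union> W) w)"
  shows "(\<Sum>w\<in>W. card (A w) + dD W w) + (\<Sum>w\<in>M. dE (W - M) w)
    \<le> (\<Sum>w\<in>W. dE (Y \<union> W) w + 2 * dD (Y \<union> W) w)"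
proof -
  let ?R = "W - M"
  have f: "finite M" "finite ?R" using fin MW finite_subset by auto
  have W: "W = M \<union> ?R" and d: "M \<inter> ?R = {}" using MW by auto
  have split: "(\<Sum>w\<in>W. g w) = (\<Sum>w\<in>M. g w) + (\<Sum>w\<in>?R. g w)" for g :: "'a \<Rightarrow> nat"
    using sum.union_disjoint[OF f d, of g] W by simp
  have dW: "dE W w = dE M w + dE ?R w" "dD W w = dD M w + dD ?R w" for w
    using dE_Un[OF f d, of w] dD_Un[OF f d, of w] W by simp_all
  have dY: "dE (Y \<union> W) w = dE Y w + dE W w" "dD (Y \<union> W) w = dD Y w + dD W w" for w
    using dE_Un[OF fin disj, of w] dD_Un[OF fin disj, of w] by simp_all
  have swap: "(\<Sum>w\<in>?R. dD M w) = (\<Sum>w\<in>M. dD ?R w)" using sum_dD_swap[OF f(2,1)] .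
  have lists: "(\<Sum>w\<in>M. card (A w)) \<le> (\<Sum>w\<in>M. card (res A c Y w) + dE Y w + 2 * dD Y w)"
    by (rule sum_mono) (use card_res[OF fin(1)] fA MW in blast)
  have "(\<Sum>w\<in>W. card (A w) + dD W w) + (\<Sum>w\<in>M. dE ?R w)
      = (\<Sum>w\<in>M. card (A w)) + (\<Sum>w\<in>M. dD M w) + 2 * (\<Sum>w\<in>M. dD ?R w) + (\<Sum>w\<in>M. dE ?R w)
        + (\<Sum>w\<in>?R. card (A w) + dD ?R w)"
    using swap by (simp add: split dW sum.distrib)
  also have "\<dots> \<le> (\<Sum>w\<in>M. dE (Y \<union> W) w + 2 * dD (Y \<union> W) w) + (\<Sum>w\<in>?R. dE (Y \<union> W) w + 2 * dD (Y \<union> W) w)"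
    using lists M R by (simp add: dY dW sum.distrib sum_distrib_left[symmetric] algebra_simps)
  finally show ?thesis by (simp only: split)
qed

text \<open>The same accounting when nothing has been coloured and \<open>X\<close> is the set from
  \<open>not_lcol_core\<close>. There the backbone is charged over all of \<open>M\<close>, so the
  backbone edges leaving \<open>X\<close> appear on the right; the edges of \<open>E\<close> leaving
  \<open>X\<close> outweigh them.\<close>

lemma density_core:
  assumes fin: "finite M" and XM: "X \<subseteq> M" and X: "\<And>w. w \<in> X \<Longrightarrow> card (A w) \<le> dE X w + dD M w"
    and R: "(\<Sum>w\<in>M - X. card (A w) + dD (M - X) w) \<le> (\<Sum>w\<in>M - X. dE M w + 2 * dD M w)"
  shows "(\<Sum>w\<in>M. card (A w)) + (\<Sum>w\<in>X. dE (M - X) w)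
    \<le> (\<Sum>w\<in>M. dE M w + dD M w) + (\<Sum>w\<in>X. dD (M - X) w)"
proof -
  let ?R = "M - X"
  have f: "finite X" "finite ?R" using XM fin finite_subset by auto
  have M: "M = X \<union> ?R" and d: "X \<inter> ?R = {}" using XM by auto
  have split: "(\<Sum>w\<in>M. g w) = (\<Sum>w\<in>X. g w) + (\<Sum>w\<in>?R. g w)" for g :: "'a \<Rightarrow> nat"
    using sum.union_disjoint[OF f d, of g] M by simp
  have dM: "dE M w = dE X w + dE ?R w" "dD M w = dD X w + dD ?R w" for w
    using dE_Un[OF f d, of w] dD_Un[OF f d, of w] M by simp_all
  have swap: "(\<Sum>w\<in>?R. dD X w) = (\<Sum>w\<in>X. dD ?R w)" "(\<Sum>w\<in>?R. dE X w) = (\<Sum>w\<in>X. dE ?R w)"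
    using sum_dD_swap[OF f(2,1)] sum_dE_swap[OF f(2,1)] by auto
  have "(\<Sum>w\<in>X. card (A w)) \<le> (\<Sum>w\<in>X. dE X w + dD M w)" by (rule sum_mono) (use X in auto)
  then show ?thesis
    using swap R by (simp add: split dM sum.distrib sum_distrib_left[symmetric])
qed

text \<open>Nested induction on \<open>M\<close> and \<open>W\<close>. For proper \<open>W\<close>,
  the rest of \<open>M\<close> can be coloured, and a minimal uncolourable part \<open>N\<close> of
  \<open>W\<close> for the remaining lists is a smaller critical set, so the theorem applies to it;
  the inner induction covers \<open>W - N\<close>. For \<open>W = M\<close> nothing can be coloured
  beforehand, and the obstruction to rankings takes the place of \<open>N\<close>.\<close>

theorem density:
  assumes "finite M" and "\<And>w. w \<in> M \<Longrightarrow> finite (A w)" and "\<not> lcol A M"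
    and "\<And>S. S \<subset> M \<Longrightarrow> lcol A S" and "W \<subseteq> M"
  shows "(\<Sum>w\<in>W. card (A w) + dD W w) \<le> (\<Sum>w\<in>W. dE M w + 2 * dD M w)"
  using assms
proof (induction "card M" arbitrary: M A W rule: less_induct)
  case less
  note outer = less.hyps and fin = less.prems(1) and fA = less.prems(2) and nl = less.prems(3) and sub = less.prems(4)
  have proper: "(\<Sum>w\<in>W. card (A w) + dD W w) \<le> (\<Sum>w\<in>W. dE M w + 2 * dD M w)" if "W \<subset> M" for W
    using that
  proof (induction "card W" arbitrary: W rule: less_induct)
    case (less W)
    note IH = less.hyps and WM = less.prems
    have fW: "finite W" using WM fin finite_subset by blast
    show ?case
    proof (cases "W = {}")
      case False
      let ?Y = "M - W"
      have Ysub: "?Y \<subset> M" using WM False by blast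
      then obtain c where c: "ok A ?Y c" using sub unfolding lcol_def by blast
      have MU: "?Y \<union> W = M" using WM by blast
      have "\<not> lcol (res A c ?Y) W" using lcol_extend[OF c, of W] nl MU by auto
      from minimal_not_lcol[OF fW this]
      obtain N where N: "N \<subseteq> W" "\<not> lcol (res A c ?Y) N" "\<And>S. S \<subset> N \<Longrightarrow> lcol (res A c ?Y) S" by blast
      have "N \<noteq> {}" using N(2) lcol_empty by blast
      have "card N < card M" using N(1) WM fin by (meson order_le_less_trans psubset_card_mono)
      have "(\<Sum>w\<in>N. card (res A c ?Y w) + dD N w) \<le> (\<Sum>w\<in>N. dE N w + 2 * dD N w)"
      proof (rule outer[OF \<open>card N < card M\<close>])
        show "finite N" using N(1) fW finite_subset by blast
        show "finite (res A c ?Y w)" if "w \<in> N" for w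
          using that N(1) WM fA by (auto simp: res_def)
      qed (use N in auto)
      then have full: "(\<Sum>w\<in>N. card (res A c ?Y w)) \<le> (\<Sum>w\<in>N. dE N w + dD N w)"
        by (simp add: sum.distrib sum_distrib_left[symmetric])
      have "(\<Sum>w\<in>W - N. card (A w) + dD (W - N) w) \<le> (\<Sum>w\<in>W - N. dE M w + 2 * dD M w)"
        by (rule IH) (use N(1) \<open>N \<noteq> {}\<close> WM fW in \<open>auto intro!: psubset_card_mono\<close>)
      moreover have "finite ?Y" "?Y \<inter> W = {}" "\<And>w. w \<in> W \<Longrightarrow> finite (A w)" using fin fA WM by auto
      ultimately have "(\<Sum>w\<in>W. card (A w) + dD W w) + (\<Sum>w\<in>N. dE (W - N) w) \<le> (\<Sum>w\<in>W. dE M w + 2 * dD M w)"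
        using density_step[of ?Y W A N c] fW N(1) full unfolding MU by blast
      then show ?thesis by (rule add_leD1)
    qed simp
  qed
  show ?case
  proof (cases "W = M")
    case False
    then show ?thesis using proper less.prems(5) by blast
  next
    case True
    obtain X where X: "X \<subseteq> M" "X \<noteq> {}" "\<And>w. w \<in> X \<Longrightarrow> card (A w) \<le> dE X w + dD M w"
      using not_lcol_core[OF fin fA nl] by blast
    have "(\<Sum>w\<in>M - X. card (A w) + dD (M - X) w) \<le> (\<Sum>w\<in>M - X. dE M w + 2 * dD M w)"
      by (rule proper) (use X in auto)
    from density_core[OF fin X(1,3) this]
    have "(\<Sum>w\<in>M. card (A w)) + (\<Sum>w\<in>X. dE (M - X) w) \<le> (\<Sum>w\<in>M. dE M w + dD M w) + (\<Sum>w\<in>X. dD (M - X) w)"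
      by blast
    moreover have "(\<Sum>w\<in>X. dD (M - X) w) \<le> (\<Sum>w\<in>X. dE (M - X) w)"
      using dD_le_dE fin by (intro sum_mono) auto
    ultimately show ?thesis unfolding True by (simp add: sum.distrib sum_distrib_left[symmetric])
  qed
qed

text \<open>When \<open>density_core\<close> excludes every proper stuck set, the stuck set is
  \<open>M\<close> itself, which bounds each single list. \<open>density\<close> for one vertex
  would only give \<open>dE M w + 2 * dD M w\<close>.\<close>

lemma density_tight:
  assumes "finite M" and "\<And>w. w \<in> M \<Longrightarrow> finite (A w)" and "\<not> lcol A M"
    and "\<And>S. S \<subset> M \<Longrightarrow> lcol A S"
    and strict: "\<And>X. X \<subset> M \<Longrightarrow> X \<noteq> {} \<Longrightarrow>
      (\<Sum>w\<in>M. dE M w + dD M w) + (\<Sum>w\<in>X. dD (M - X) w) < (\<Sum>w\<in>M. card (A w)) + (\<Sum>w\<in>X. dE (M - X) w)"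
    and "w \<in> M"
  shows "card (A w) \<le> dE M w + dD M w"
proof -
  obtain X where X: "X \<subseteq> M" "X \<noteq> {}" "\<And>w. w \<in> X \<Longrightarrow> card (A w) \<le> dE X w + dD M w"
    using not_lcol_core[OF assms(1-3)] by blast
  show ?thesis
  proof (cases "X = M")
    case True
    then show ?thesis using X(3) \<open>w \<in> M\<close> by simp
  next
    case False
    have "(\<Sum>w\<in>M - X. card (A w) + dD (M - X) w) \<le> (\<Sum>w\<in>M - X. dE M w + 2 * dD M w)"
      by (rule density[OF assms(1-4)]) auto
    from density_core[OF assms(1) X(1,3) this] strict[of X] X(1,2) False show ?thesis
      by (simp add: psubset_eq)
  qed
qed

end

section \<open>Colours at distance two\<close>

lemma card_le_span: "finite (A :: nat set) \<Longrightarrow> A \<noteq> {} \<Longrightarrow> card A \<le> Max A - Min A + 1"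
proof -
  assume "finite A" "A \<noteq> {}"
  then have "A \<subseteq> {Min A..Max A}" by auto
  from card_mono[OF _ this] have "card A \<le> Suc (Max A) - Min A" by simp
  moreover have "Min A \<le> Max A" using \<open>finite A\<close> \<open>A \<noteq> {}\<close> by simp
  ultimately show ?thesis by linarith
qed

lemma no_far_span:
  assumes "finite A" "finite B" "A \<noteq> {}" "B \<noteq> {}" and "\<And>a b. a \<in> A \<Longrightarrow> b \<in> B \<Longrightarrow> \<not> far a b"
  shows "Max A \<le> Min B + 1" "Max B \<le> Min A + 1" "Min A \<le> Max A" "Min B \<le> Max B"
proof -
  have "Max A \<in> A" "Min A \<in> A" "Max B \<in> B" "Min B \<in> B" using assms(1-4) by simp_all
  then show "Max A \<le> Min B + 1" "Max B \<le> Min A + 1"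
    using assms(5)[of "Max A" "Min B"] assms(5)[of "Min A" "Max B"] by (auto simp: far_def)
  show "Min A \<le> Max A" "Min B \<le> Max B" using assms(1-4) by simp_all
qed

text \<open>Without a far pair each maximum exceeds the minimum of the other set by at most 1, so
  the lengths of the two spanned intervals add up to at most 4.\<close>

lemma far_pair:
  assumes "finite A" "finite B" "A \<noteq> {}" "B \<noteq> {}" and "5 \<le> card A + card B"
  obtains a b where "a \<in> A" "b \<in> B" "far a b"
proof -
  have "\<exists>a\<in>A. \<exists>b\<in>B. far a b"
  proof (rule ccontr)
    assume n: "\<not> ?thesis"
    have "Max A \<le> Min B + 1" "Max B \<le> Min A + 1" "Min A \<le> Max A" "Min B \<le> Max B"
      using no_far_span[of A B] assms(1-4) n by blast+
    then show False using card_le_span[of A] card_le_span[of B] assms by linarith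
  qed
  then show ?thesis using that by blast
qed

text \<open>The equality case of \<open>far_pair\<close>: both intervals have length exactly 2 and
  start at the same place.\<close>

lemma no_far_two_two:
  assumes "card A = 2" "card B = 2" and "\<And>a b. a \<in> A \<Longrightarrow> b \<in> B \<Longrightarrow> \<not> far a b"
  obtains m where "A = {m, m + 1}" "B = {m, m + 1}"
proof -
  have f: "finite A" "finite B" using assms card.infinite by fastforce+
  have ne: "A \<noteq> {}" "B \<noteq> {}" using assms by auto
  have sp: "Max A \<le> Min B + 1" "Max B \<le> Min A + 1" "Min A \<le> Max A" "Min B \<le> Max B"
    using no_far_span[OF f ne assms(3)] by blast+
  have m: "Max A = Min A + 1" "Max B = Min B + 1" "Min A = Min B"
    using sp card_le_span[OF f(1) ne(1)] card_le_span[OF f(2) ne(2)] assms(1,2) by linarith+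
  have "{Min A, Max A} \<subseteq> A" "{Min B, Max B} \<subseteq> B" using Min_in[OF f(1) ne(1)] Max_in[OF f(1) ne(1)]
    Min_in[OF f(2) ne(2)] Max_in[OF f(2) ne(2)] by blast+
  moreover have "card {Min A, Max A} = card A" "card {Min B, Max B} = card B" using m assms(1,2) by simp_all
  ultimately have e: "{Min A, Max A} = A" "{Min B, Max B} = B" using card_subset_eq f by blast+
  show ?thesis
    by (rule that[of "Min A"]) (rule e(1)[unfolded m(1), symmetric], rule e(2)[unfolded m(2), folded m(3), symmetric])
qed

lemma card_Diff1_ge: "finite A \<Longrightarrow> n + 1 \<le> card A \<Longrightarrow> n \<le> card (A - {x})"
  by (cases "x \<in> A") auto

lemma card_Diff2_ge: "finite A \<Longrightarrow> n + 2 \<le> card A \<Longrightarrow> n \<le> card (A - {x, y})"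
  using card_Diff1_ge[of A "n + 1" x] card_Diff1_ge[of "A - {x}" n y] by (simp add: Diff_insert2[symmetric] insert_commute)

text \<open>Lists for a triangle whose backbone is the edge of \<open>q\<close> and
  \<open>r\<close>. Each \<open>p\<close> must leave two lists of size 2 without a far pair, hence
  twice the same two consecutive numbers. So \<open>p\<close> is an end of the interval
  \<open>Q = R\<close>, and two different choices of \<open>p\<close> give both ends.\<close>

lemma triangle_exception:
  assumes fin: "finite P" "finite Q" "finite R" and card: "2 \<le> card P" "3 \<le> card Q" "3 \<le> card R"
    and none: "\<And>p q r. p \<in> P \<Longrightarrow> q \<in> Q \<Longrightarrow> r \<in> R \<Longrightarrow> p \<noteq> q \<Longrightarrow> p \<noteq> r \<Longrightarrow> \<not> far q r"
  obtains b where "P = {b, b + 2}" "Q = {b, b + 1, b + 2}" "R = {b, b + 1, b + 2}"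
proof -
  have z: "\<exists>m. p \<in> Q \<and> Q - {p} = {m, m + 1} \<and> R = Q" if p: "p \<in> P" for p
  proof -
    have nf: "\<And>q r. q \<in> Q - {p} \<Longrightarrow> r \<in> R - {p} \<Longrightarrow> \<not> far q r" using none[OF p] by blast
    have ge: "2 \<le> card (Q - {p})" "2 \<le> card (R - {p})"
      by (rule card_Diff1_ge; use fin card in simp)+
    then have ne: "Q - {p} \<noteq> {}" "R - {p} \<noteq> {}" by (metis card.empty not_numeral_le_zero)+
    have lt: "\<not> 5 \<le> card (Q - {p}) + card (R - {p})"
      using far_pair[of "Q - {p}" "R - {p}"] fin ne nf by (metis finite_Diff)
    then have c2: "card (Q - {p}) = 2" "card (R - {p}) = 2" using ge by linarith+
    then have pQ: "p \<in> Q" "p \<in> R" using card(2,3) by (cases "p \<in> Q"; cases "p \<in> R"; simp)+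
    obtain m where m: "Q - {p} = {m, m + 1}" "R - {p} = {m, m + 1}" by (rule no_far_two_two[OF c2 nf])
    then have "Q = insert p {m, m + 1}" "R = insert p {m, m + 1}" using pQ m by blast+
    then show ?thesis using pQ m by blast
  qed
  obtain p q where pq: "p \<in> P" "q \<in> P" "p < q"
  proof -
    obtain x y where "x \<in> P" "y \<in> P" "x \<noteq> y" using card(1)
      by (metis card_le_Suc0_iff_eq fin(1) not_less_eq_eq numeral_2_eq_2)
    then show ?thesis using that by (meson linorder_neqE_nat)
  qed
  obtain m where m: "p \<in> Q" "Q - {p} = {m, m + 1}" "R = Q" using z[OF pq(1)] by blast
  obtain n where n: "q \<in> Q" "Q - {q} = {n, n + 1}" using z[OF pq(2)] by blast
  have Q: "Q = {p, m, m + 1}" "Q = {q, n, n + 1}" using m n by auto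
  have "q \<in> {p, m, m + 1}" "p \<in> {q, n, n + 1}" "m \<in> {q, n, n + 1}" "m + 1 \<in> {q, n, n + 1}"
    using m(1) n(1) Q by blast+
  moreover have "m \<noteq> p" "m + 1 \<noteq> p" using m(2) by blast+
  ultimately have "p = n \<and> q = p + 2 \<and> m = p + 1" using pq(3) unfolding insert_iff empty_iff by simp presburger
  then have pn: "q = p + 2" "m = p + 1" by blast+
  have QQ: "Q = {p, p + 1, p + 2}" unfolding Q(1) pn(2) by simp
  have "x \<in> {p, p + 2}" if x: "x \<in> P" for x
  proof -
    obtain l where l: "x \<in> Q" "Q - {x} = {l, l + 1}" using z[OF x] by blast
    show ?thesis
    proof (rule ccontr)
      assume "\<not> ?thesis"
      then have x1: "x = p + 1" using l(1) unfolding QQ by blast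
      have "Q - {p + 1} = {p, p + 2}" unfolding QQ by auto
      then have "{l, l + 1} = {p, p + 2}" using l(2) unfolding x1 by simp
      then show False by (auto simp: doubleton_eq_iff)
    qed
  qed
  then have "P = {p, p + 2}" using pq(1,2) unfolding pn(1) by blast
  then show ?thesis using that[of p] QQ m(3) by simp
qed

text \<open>Lists for a complete graph on four vertices with a perfect matching as backbone. If the
  smallest colour \<open>m\<close> of all is given to one vertex, its partner loses only
  \<open>m + 1\<close> besides \<open>m\<close>. A triangle remains, so only the lists of
  \<open>triangle_exception\<close> can be in the way; they contradict the list sizes or are
  explicit enough to colour differently.\<close>

lemma two_far_pairs:
  assumes fin: "finite X" "finite Y" "finite Z" "finite W"
    and card: "3 \<le> card X" "4 \<le> card Y" "4 \<le> card Z" "4 \<le> card W"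
  shows "\<exists>x\<in>X. \<exists>y\<in>Y. \<exists>z\<in>Z. \<exists>w\<in>W. distinct [x, y, z, w] \<and> far x y \<and> far z w"
proof (rule ccontr)
  assume "\<not> ?thesis"
  then have none: "\<not> (far x y \<and> far z w)" if "x \<in> X" "y \<in> Y" "z \<in> Z" "w \<in> W" "distinct [x, y, z, w]" for x y z w
    using that by blast
  define m where "m = Min (X \<union> Y \<union> Z \<union> W)"
  have ne: "X \<union> Y \<union> Z \<union> W \<noteq> {}" using card by auto
  have min: "\<And>i. i \<in> X \<union> Y \<union> Z \<union> W \<Longrightarrow> m \<le> i" unfolding m_def using fin by simp
  \<comment> \<open>If \<open>m\<close> is missing from \<open>X\<close> and \<open>Y\<close>, these
    lists stay intact after \<open>m\<close> is used in the other pair, and \<open>Y\<close> is too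
    long for the exception.\<close>
  have smallest: False
    if fin': "finite A" "finite B" and card': "4 \<le> card B" and m: "m \<notin> X" "m \<notin> Y" "m \<in> A"
      and min': "\<And>i. i \<in> B \<Longrightarrow> m \<le> i"
      and none': "\<And>x y z w. x \<in> X \<Longrightarrow> y \<in> Y \<Longrightarrow> z \<in> A \<Longrightarrow> w \<in> B \<Longrightarrow> distinct [x, y, z, w] \<Longrightarrow> \<not> (far x y \<and> far z w)"
    for A B
  proof -
    have far: "far m w" if "w \<in> B - {m, m + 1}" for w using min'[of w] that by (auto simp: far_def)
    obtain b where b: "Y = {b, b + 1, b + 2}"
    proof (rule triangle_exception[of "B - {m, m + 1}" X Y])
      show "2 \<le> card (B - {m, m + 1})" by (rule card_Diff2_ge) (use fin' card' in auto)
      fix p q r assume h: "p \<in> B - {m, m + 1}" "q \<in> X" "r \<in> Y" "p \<noteq> q" "p \<noteq> r"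
      show "\<not> far q r"
      proof
        assume qr: "far q r"
        then have "q \<noteq> r" by (auto simp: far_def)
        then show False using none'[of q r m p] m h far[OF h(1)] qr by auto
      qed
    qed (use fin fin' card that in auto)
    then show False using card(2) by simp
  qed
  have "m \<in> X \<union> Y \<union> Z \<union> W" unfolding m_def using fin ne by (intro Min_in) auto
  then consider "m \<in> X" | "m \<notin> X" "m \<in> Y" | "m \<notin> X" "m \<notin> Y" "m \<in> Z" | "m \<notin> X" "m \<notin> Y" "m \<in> W" by blast
  then show False
  proof cases
    case 1
    have far: "far m y" if "y \<in> Y - {m, m + 1}" for y using min[of y] that by (auto simp: far_def)
    obtain b where b: "Y - {m, m + 1} = {b, b + 2}" "Z - {m} = {b, b + 1, b + 2}" "W - {m} = {b, b + 1, b + 2}"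
    proof (rule triangle_exception[of "Y - {m, m + 1}" "Z - {m}" "W - {m}"])
      show "2 \<le> card (Y - {m, m + 1})" by (rule card_Diff2_ge) (use fin card in auto)
      show "3 \<le> card (Z - {m})" "3 \<le> card (W - {m})" by (rule card_Diff1_ge; use fin card in auto)+
      fix p q r assume h: "p \<in> Y - {m, m + 1}" "q \<in> Z - {m}" "r \<in> W - {m}" "p \<noteq> q" "p \<noteq> r"
      show "\<not> far q r"
      proof
        assume qr: "far q r"
        then have "q \<noteq> r" by (auto simp: far_def)
        then show False using none[of m p q r] 1 h far[OF h(1)] qr by auto
      qed
    qed (use fin that in auto)
    have "card (Z - {m}) = 3" "card (W - {m}) = 3" using b by simp_all
    then have mZW: "m \<in> Z" "m \<in> W" using card(3,4) by (cases "m \<in> Z"; cases "m \<in> W"; simp)+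
    have "card (Y - {m, m + 1}) = 2" using b by simp
    have "b \<in> Y - {m, m + 1}" unfolding b(1) by simp
    then have bm: "m + 2 \<le> b" using min[of b] by auto
    have Y: "m \<in> Y" "b \<in> Y" "b + 2 \<in> Y" "m + 1 \<in> Y"
    proof -
      have sub: "Y \<subseteq> insert m (insert (m + 1) {b, b + 2})" using b(1) by blast
      have "card Y = card (insert m (insert (m + 1) {b, b + 2}))"
        using card_mono[OF _ sub] card(2) bm by simp
      then have "Y = insert m (insert (m + 1) {b, b + 2})" by (intro card_subset_eq) (use sub in auto)
      then show "m \<in> Y" "b \<in> Y" "b + 2 \<in> Y" "m + 1 \<in> Y" by auto
    qed
    have "b + 1 \<in> W - {m}" "b \<in> Z - {m}" "b + 2 \<in> W - {m}" unfolding b(2,3) by simp_all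
    then have ZW: "b + 1 \<in> W" "b \<in> Z" "b + 2 \<in> W" by blast+
    show False
    proof (cases "b + 1 \<in> X")
      case True
      then show False using none[of "b + 1" m b "b + 2"] Y ZW bm by (auto simp: far_def)
    next
      case False
      \<comment> \<open>Now \<open>z\<close> gets \<open>m\<close> and \<open>w\<close> gets
        \<open>b + 1\<close>, which leaves at least 2 + 3 colours for the other pair.\<close>
      have "X - {m, b + 1} = X - {m}" using False by auto
      then have X2: "2 \<le> card (X - {m, b + 1})" using card_Diff1_ge[of X 2 m] fin card by simp
      then have "X - {m, b + 1} \<noteq> {}" by (metis card.empty not_numeral_le_zero)
      moreover have "5 \<le> card (X - {m, b + 1}) + card {m + 1, b, b + 2}" using bm X2 by simp
      ultimately obtain x y where "x \<in> X - {m, b + 1}" "y \<in> {m + 1, b, b + 2}" "far x y"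
        using far_pair[of "X - {m, b + 1}" "{m + 1, b, b + 2}"] fin by blast
      then show False using none[of x y m "b + 1"] Y ZW bm mZW by (auto simp: far_def)
    qed
  next
    case 2
    have far: "far x m" if "x \<in> X - {m + 1}" for x
    proof -
      have "m \<le> x" "x \<noteq> m" "x \<noteq> m + 1" using min[of x] that 2 by auto
      then show ?thesis by (simp add: far_def)
    qed
    obtain b where b: "X - {m + 1} = {b, b + 2}" "Z - {m} = {b, b + 1, b + 2}" "W - {m} = {b, b + 1, b + 2}"
    proof (rule triangle_exception[of "X - {m + 1}" "Z - {m}" "W - {m}"])
      show "2 \<le> card (X - {m + 1})" "3 \<le> card (Z - {m})" "3 \<le> card (W - {m})"
        by (rule card_Diff1_ge; use fin card in auto)+
      fix p q r assume h: "p \<in> X - {m + 1}" "q \<in> Z - {m}" "r \<in> W - {m}" "p \<noteq> q" "p \<noteq> r"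
      show "\<not> far q r"
      proof
        assume qr: "far q r"
        then have "q \<noteq> r" by (auto simp: far_def)
        then show False using none[of p m q r] 2 h far[OF h(1)] qr by auto
      qed
    qed (use fin that in auto)
    have "card (Z - {m}) = 3" using b by simp
    then have mZ: "m \<in> Z" using card(3) by (cases "m \<in> Z") auto
    have "b \<in> Z - {m}" unfolding b(2) by simp
    then have bm: "m + 1 \<le> b" using min[of b] by (cases "b = m") auto
    have "b + 1 \<notin> X - {m + 1}" unfolding b(1) by simp
    then have "b + 1 \<notin> X" using bm by simp
    then have "X - {m, b + 1} = X" using 2 by auto
    moreover have bW: "b + 1 \<in> W"
    proof -
      have "b + 1 \<in> W - {m}" unfolding b(3) by simp
      then show ?thesis by blast
    qed
    moreover have Y2: "2 \<le> card (Y - {m, b + 1})" by (rule card_Diff2_ge) (use fin card in auto)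
    then have "Y - {m, b + 1} \<noteq> {}" by (metis card.empty not_numeral_le_zero)
    moreover have "X \<noteq> {}" using card(1) by auto
    moreover note Y2
    ultimately have "finite (X - {m, b + 1})" "finite (Y - {m, b + 1})" "X - {m, b + 1} \<noteq> {}" "Y - {m, b + 1} \<noteq> {}"
        "5 \<le> card (X - {m, b + 1}) + card (Y - {m, b + 1})"
      using fin card by simp_all
    then obtain x y where "x \<in> X - {m, b + 1}" "y \<in> Y - {m, b + 1}" "far x y" by (rule far_pair)
    then show False using none[of x y m "b + 1"] bW bm mZ by (auto simp: far_def)
  next
    case 3
    show False by (rule smallest[OF fin(3,4) card(4) 3 _ none]) (use min in auto)
  next
    case 4
    have none4: "\<not> (far x y \<and> far z w)" if "x \<in> X" "y \<in> Y" "z \<in> W" "w \<in> Z" "distinct [x, y, z, w]" for x y z w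
      using none[OF that(1,2,4,3)] that(5) far_sym[of z w] by auto
    show False by (rule smallest[OF fin(4,3) card(3) 4(1,2,3) _ none4]) (use min in auto)
  qed
qed

text \<open>The last list pattern of \<open>diamond_shape\<close>: everything is adjacent except
  \<open>a\<close> and \<open>c\<close>, and the backbone is ab, cu. For fixed
  \<open>a \<noteq> u\<close> the other two vertices fail only if both are left with one and the
  same colour \<open>z\<close>, which determines \<open>B\<close> and \<open>C\<close> completely.
  Different choices of \<open>a\<close> and \<open>u\<close> then contradict each other.\<close>

lemma leaf_apex_lists:
  assumes fin: "finite A" "finite B" "finite U" "finite C"
    and card: "2 \<le> card A" "5 \<le> card B" "2 \<le> card U" "4 \<le> card C" "card B \<le> 5" "card C \<le> 4"
  shows "\<exists>a\<in>A. \<exists>b\<in>B. \<exists>u\<in>U. \<exists>c\<in>C. far a b \<and> far c u \<and> a \<noteq> u \<and> b \<noteq> u \<and> b \<noteq> c"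
proof (rule ccontr)
  assume n: "\<not> ?thesis"
  have key: "\<exists>z. B = {a - 1, a, a + 1, u, z} \<and> C = {u - 1, u, u + 1, z} \<and> card {a - 1, a, a + 1, u, z} = 5
      \<and> card {u - 1, u, u + 1, z} = 4" if au: "a \<in> A" "u \<in> U" "a \<noteq> u" for a u
  proof -
    define B' where "B' = B - {a - 1, a, a + 1, u}"
    define C' where "C' = C - {u - 1, u, u + 1}"
    have eq: "b = c" if "b \<in> B'" "c \<in> C'" for b c
    proof (rule ccontr)
      assume "b \<noteq> c"
      have "far a b" "far c u" using that unfolding B'_def C'_def far_def by auto
      then show False using n au that \<open>b \<noteq> c\<close> unfolding B'_def C'_def by auto
    qed
    have l: "card {a - 1, a, a + 1, u} \<le> 4" "card {u - 1, u, u + 1} \<le> 3" by (simp_all add: card_insert_le_m1)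
    have "card B - card {a - 1, a, a + 1, u} \<le> card B'" "card C - card {u - 1, u, u + 1} \<le> card C'"
      unfolding B'_def C'_def by (rule diff_card_le_card_Diff; simp)+
    then have ge: "1 \<le> card B'" "1 \<le> card C'" using l card by linarith+
    then obtain z w where zw: "z \<in> B'" "w \<in> C'" by fastforce
    have B': "B' = {z}" using eq zw by blast
    have C': "C' = {z}" using eq zw by blast
    have sub: "B \<subseteq> {a - 1, a, a + 1, u, z}" "C \<subseteq> {u - 1, u, u + 1, z}"
      using B' C' unfolding B'_def C'_def by blast+
    have le: "card {a - 1, a, a + 1, u, z} \<le> 5" "card {u - 1, u, u + 1, z} \<le> 4" by (simp_all add: card_insert_le_m1)
    have "card B \<le> card {a - 1, a, a + 1, u, z}" "card C \<le> card {u - 1, u, u + 1, z}"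
      by (rule card_mono[OF _ sub(1)], simp) (rule card_mono[OF _ sub(2)], simp)
    then have c: "card {a - 1, a, a + 1, u, z} = 5" "card {u - 1, u, u + 1, z} = 4" using le card by linarith+
    have "B = {a - 1, a, a + 1, u, z}" by (rule card_subset_eq) (use sub c card in auto)
    moreover have "C = {u - 1, u, u + 1, z}" by (rule card_subset_eq) (use sub c card in auto)
    ultimately show ?thesis using c by blast
  qed
  have two: "\<exists>y\<in>S. y \<noteq> x" if "2 \<le> card S" for S and x :: nat
  proof (rule ccontr)
    assume "\<not> ?thesis"
    then have "S \<subseteq> {x}" by blast
    then show False using that card_mono[of "{x}" S] by simp
  qed
  have distinct5: "a \<ge> 1 \<and> u + 1 < a \<or> a \<ge> 1 \<and> a + 1 < u" if "card {a - 1, a, a + 1, u, z} = 5" for a u z :: nat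
  proof -
    have "distinct [a - 1, a, a + 1, u, z]" using that by (intro card_distinct) simp
    then show ?thesis by auto
  qed
  have distinct4: "distinct [u - 1, u, u + 1, z]" if "card {u - 1, u, u + 1, z} = 4" for u z :: nat
    using that by (intro card_distinct) simp
  \<comment> \<open>For fixed \<open>u\<close> the list \<open>C\<close> determines
    \<open>z\<close>, so \<open>B\<close> leaves only one place for the interval
    \<open>a - 1\<close>, \<open>a\<close>, \<open>a + 1\<close>.\<close>
  have same_u: "a = a'" if au: "a \<in> A" "a' \<in> A" "u \<in> U" "a \<noteq> u" "a' \<noteq> u" for a a' u
  proof -
    obtain z where z: "B = {a - 1, a, a + 1, u, z}" "C = {u - 1, u, u + 1, z}"
      "card {a - 1, a, a + 1, u, z} = 5" "card {u - 1, u, u + 1, z} = 4" using key[OF au(1,3,4)] by blast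
    obtain z' where z': "B = {a' - 1, a', a' + 1, u, z'}" "C = {u - 1, u, u + 1, z'}"
      "card {a' - 1, a', a' + 1, u, z'} = 5" "card {u - 1, u, u + 1, z'} = 4" using key[OF au(2,3,5)] by blast
    have "z \<in> {u - 1, u, u + 1, z'}" using z(2) z'(2) by blast
    then have zz: "z = z'" using distinct4[OF z(4)] by auto
    have d: "distinct [a - 1, a, a + 1, u, z]" "distinct [a' - 1, a', a' + 1, u, z]"
      using z(3) z'(3) unfolding zz by (intro card_distinct; simp)+
    have "a' \<in> {a - 1, a, a + 1, u, z}" "a' + 1 \<in> {a - 1, a, a + 1, u, z}" "a' - 1 \<in> {a - 1, a, a + 1, u, z}"
      using z(1) z'(1) by blast+
    then have "a' \<in> {a - 1, a, a + 1}" "a' + 1 \<in> {a - 1, a, a + 1}" "a' - 1 \<in> {a - 1, a, a + 1}"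
      using d(2) by simp_all
    moreover have "a - 1 \<noteq> a" "a' - 1 \<noteq> a'" using d by simp_all
    then have "1 \<le> a" "1 \<le> a'" by linarith+
    ultimately show ?thesis by simp linarith
  qed
  have U_A: "\<exists>y\<in>A. y \<noteq> u" for u by (rule two[OF card(1)])
  obtain u where u: "u \<in> U" using two[OF card(3)] by blast
  obtain a where a: "a \<in> A" "a \<noteq> u" using two[OF card(1)] by blast
  obtain a' where a': "a' \<in> A" "a' \<noteq> a" using two[OF card(1)] by blast
  have a'u: "a' = u" using same_u[OF a(1) a'(1) u a(2)] a' by blast
  obtain u' where u': "u' \<in> U" "u' \<noteq> u" using two[OF card(3)] by blast
  have u'a: "u' = a" using same_u[OF a(1) a'(1) u'(1)] a'(2) a'u u'(2) by blast
  obtain z where z: "B = {a - 1, a, a + 1, u, z}" "C = {u - 1, u, u + 1, z}"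
      "card {a - 1, a, a + 1, u, z} = 5" "card {u - 1, u, u + 1, z} = 4" using key[OF a(1) u a(2)] by blast
  \<comment> \<open>Both \<open>A\<close> and \<open>U\<close> contain both colours, so the roles of
    \<open>a\<close> and \<open>u\<close> can be exchanged.\<close>
  obtain w where w: "C = {a - 1, a, a + 1, w}"
    using key[of u a] a'(1) a'u u'(1) u'a a(2) by blast
  have m: "a - 1 \<in> {u - 1, u, u + 1, z}" "a \<in> {u - 1, u, u + 1, z}" "a + 1 \<in> {u - 1, u, u + 1, z}" using z(2) w by blast+
  from distinct5[OF z(3)] show False
  proof (elim disjE conjE)
    assume "1 \<le> a" "u + 1 < a"
    then have "a = z" "a + 1 = z" using m(2,3) by (simp; linarith)+
    then show False by simp
  next
    assume "1 \<le> a" "a + 1 < u"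
    then have "a = z" "a - 1 = z" using m(1,2) by (simp; linarith)+
    then show False using \<open>1 \<le> a\<close> by simp
  qed
qed

section \<open>Minimal counterexamples and the elimination tree\<close>

fun pair_sum :: "('b \<Rightarrow> 'c set) \<Rightarrow> 'b list \<Rightarrow> nat" where
  "pair_sum N [] = 0"
| "pair_sum N (x # xs) = (\<Sum>y\<leftarrow>xs. card (N x \<inter> N y)) + pair_sum N xs"

lemma card_Int_UN_le:
  "finite A \<Longrightarrow> card (A \<inter> (\<Union>y\<in>set xs. N y)) \<le> (\<Sum>y\<leftarrow>xs. card (A \<inter> N y))"
proof (induction xs)
  case (Cons x xs)
  let ?U = "\<Union>y\<in>set xs. N y"
  have eq: "A \<inter> (\<Union>y\<in>set (x # xs). N y) = (A \<inter> N x) \<union> (A \<inter> ?U)" by auto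
  have "card (A \<inter> (\<Union>y\<in>set (x # xs). N y)) \<le> card (A \<inter> N x) + card (A \<inter> ?U)"
    unfolding eq by (rule card_Un_le)
  also have "\<dots> \<le> card (A \<inter> N x) + (\<Sum>y\<leftarrow>xs. card (A \<inter> N y))"
    using Cons.IH[OF Cons.prems] by (rule add_left_mono)
  finally show ?case by simp
qed simp

text \<open>This is how the absence of 4-cycles is exploited: sets that pairwise share at most one
  element have a large union, while they all lie in one clique.\<close>

lemma bonferroni:
  assumes "\<And>x. x \<in> set xs \<Longrightarrow> finite (N x)"
  shows "(\<Sum>x\<leftarrow>xs. card (N x)) \<le> card (\<Union>x\<in>set xs. N x) + pair_sum N xs"
  using assms
proof (induction xs)
  case (Cons x xs)
  let ?U = "\<Union>y\<in>set xs. N y"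
  have f: "finite (N x)" "finite ?U" using Cons.prems by auto
  have "card (N x) + card ?U = card (N x \<union> ?U) + card (N x \<inter> ?U)"
    using card_Un_Int[OF f] by simp
  moreover have "card (N x \<inter> ?U) \<le> (\<Sum>y\<leftarrow>xs. card (N x \<inter> N y))" by (rule card_Int_UN_le[OF f(1)])
  moreover have "(\<Sum>x\<leftarrow>xs. card (N x)) \<le> card ?U + pair_sum N xs" using Cons by simp
  moreover have "(\<Union>y\<in>set (x # xs). N y) = N x \<union> ?U" by simp
  ultimately show ?case by (simp del: UN_simps)
qed simp

text \<open>\<open>E\<close> and \<open>D\<close> are taken as already restricted to a minimal
  uncolourable set \<open>V\<close>, \<open>f\<close> is a perfect elimination order, and
  \<open>common\<close> says that the backbone has no 4-cycle. As
  \<open>s = k - (\<omega> - 1)\<close>, a vertex keeps at least \<open>s\<close> colours after its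
  higher neighbours have been coloured, apart from the extra losses along the backbone.\<close>

locale critical = backbone +
  fixes V :: "'a set" and f :: "'a \<Rightarrow> nat" and k s \<omega> :: nat
  assumes finV: "finite V"
    and E_V: "E u v \<Longrightarrow> u \<in> V"
    and inj_f: "inj_on f V"
    and peo: "E v x \<Longrightarrow> f v < f x \<Longrightarrow> E v y \<Longrightarrow> f v < f y \<Longrightarrow> x \<noteq> y \<Longrightarrow> E x y"
    and card_higher: "card {x. E v x \<and> f v < f x} < \<omega>"
    and common: "D u x \<Longrightarrow> D x v \<Longrightarrow> D u y \<Longrightarrow> D y v \<Longrightarrow> u \<noteq> v \<Longrightarrow> x = y"
    and not_col: "\<not> lcol (\<lambda>_. {1..k}) V"
    and sub_col: "S \<subset> V \<Longrightarrow> lcol (\<lambda>_. {1..k}) S"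
    and k_eq: "k + 1 = s + \<omega>"
    and \<omega>_le: "\<omega> + 9 \<le> 2 * s"
    and s_ge: "10 \<le> s"
begin

definition K :: "'a \<Rightarrow> 'a set" where
  "K v = {x. E v x \<and> f v < f x}"

definition up :: "'a set \<Rightarrow> 'a \<Rightarrow> nat" where
  "up C w = card {y \<in> C. E w y \<and> f w < f y}"

definition out :: "'a set \<Rightarrow> 'a \<Rightarrow> 'a set" where
  "out C w = {y. D w y \<and> y \<notin> C}"

text \<open>Vertices of \<open>C\<close> have only higher neighbours outside \<open>C\<close>, all of them in \<open>Q\<close>; in applications \<open>Q\<close> is a clique.\<close>

definition block :: "'a set \<Rightarrow> 'a set \<Rightarrow> bool" where
  "block C Q \<longleftrightarrow> C \<subseteq> V \<and> Q \<subseteq> V \<and> (\<forall>w\<in>C. \<forall>y. E w y \<longrightarrow> y \<in> C \<or> y \<in> Q \<and> f w < f y)"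

lemma E_V2: "E u v \<Longrightarrow> v \<in> V"
  using E_V[OF E_sym] .

lemma f_neq: "E u v \<Longrightarrow> f u \<noteq> f v"
proof
  assume "E u v" "f u = f v"
  then have "u = v" using inj_onD[OF inj_f, of u v] E_V[of u v] E_V2[of u v] by simp
  then show False using \<open>E u v\<close> E_irrefl by simp
qed

lemma K_sub: "K v \<subseteq> V"
  using E_V2 by (auto simp: K_def)

lemma finK: "finite (K v)"
  using K_sub finV finite_subset by blast

lemma card_K: "card (K v) + 1 \<le> \<omega>"
  using card_higher[of v] by (simp add: K_def)

lemma out_sub: "out C w \<subseteq> V"
  using D_imp_E E_V2 by (auto simp: out_def)

lemma fin_out: "finite (out C w)"
  using out_sub finV finite_subset by blast

text \<open>Two common backbone neighbours would close a 4-cycle.\<close>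

lemma card_out_Int: "x \<noteq> y \<Longrightarrow> card (out C x \<inter> out C' y) \<le> 1"
proof -
  assume xy: "x \<noteq> y"
  have "a = b" if "a \<in> out C x \<inter> out C' y" "b \<in> out C x \<inter> out C' y" for a b
  proof (rule common[OF _ _ _ _ xy])
    show "D x a" "D a y" "D x b" "D b y" using that D_sym[of y] by (auto simp: out_def)
  qed
  moreover have "finite (out C x \<inter> out C' y)" using fin_out by blast
  ultimately show ?thesis by (simp add: card_le_Suc0_iff_eq)
qed

text \<open>Here \<open>z\<close> is already the one common backbone neighbour that is possible, and
  it lies inside \<open>C\<close>.\<close>

lemma out_Int_empty:
  assumes "x \<noteq> y" "D x z" "D z y" "z \<in> C"
  shows "out C x \<inter> out C' y = {}"
proof -
  have "a = z" if "a \<in> out C x \<inter> out C' y" for a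
  proof (rule common[OF _ _ assms(2,3,1)])
    show "D x a" "D a y" using that D_sym[of y] by (auto simp: out_def)
  qed
  then show ?thesis using assms(4) by (auto simp: out_def)
qed

lemma out_block: "block C Q \<Longrightarrow> w \<in> C \<Longrightarrow> out C w \<subseteq> Q"
proof
  fix y assume "block C Q" "w \<in> C" and y: "y \<in> out C w"
  moreover have "E w y" using D_imp_E y by (simp add: out_def)
  ultimately show "y \<in> Q" using y by (auto simp: block_def out_def)
qed

lemma block_fin: "block C Q \<Longrightarrow> finite C"
  using finV finite_subset by (auto simp: block_def)

lemma K_split:
  assumes "block C Q" "w \<in> C"
  shows "card (K w) = up C w + card (K w - C)" "dE V w = dE C w + card (K w - C)"
    "dD V w = dD C w + card (out C w)" "dE (V - C) w = card (K w - C)" "dD (V - C) w = card (out C w)"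
proof -
  have fC: "finite C" and CV: "C \<subseteq> V" using block_fin assms(1) by (auto simp: block_def)
  have "K w = {y \<in> C. E w y \<and> f w < f y} \<union> (K w - C)" by (auto simp: K_def)
  then show "card (K w) = up C w + card (K w - C)"
    unfolding up_def using fC finK by (subst card_Un_disjoint[symmetric]) auto
  have "{v \<in> V - C. E w v} = K w - C" using assms E_V2 by (auto simp: block_def K_def)
  then show 1: "dE (V - C) w = card (K w - C)" by (simp add: dE_def)
  have "{v \<in> V - C. D w v} = out C w" using D_imp_E E_V2 by (auto simp: out_def)
  then show 2: "dD (V - C) w = card (out C w)" by (simp add: dD_def)
  have V: "C \<union> (V - C) = V" using CV by blast
  show "dE V w = dE C w + card (K w - C)" "dD V w = dD C w + card (out C w)"
    using dE_Un[of C "V - C" w] dD_Un[of C "V - C" w] fC finV V 1 2 by auto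
qed

lemma sum_dE_up: "finite C \<Longrightarrow> C \<subseteq> V \<Longrightarrow> (\<Sum>w\<in>C. dE C w) = 2 * (\<Sum>w\<in>C. up C w)"
proof -
  assume fC: "finite C" and CV: "C \<subseteq> V"
  let ?dn = "\<lambda>w. card {y \<in> C. E w y \<and> f y < f w}"
  have "dE C w = up C w + ?dn w" for w
  proof -
    have "{v \<in> C. E w v} = {y \<in> C. E w y \<and> f w < f y} \<union> {y \<in> C. E w y \<and> f y < f w}"
      using f_neq[of w] by (auto simp: nat_neq_iff)
    moreover have "card ({y \<in> C. E w y \<and> f w < f y} \<union> {y \<in> C. E w y \<and> f y < f w})
        = card {y \<in> C. E w y \<and> f w < f y} + card {y \<in> C. E w y \<and> f y < f w}"
      by (rule card_Un_disjoint) (use fC in auto)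
    ultimately show ?thesis unfolding dE_def up_def by simp
  qed
  moreover have "(\<Sum>w\<in>C. ?dn w) = (\<Sum>w\<in>C. up C w)"
  proof -
    have "(\<Sum>w\<in>C. ?dn w) = (\<Sum>w\<in>C. \<Sum>y\<in>C. if E w y \<and> f y < f w then 1 else 0)"
      using fC by (simp add: sum.If_cases Int_def)
    also have "\<dots> = (\<Sum>y\<in>C. \<Sum>w\<in>C. if E w y \<and> f y < f w then 1 else 0)" by (rule sum.swap)
    also have "\<dots> = (\<Sum>y\<in>C. \<Sum>w\<in>C. if E y w \<and> f y < f w then 1 else 0)"
      by (intro sum.cong refl) (use E_sym in auto)
    also have "\<dots> = (\<Sum>y\<in>C. up C y)"
      unfolding up_def using fC by (simp add: sum.If_cases Int_def)
    finally show ?thesis .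
  qed
  ultimately show ?thesis by (simp add: sum.distrib)
qed

lemma V_density:
  assumes "W \<subseteq> V"
  shows "(\<Sum>w\<in>W. k + dD W w) \<le> (\<Sum>w\<in>W. dE V w + 2 * dD V w)"
  using density[OF finV _ not_col sub_col assms] by simp

text \<open>The density inequality expressed in \<open>s\<close>: the neighbours of \<open>w\<close>
  outside the block all lie above \<open>w\<close>, so there are at most
  \<open>\<omega> - 1 - up C w\<close> of them. The slack \<open>t\<close> receives the surplus of
  \<open>density_step\<close>.\<close>

lemma block_count:
  assumes C: "block C Q" and n: "(\<Sum>w\<in>C. k + dD C w) + t \<le> (\<Sum>w\<in>C. dE V w + 2 * dD V w)"
  shows "card C * s + t \<le> (\<Sum>w\<in>C. up C w) + (\<Sum>w\<in>C. dD C w) + 2 * (\<Sum>w\<in>C. card (out C w))"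
proof -
  have CV: "C \<subseteq> V" and fC: "finite C" using C block_fin by (auto simp: block_def)
  have "dE V w + (up C w + 1) \<le> dE C w + \<omega>" if "w \<in> C" for w
    using K_split(1,2)[OF C that] card_K[of w] by linarith
  then have "(\<Sum>w\<in>C. dE V w + (up C w + 1)) \<le> (\<Sum>w\<in>C. dE C w + \<omega>)" by (rule sum_mono)
  then have "sum (dE V) C + sum (up C) C + card C \<le> sum (dE C) C + card C * \<omega>"
    by (simp only: sum.distrib sum_constant) simp
  moreover have "(\<Sum>w\<in>C. dD V w) = (\<Sum>w\<in>C. dD C w + card (out C w))"
    by (rule sum.cong) (use K_split(3)[OF C] in auto)
  moreover have "card C * (k + 1) = card C * s + card C * \<omega>" using k_eq by (simp add: algebra_simps)
  ultimately show ?thesis using n sum_dE_up[OF fC CV]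
    by (simp add: sum.distrib sum_distrib_left[symmetric])
qed

lemma block_density:
  assumes C: "block C Q"
  shows "card C * s \<le> (\<Sum>w\<in>C. up C w) + (\<Sum>w\<in>C. dD C w) + 2 * (\<Sum>w\<in>C. card (out C w))"
  using block_count[OF C, of 0] V_density[of C] C by (simp add: block_def)

lemma residual:
  assumes W: "block W Q" and ne: "W \<noteq> {}"
  obtains c where "ok (\<lambda>_. {1..k}) (V - W) c" "\<not> lcol (res (\<lambda>_. {1..k}) c (V - W)) W"
    "\<And>w. w \<in> W \<Longrightarrow> k \<le> card (res (\<lambda>_. {1..k}) c (V - W) w) + card (K w - W) + 2 * card (out W w)"
    "\<And>w. w \<in> W \<Longrightarrow> s + up W w \<le> card (res (\<lambda>_. {1..k}) c (V - W) w) + 2 * card (out W w)"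
proof -
  have WV: "W \<subseteq> V" using W by (auto simp: block_def)
  then have "V - W \<subset> V" using ne by blast
  then obtain c where c: "ok (\<lambda>_. {1..k}) (V - W) c" using sub_col unfolding lcol_def by blast
  have nl: "\<not> lcol (res (\<lambda>_. {1..k}) c (V - W)) W"
    using lcol_extend[OF c, of W] not_col WV by (auto simp: Un_absorb2)
  have 1: "k \<le> card (res (\<lambda>_. {1..k}) c (V - W) w) + card (K w - W) + 2 * card (out W w)" if "w \<in> W" for w
    using card_res[of "V - W" "\<lambda>_. {1..k}" w c] finV K_split(4,5)[OF W that] by simp
  have "s + up W w \<le> card (res (\<lambda>_. {1..k}) c (V - W) w) + 2 * card (out W w)" if "w \<in> W" for w
    using 1[OF that] K_split(1)[OF W that] card_K[of w] k_eq by linarith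
  then show ?thesis using that c nl 1 by blast
qed

text \<open>\<open>(v, p) \<in> R\<close> says that \<open>p\<close> is the parent of \<open>v\<close> in the elimination tree, its lowest higher neighbour.\<close>

definition R :: "('a \<times> 'a) set" where
  "R = {(v, p). p \<in> K v \<and> (\<forall>x\<in>K v. f p \<le> f x)}"

definition T :: "'a \<Rightarrow> 'a set" where
  "T u = {v. (v, u) \<in> R\<^sup>*}"

lemma R_D: "(v, p) \<in> R \<Longrightarrow> E v p \<and> f v < f p"
  by (auto simp: R_def K_def)

text \<open>The higher neighbours of \<open>v\<close> form a clique, so all of them are higher
  neighbours of the lowest one.\<close>

lemma K_R: "(v, p) \<in> R \<Longrightarrow> x \<in> K v \<Longrightarrow> x = p \<or> x \<in> K p"
proof -
  assume vp: "(v, p) \<in> R" and x: "x \<in> K v"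
  have "E p x \<and> f p < f x" if "x \<noteq> p"
  proof -
    have px: "E p x" using peo[of v p x] vp x that by (auto simp: R_def K_def)
    moreover have "f p \<le> f x" using vp x by (auto simp: R_def)
    ultimately show ?thesis using f_neq[OF px] by simp
  qed
  then show ?thesis by (auto simp: K_def)
qed

lemma single_valued_R: "single_valued R"
proof (rule single_valuedI)
  fix v p q assume p: "(v, p) \<in> R" and q: "(v, q) \<in> R"
  have "p \<in> K v" "q \<in> K v" "f p = f q" using p q by (auto simp: R_def intro: order.antisym)
  then show "p = q" using inj_onD[OF inj_f, of p q] K_sub by blast
qed

lemma parent_exists: "K v \<noteq> {} \<Longrightarrow> \<exists>p. (v, p) \<in> R"
proof -
  assume "K v \<noteq> {}"
  then obtain x where "x \<in> K v" by blast
  from ex_has_least_nat[of "\<lambda>x. x \<in> K v", OF this, of f] show ?thesis by (auto simp: R_def)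
qed

text \<open>By \<open>K_R\<close>, going from \<open>v\<close> to its parent keeps \<open>x\<close>
  among the higher neighbours until \<open>x\<close> itself is reached.\<close>

lemma K_trancl: "x \<in> K v \<Longrightarrow> (v, x) \<in> R\<^sup>*"
proof (induction "f x - f v" arbitrary: v rule: less_induct)
  case less
  obtain p where p: "(v, p) \<in> R" using parent_exists less.prems by blast
  show ?case
  proof (cases "x = p")
    case True
    then show ?thesis using p by blast
  next
    case False
    then have x: "x \<in> K p" using K_R[OF p less.prems] by simp
    have "f x - f p < f x - f v" using R_D[OF p] x by (auto simp: K_def)
    from less.hyps[OF this x] show ?thesis using p by (rule converse_rtrancl_into_rtrancl[rotated])
  qed
qed

lemma trancl_K: "(v, u) \<in> R\<^sup>* \<Longrightarrow> x \<in> K v \<Longrightarrow> x \<in> K u \<or> (x, u) \<in> R\<^sup>*"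
proof (induction rule: converse_rtrancl_induct)
  case base
  then show ?case by simp
next
  case (step v p)
  then show ?case using K_R[of v p x] by blast
qed

lemma trancl_le: "(v, u) \<in> R\<^sup>* \<Longrightarrow> f v \<le> f u"
  by (induction rule: rtrancl_induct) (use R_D in fastforce)+

lemma T_sub: "u \<in> V \<Longrightarrow> T u \<subseteq> V"
proof
  fix v assume "u \<in> V" "v \<in> T u"
  then have "(v, u) \<in> R\<^sup>*" by (simp add: T_def)
  then show "v \<in> V" by (cases rule: converse_rtranclE) (use \<open>u \<in> V\<close> R_D E_V in blast)+
qed

text \<open>Subtrees are the source of blocks: lower neighbours are descendants by
  \<open>K_trancl\<close>, and by \<open>trancl_K\<close> a higher neighbour can leave the subtree
  only into \<open>K u\<close>.\<close>

lemma block_T: "u \<in> V \<Longrightarrow> block (T u) (K u)"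
  unfolding block_def
proof (intro conjI ballI allI impI)
  fix w y assume w: "w \<in> T u" and wy: "E w y"
  consider "f w < f y" | "f y < f w" using f_neq[OF wy] by linarith
  then show "y \<in> T u \<or> y \<in> K u \<and> f w < f y"
  proof cases
    case 1
    then have "y \<in> K w" using wy by (simp add: K_def)
    then show ?thesis using trancl_K[of w u y] w 1 by (auto simp: T_def)
  next
    case 2
    then have "w \<in> K y" using E_sym[OF wy] by (simp add: K_def)
    from K_trancl[OF this] w have "(y, u) \<in> R\<^sup>*" unfolding T_def by (auto intro: rtrancl_trans)
    then show ?thesis by (simp add: T_def)
  qed
qed (use T_sub K_sub in auto)

lemma T_children: "T u = insert u (\<Union>v\<in>{v. (v, u) \<in> R}. T v)"
proof (intro equalityI subsetI)
  fix x assume "x \<in> T u"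
  then have "(x, u) \<in> R\<^sup>*" by (simp add: T_def)
  then show "x \<in> insert u (\<Union>v\<in>{v. (v, u) \<in> R}. T v)"
    by (cases rule: rtranclE) (auto simp: T_def)
next
  fix x assume "x \<in> insert u (\<Union>v\<in>{v. (v, u) \<in> R}. T v)"
  then show "x \<in> T u" by (auto simp: T_def intro: rtrancl_into_rtrancl)
qed

lemma T_disjoint:
  assumes "(v, u) \<in> R" "(v', u) \<in> R" "v \<noteq> v'"
  shows "T v \<inter> T v' = {}"
proof -
  have no: "(a, b) \<notin> R\<^sup>*" if au: "(a, u) \<in> R" and bu: "(b, u) \<in> R" and ab: "a \<noteq> b" for a b
  proof
    assume "(a, b) \<in> R\<^sup>*"
    then obtain z where "(a, z) \<in> R" "(z, b) \<in> R\<^sup>*" using ab by (auto elim: converse_rtranclE)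
    then have "(u, b) \<in> R\<^sup>*" using single_valuedD[OF single_valued_R] au by blast
    then show False using trancl_le[of u b] R_D[OF bu] by simp
  qed
  show ?thesis
    using single_valued_confluent[OF single_valued_R] no[OF assms] no[OF assms(2,1)] assms(3)
    unfolding T_def by blast
qed

lemma T_root: "(v, u) \<in> R \<Longrightarrow> u \<notin> T v"
  using R_D trancl_le unfolding T_def by fastforce

lemma block_child: "(v, u) \<in> R \<Longrightarrow> block (T v) (insert u (K u))"
proof -
  assume vu: "(v, u) \<in> R"
  then have V: "v \<in> V" "u \<in> V" using R_D E_V E_V2 by blast+
  have "K v \<subseteq> insert u (K u)" using K_R[OF vu] by blast
  then show ?thesis using block_T[OF V(1)] V(2) K_sub unfolding block_def by blast
qed

text \<open>The lowest vertex \<open>v\<close> of \<open>V\<close> has at least s/2 \<ge> 5 backbone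
  neighbours, all above it, and the highest member of the clique \<open>K v\<close> has the whole
  clique in its subtree.\<close>

lemma big_T_exists: "\<exists>u\<in>V. 4 \<le> card (T u)"
proof -
  have "V \<noteq> {}" using not_col lcol_empty by auto
  then obtain v where v: "v \<in> V" and least: "\<And>x. x \<in> V \<Longrightarrow> f v \<le> f x"
    using ex_has_least_nat[of "\<lambda>x. x \<in> V" _ f] by blast
  have b: "block {v} (K v)"
    unfolding block_def
  proof (intro conjI ballI allI impI)
    fix w y assume "w \<in> {v}" "E w y"
    then have vy: "w = v" "E v y" by auto
    have "f v \<le> f y" using least E_V2[OF vy(2)] by blast
    then show "y \<in> {v} \<or> y \<in> K v \<and> f w < f y" using f_neq[OF vy(2)] vy by (simp add: K_def)
  qed (use v K_sub in auto)
  have "up {v} v = 0" "dD {v} v = 0" using E_irrefl D_imp_E by (auto simp: up_def dD_def)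
  then have "s \<le> 2 * card (out {v} v)" using block_density[OF b] by simp
  moreover have "card (out {v} v) \<le> card (K v)" using out_block[OF b] finK by (intro card_mono) auto
  ultimately have cK: "4 \<le> card (K v)" using s_ge by linarith
  then have "K v \<noteq> {}" by auto
  then have "Max (f ` K v) \<in> f ` K v" using finK by (intro Max_in) auto
  then obtain z where z: "z \<in> K v" "f z = Max (f ` K v)" by auto
  have "K v \<subseteq> T z"
  proof
    fix x assume x: "x \<in> K v"
    show "x \<in> T z"
    proof (cases "x = z")
      case False
      then have xz: "E x z" using peo[of v x z] x z by (auto simp: K_def)
      moreover have "f x \<le> f z" using z x finK by simp
      ultimately have "z \<in> K x" using f_neq[OF xz] by (simp add: K_def)
      then show ?thesis using K_trancl by (simp add: T_def)
    qed (simp add: T_def)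
  qed
  moreover have zV: "z \<in> V" using z K_sub by blast
  moreover have "finite (T z)" using T_sub[OF zV] finV finite_subset by blast
  ultimately have "4 \<le> card (T z)" using cK card_mono[of "T z" "K v"] by simp
  then show ?thesis using zV by blast
qed

lemma lowest_big_T:
  obtains u where "u \<in> V" "4 \<le> card (T u)" "\<And>v. (v, u) \<in> R \<Longrightarrow> card (T v) \<le> 3"
proof -
  obtain u0 where "u0 \<in> V \<and> 4 \<le> card (T u0)" using big_T_exists by blast
  from ex_has_least_nat[of "\<lambda>u. u \<in> V \<and> 4 \<le> card (T u)", OF this, of f]
  obtain u where u: "u \<in> V" "4 \<le> card (T u)" "\<And>v. v \<in> V \<Longrightarrow> 4 \<le> card (T v) \<Longrightarrow> f u \<le> f v" by blast
  have "card (T v) \<le> 3" if "(v, u) \<in> R" for v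
  proof (rule ccontr)
    assume "\<not> ?thesis"
    then have "f u \<le> f v" using u(3)[of v] R_D[OF that] E_V[of v u] by simp
    then show False using R_D[OF that] by simp
  qed
  then show ?thesis using that u by blast
qed

lemma card_insert_filter:
  assumes "finite S" "x \<notin> S"
  shows "card {v \<in> insert x S. P v} = (if P x then 1 else 0) + card {v \<in> S. P v}"
proof -
  have "{v \<in> insert x S. P v} = (if P x then insert x {v \<in> S. P v} else {v \<in> S. P v})" by auto
  then show ?thesis using assms by simp
qed

lemma dD_insert: "finite S \<Longrightarrow> x \<notin> S \<Longrightarrow> dD (insert x S) w = (if D w x then 1 else 0) + dD S w"
  unfolding dD_def by (rule card_insert_filter)

lemma dE_insert: "finite S \<Longrightarrow> x \<notin> S \<Longrightarrow> dE (insert x S) w = (if E w x then 1 else 0) + dE S w"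
  unfolding dE_def by (rule card_insert_filter)

lemma up_insert: "finite S \<Longrightarrow> x \<notin> S \<Longrightarrow> up (insert x S) w = (if E w x \<and> f w < f x then 1 else 0) + up S w"
  unfolding up_def by (rule card_insert_filter)

lemma deg_empty: "dD {} w = 0" "dE {} w = 0" "up {} w = 0"
  by (simp_all add: dD_def dE_def up_def)

lemma D_irrefl: "\<not> D u u"
  using D_imp_E E_irrefl by blast

lemmas deg_simps = dD_insert dE_insert up_insert deg_empty E_irrefl D_irrefl

end

section \<open>Backbone degrees in blocks of at most three vertices\<close>

context critical
begin

abbreviation dO :: "'a set \<Rightarrow> 'a \<Rightarrow> nat" where
  "dO C x \<equiv> card (out C x)"

lemma cap:
  assumes "\<forall>p\<in>set xs. block (fst p) Q \<and> snd p \<in> fst p"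
  shows "(\<Sum>(C, x)\<leftarrow>xs. dO C x) \<le> card Q + pair_sum (\<lambda>(C, x). out C x) xs"
proof (cases "xs = []")
  case False
  have finQ: "finite Q" using assms False finV finite_subset unfolding block_def
    by (metis list.set_intros(1) list.exhaust)
  have "(\<Sum>p\<leftarrow>xs. card (case p of (C, x) \<Rightarrow> out C x))
    \<le> card (\<Union>p\<in>set xs. case p of (C, x) \<Rightarrow> out C x) + pair_sum (\<lambda>(C, x). out C x) xs"
    by (rule bonferroni) (auto simp: fin_out)
  moreover have "card (\<Union>p\<in>set xs. case p of (C, x) \<Rightarrow> out C x) \<le> card Q"
    by (rule card_mono[OF finQ]) (use assms out_block in fastforce)
  moreover have "(\<Sum>p\<leftarrow>xs. card (case p of (C, x) \<Rightarrow> out C x)) = (\<Sum>(C, x)\<leftarrow>xs. dO C x)"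
    by (intro arg_cong[where f = sum_list] map_cong) auto
  ultimately show ?thesis by simp
qed simp

lemma single_density: "block {x} Q \<Longrightarrow> s \<le> 2 * dO {x} x"
  using block_density[of "{x}" Q] by (simp add: deg_simps)

text \<open>The block inequality reads 2s \<le> 3 + 2(\<open>dO {x, y} x + dO {x, y} y\<close>), and
  parity turns the 3 into a 2.\<close>

lemma pair_density:
  assumes "block {x, y} Q" "x \<noteq> y"
  shows "s \<le> dO {x, y} x + dO {x, y} y + 1"
proof -
  have "2 * (up {x, y} x + up {x, y} y) = 2 * (if E x y then 1 else 0)"
    using sum_dE_up[of "{x, y}"] assms E_sym[of x y] E_sym[of y x]
    by (auto simp: deg_simps block_def)
  moreover have "dD {x, y} x + dD {x, y} y = 2 * (if D x y then 1 else 0)"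
    using assms D_sym[of x y] D_sym[of y x] by (auto simp: deg_simps)
  ultimately show ?thesis using block_density[OF assms(1)] assms(2) by (auto split: if_splits)
qed

lemma triple_density:
  assumes C: "block {x, y, z} Q" and d: "x \<noteq> y" "y \<noteq> z" "x \<noteq> z"
  shows "3 * s \<le> of_bool (E x y) + of_bool (E y z) + of_bool (E x z)
      + 2 * (of_bool (D x y) + of_bool (D y z) + of_bool (D x z))
      + 2 * (dO {x, y, z} x + dO {x, y, z} y + dO {x, y, z} z)"
proof -
  have E: "E y x = E x y" "E z x = E x z" "E z y = E y z" using E_sym by blast+
  have D: "D y x = D x y" "D z x = D x z" "D z y = D y z" using D_sym by blast+
  have "2 * (up {x, y, z} x + up {x, y, z} y + up {x, y, z} z)
      = 2 * (of_bool (E x y) + of_bool (E y z) + of_bool (E x z))"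
    using sum_dE_up[of "{x, y, z}"] C d E by (simp add: deg_simps block_def of_bool_def)
  moreover have "dD {x, y, z} x + dD {x, y, z} y + dD {x, y, z} z
      = 2 * (of_bool (D x y) + of_bool (D y z) + of_bool (D x z))"
    using d D by (simp add: deg_simps of_bool_def)
  ultimately show ?thesis using block_density[OF C] d by (simp add: card_insert_if)
qed

text \<open>The one pair of triples that counting does not exclude: \<open>s = 11\<close> and both triples are backbone paths inside triangles.\<close>

lemma no_path_triple:
  assumes C: "block {x, y, z} Q" and d: "x \<noteq> y" "y \<noteq> z" "x \<noteq> z" and s: "s = 11"
    and D: "D x z" "D y z" "\<not> D x y" and Exy: "E x y"
    and o: "dO {x, y, z} x = 4" "dO {x, y, z} y = 4" "dO {x, y, z} z = 5"
  shows False
proof -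
  let ?C = "{x, y, z}" and ?A = "\<lambda>_ :: 'a. {1..k}"
  have E: "E x z" "E y z" "E z x" "E z y" "E y x" using D Exy D_imp_E E_sym by blast+
  have D': "D z x" "D z y" "\<not> D y x" using D D_sym by blast+
  have V: "x \<in> V" "y \<in> V" using E E_V by blast+
  have f: "f x \<noteq> f y" "f x \<noteq> f z" "f y \<noteq> f z" using f_neq E Exy by blast+
  have up: "up ?C x = of_bool (f x < f y) + of_bool (f x < f z)"
    "up ?C y = of_bool (f y < f x) + of_bool (f y < f z)"
    "up ?C z = of_bool (f z < f x) + of_bool (f z < f y)"
    using d E Exy by (simp_all add: deg_simps of_bool_def)
  have dD: "dD ?C x = 1" "dD ?C y = 1" "dD ?C z = 2" "dE ?C x = 2" "dE ?C y = 2"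
    using d D D' E Exy by (simp_all add: deg_simps)
  \<comment> \<open>The density inequality for the single vertex \<open>w\<close> excludes two
    neighbours above it in the triangle. So neither \<open>x\<close> nor \<open>y\<close> is the
    lowest of the three, and \<open>z\<close> is.\<close>
  have single: "w \<in> {x, y} \<Longrightarrow> up ?C w \<le> 1" for w
  proof -
    assume w: "w \<in> {x, y}"
    then have wC: "w \<in> ?C" and wV: "w \<in> V" using V by auto
    have "k + dD {w} w \<le> dE V w + 2 * dD V w" using V_density[of "{w}"] wV by simp
    then show ?thesis
      using K_split(1-3)[OF C wC] card_K[of w] k_eq s w o dD by auto
  qed
  have ux: "up ?C x \<le> 1" and uy: "up ?C y \<le> 1" using single by blast+
  have z: "f z < f x" "f z < f y" using ux uy up f by (auto simp: of_bool_def split: if_splits)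
  obtain c where nl: "\<not> lcol (res ?A c (V - ?C)) ?C"
    and L: "\<And>w. w \<in> ?C \<Longrightarrow> s + up ?C w \<le> card (res ?A c (V - ?C) w) + 2 * dO ?C w"
    using residual[OF C] by blast
  have low: "False" if ab: "{a, b} = {x, y}" and ab': "a \<noteq> b" "f a < f b" for a b
  proof -
    have cases: "a = x \<and> b = y \<or> a = y \<and> b = x" using ab d by (auto simp: doubleton_eq_iff)
    \<comment> \<open>The remaining lists of \<open>z\<close>, \<open>b\<close>, \<open>a\<close>
      have at least 3, 3, 4 colours, which is enough in this order.\<close>
    let ?r = "\<lambda>v. if v = z then 0 else if v = b then 1 else 2 :: nat"
    have "lcol (res ?A c (V - ?C)) ?C"
    proof (rule lcol_rank[of _ ?r])
      show "inj_on ?r ?C" using d cases by (auto simp: inj_on_def)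
      show "finite (res ?A c (V - ?C) w)" for w by (simp add: res_def)
      fix w assume w: "w \<in> ?C"
      have eq: "{v \<in> ?C. E w v \<and> ?r v < ?r w} = (if w = z then {} else if w = b then {z} else {z, b})"
        using w d cases E E_irrefl Exy by (auto split: if_splits)
      have "card {v \<in> ?C. E w v \<and> ?r v < ?r w} = ?r w" unfolding eq using d cases by auto
      moreover have "s + up ?C w \<le> card (res ?A c (V - ?C) w) + 2 * dO ?C w" by (rule L[OF w])
      ultimately show "card {v \<in> ?C. E w v \<and> ?r v < ?r w} + dD ?C w < card (res ?A c (V - ?C) w)"
        using w cases o dD up s z f ab' by auto
    qed simp
    then show False using nl by blast
  qed
  consider "f x < f y" | "f y < f x" using f by linarith
  then show False
  proof cases
    case 1 then show False using low[of x y] d by blast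
  next
    case 2 then show False using low[of y x] d by (metis insert_commute)
  qed
qed

end

section \<open>Several subtrees below one vertex\<close>

context critical
begin

text \<open>All four sets lie in a set of at most \<omega> \<le> 2s - 9 vertices. The four cross
  intersections cost at most 1 each, and 9 - 4 = 5.\<close>

lemma cap4:
  assumes "block A Q" "block B Q" "block C Q" "block F Q" "a \<in> A" "b \<in> B" "c \<in> C" "d \<in> F"
    and "a \<noteq> c" "a \<noteq> d" "b \<noteq> c" "b \<noteq> d" and Q: "card Q \<le> \<omega>"
  shows "dO A a + dO B b + dO C c + dO F d + 5
    \<le> 2 * s + card (out A a \<inter> out B b) + card (out C c \<inter> out F d)"
proof -
  have "dO A a + dO B b + dO C c + dO F d \<le> card Q + pair_sum (\<lambda>(C, x). out C x) [(A, a), (B, b), (C, c), (F, d)]"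
    using cap[of "[(A, a), (B, b), (C, c), (F, d)]" Q] assms by simp
  moreover have "card (out A a \<inter> out C c) \<le> 1" "card (out A a \<inter> out F d) \<le> 1"
      "card (out B b \<inter> out C c) \<le> 1" "card (out B b \<inter> out F d) \<le> 1"
    using card_out_Int assms by auto
  ultimately show ?thesis using Q \<omega>_le by simp
qed

lemma pair_sum_append:
  "pair_sum N (xs @ ys) = pair_sum N xs + pair_sum N ys + (\<Sum>x\<leftarrow>xs. \<Sum>y\<leftarrow>ys. card (N x \<inter> N y))"
  by (induction xs) simp_all

lemma cap_two:
  assumes B: "block C Q" "block F Q" and sub: "set xs \<subseteq> C" "set ys \<subseteq> F" and disj: "C \<inter> F = {}" and Q: "card Q \<le> \<omega>"
  shows "(\<Sum>x\<leftarrow>xs. dO C x) + (\<Sum>y\<leftarrow>ys. dO F y) + 9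
    \<le> 2 * s + pair_sum (out C) xs + pair_sum (out F) ys + length xs * length ys"
proof -
  let ?N = "\<lambda>(C, x). out C x"
  have m: "pair_sum ?N (map (Pair G) zs) = pair_sum (out G) zs" for G zs
    by (induction zs) (simp_all add: o_def)
  have "(\<Sum>x\<leftarrow>xs. \<Sum>y\<leftarrow>ys. card (out C x \<inter> out F y)) \<le> (\<Sum>x\<leftarrow>xs. \<Sum>y\<leftarrow>ys. 1)"
    using sub disj by (intro sum_list_mono card_out_Int) auto
  moreover have "(\<Sum>(C, x)\<leftarrow>map (Pair C) xs @ map (Pair F) ys. dO C x)
      \<le> card Q + pair_sum ?N (map (Pair C) xs @ map (Pair F) ys)"
    by (rule cap) (use B sub in auto)
  ultimately show ?thesis
    using Q \<omega>_le by (simp add: pair_sum_append m o_def sum_list_triv)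
qed

text \<open>The disjuncts belong to at most one, exactly two, and three backbone edges inside the
  triple; with two edges \<open>z\<close> is the centre of the path. Each further edge weakens the
  degree bound by 2, but ends of a two-edge path share no backbone neighbour outside. The extra
  clause of the second disjunct records \<open>no_path_triple\<close>.\<close>

definition triple_bound :: "'a set \<Rightarrow> 'a \<Rightarrow> 'a \<Rightarrow> 'a \<Rightarrow> bool" where
  "triple_bound C x y z \<longleftrightarrow>
     3 * s \<le> 5 + 2 * (dO C x + dO C y + dO C z) \<or>
     card (out C x \<inter> out C y) = 0 \<and> 3 * s \<le> 7 + 2 * (dO C x + dO C y + dO C z) \<and>
       (3 * s \<le> 6 + 2 * (dO C x + dO C y + dO C z) \<or>
         \<not> (s = 11 \<and> dO C x = 4 \<and> dO C y = 4 \<and> dO C z = 5)) \<or>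
     card (out C x \<inter> out C y) = 0 \<and> card (out C x \<inter> out C z) = 0 \<and> card (out C y \<inter> out C z) = 0 \<and>
       3 * s \<le> 9 + 2 * (dO C x + dO C y + dO C z)"

lemma triple_summary:
  assumes C: "block C Q" and card: "card C = 3"
  obtains x y z where "C = {x, y, z}" "x \<noteq> y" "y \<noteq> z" "x \<noteq> z"
    "card (out C x \<inter> out C y) \<le> 1" "card (out C x \<inter> out C z) \<le> 1" "card (out C y \<inter> out C z) \<le> 1"
    "triple_bound C x y z"
proof -
  note result = that
  obtain a b c where abc: "C = {a, b, c}" "a \<noteq> b" "b \<noteq> c" "a \<noteq> c"
    using card by (auto simp: card_3_iff)
  have zero: "card (out C p \<inter> out C q) = 0" if "p \<noteq> q" "D p r" "D q r" "r \<in> C" for p q r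
    using out_Int_empty[OF that(1,2) D_sym[OF that(3)] that(4)] by simp
  have b: "of_bool P \<le> (1 :: nat)" for P by simp
  have aux: "S \<le> 5 + 2 * n" if "S \<le> e1 + e2 + e3 + 2 * d + 2 * n" "e1 \<le> 1" "e2 \<le> 1" "e3 \<le> 1" "d \<le> 1"
    for S e1 e2 e3 d n :: nat using that by linarith
  have t: "3 * s \<le> of_bool (E x y) + of_bool (E y z) + of_bool (E x z)
      + 2 * (of_bool (D x y) + of_bool (D y z) + of_bool (D x z)) + 2 * (dO C x + dO C y + dO C z)"
    if "C = {x, y, z}" "x \<noteq> y" "y \<noteq> z" "x \<noteq> z" for x y z
    using triple_density[of x y z Q] C that by simp
  have centre: thesis if d: "C = {x, y, z}" "x \<noteq> y" "y \<noteq> z" "x \<noteq> z" and D: "D x z" "D y z" for x y z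
  proof (rule result[OF d card_out_Int[OF d(2)] card_out_Int[OF d(4)] card_out_Int[OF d(3)]])
    have E: "E x z" "E y z" using D D_imp_E by blast+
    have mem: "x \<in> C" "y \<in> C" "z \<in> C" using d(1) by auto
    have z: "card (out C x \<inter> out C y) = 0" by (rule zero[OF d(2) D mem(3)])
    show "triple_bound C x y z"
    proof (cases "D x y")
      case True
      have "card (out C x \<inter> out C z) = 0" "card (out C y \<inter> out C z) = 0"
        using zero[OF d(4) True D_sym[OF D(2)] mem(2)] zero[OF d(3) D_sym[OF True] D_sym[OF D(1)] mem(1)] by auto
      moreover have "3 * s \<le> 9 + 2 * (dO C x + dO C y + dO C z)" using t[OF d] True D b[of "E x y"] E by simp
      ultimately show ?thesis unfolding triple_bound_def using z by blast
    next
      case False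
      show ?thesis
      proof (cases "E x y")
        case True
        have "\<not> (s = 11 \<and> dO C x = 4 \<and> dO C y = 4 \<and> dO C z = 5)"
          using no_path_triple[of x y z Q] C d D False True by auto
        moreover have "3 * s \<le> 7 + 2 * (dO C x + dO C y + dO C z)" using t[OF d] False D True E by simp
        ultimately show ?thesis unfolding triple_bound_def using z by blast
      next
        case nE: False
        have "3 * s \<le> 6 + 2 * (dO C x + dO C y + dO C z)" using t[OF d] False D nE E by simp
        then show ?thesis unfolding triple_bound_def using z by simp
      qed
    qed
  qed
  consider "D a b" "D b c" | "D a b" "D a c" | "D a c" "D b c"
    | "of_bool (D a b) + of_bool (D b c) + of_bool (D a c) \<le> (1 :: nat)"
    by (cases "D a b"; cases "D b c"; cases "D a c") auto
  then show thesis
  proof cases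
    case 1
    then show ?thesis using centre[of a c b] abc D_sym by auto
  next
    case 2
    then show ?thesis using centre[of b c a] abc D_sym by auto
  next
    case 3
    then show ?thesis using centre[of a b c] abc by auto
  next
    case 4
    have "3 * s \<le> 5 + 2 * (dO C a + dO C b + dO C c)" by (rule aux[OF t[OF abc] b b b 4])
    then have "triple_bound C a b c" by (simp add: triple_bound_def)
    then show ?thesis
      by (rule result[OF abc card_out_Int[OF abc(2)] card_out_Int[OF abc(4)] card_out_Int[OF abc(3)]])
  qed
qed

text \<open>Comparing the degree sums with the room in \<open>Q\<close> gives
  \<open>s \<le> 11\<close>. For \<open>s = 10\<close> and \<open>s = 11\<close> the counts with
  only two vertices of the second triple decide, and the sole survivor, \<open>s = 11\<close> with
  degrees 4, 4, 5, is excluded by \<open>triple_bound\<close>.\<close>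

lemma no_two_triples:
  assumes B: "block C Q" "block F Q" and c3: "card C = 3" "card F = 3" and disj: "C \<inter> F = {}" and Q: "card Q \<le> \<omega>"
  shows False
proof -
  obtain x y z where C: "C = {x, y, z}" "x \<noteq> y" "y \<noteq> z" "x \<noteq> z" and
    lC: "card (out C x \<inter> out C y) \<le> 1" "card (out C x \<inter> out C z) \<le> 1" "card (out C y \<inter> out C z) \<le> 1" and
    tC: "triple_bound C x y z"
    using triple_summary[OF B(1) c3(1)] .
  obtain a b c where F: "F = {a, b, c}" "a \<noteq> b" "b \<noteq> c" "a \<noteq> c" and
    lF: "card (out F a \<inter> out F b) \<le> 1" "card (out F a \<inter> out F c) \<le> 1" "card (out F b \<inter> out F c) \<le> 1" and
    tF: "triple_bound F a b c"
    using triple_summary[OF B(2) c3(2)] .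
  have sub: "{x, y, z} \<subseteq> C" "{a, b, c} \<subseteq> F" "{a, b} \<subseteq> F" "{a, c} \<subseteq> F" "{b, c} \<subseteq> F" using C F by auto
  note two = cap_two[OF B _ _ disj Q, of "[x, y, z]"]
  define X where "X = dO C x + dO C y + dO C z"
  define c1 where "c1 = card (out C x \<inter> out C y) + card (out C x \<inter> out C z) + card (out C y \<inter> out C z)"
  define p q r u v w where "p = dO F a" "q = dO F b" "r = dO F c"
    "u = card (out F a \<inter> out F b)" "v = card (out F a \<inter> out F c)" "w = card (out F b \<inter> out F c)"
  note defs = this
  have hC: "3 * s \<le> 5 + 2 * X \<and> c1 \<le> 3 \<or> 3 * s \<le> 7 + 2 * X \<and> c1 \<le> 2 \<or> 3 * s \<le> 9 + 2 * X \<and> c1 = 0"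
    using tC lC unfolding triple_bound_def X_def c1_def by (elim disjE conjE) auto
  have h6: "X + (p + q + r) \<le> 2 * s + c1 + u + v + w" using two[of "[a, b, c]"] sub unfolding X_def c1_def defs by simp
  have h5: "X + p + q + 3 \<le> 2 * s + c1 + u" "X + p + r + 3 \<le> 2 * s + c1 + v" "X + q + r + 3 \<le> 2 * s + c1 + w"
    using two[of "[a, b]"] two[of "[a, c]"] two[of "[b, c]"] sub unfolding X_def c1_def defs by simp_all
  have luvw: "u \<le> 1" "v \<le> 1" "w \<le> 1" using lF unfolding defs by auto
  have hF: "3 * s \<le> 5 + 2 * (p + q + r) \<or>
     u = 0 \<and> 3 * s \<le> 7 + 2 * (p + q + r) \<and> (3 * s \<le> 6 + 2 * (p + q + r) \<or> \<not> (s = 11 \<and> p = 4 \<and> q = 4 \<and> r = 5)) \<or>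
     u = 0 \<and> v = 0 \<and> w = 0 \<and> 3 * s \<le> 9 + 2 * (p + q + r)"
    using tF unfolding triple_bound_def defs .
  have m: "3 * s + 2 * c1 \<le> 11 + 2 * X" using hC by linarith
  define P U where "P = p + q + r" "U = u + v + w"
  note PU = this
  have "3 * s + 2 * U \<le> 11 + 2 * P" using hF[folded PU(1)] luvw unfolding PU(2) by (elim disjE conjE) auto
  moreover have "X + P \<le> 2 * s + c1 + U" using h6 unfolding PU by linarith
  ultimately have "s \<le> 11" using m by linarith
  then consider "s = 10" | "s = 11" using s_ge by linarith
  then show False
  proof cases
    case 1
    then have "10 + c1 \<le> X" using m by linarith
    then show False using hF h5 luvw 1 by (elim disjE conjE) presburger+
  next
    case 2
    then have "11 + c1 \<le> X" using m by linarith
    then show False using hF h5 h6 luvw 2 by (elim disjE conjE) presburger+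
  qed
qed

text \<open>Counting all five vertices gives \<open>s \<le> 9\<close>, so this is a place where
  \<open>s \<ge> 10\<close> is essential.\<close>

lemma no_triple_pair:
  assumes B: "block C Q" "block {a, b} Q" and c3: "card C = 3" and ab: "a \<noteq> b" and disj: "C \<inter> {a, b} = {}"
    and Q: "card Q \<le> \<omega>"
  shows False
proof -
  obtain x y z where C: "C = {x, y, z}" "x \<noteq> y" "y \<noteq> z" "x \<noteq> z" and
    lC: "card (out C x \<inter> out C y) \<le> 1" "card (out C x \<inter> out C z) \<le> 1" "card (out C y \<inter> out C z) \<le> 1" and
    tC: "triple_bound C x y z"
    using triple_summary[OF B(1) c3(1)] .
  define X where "X = dO C x + dO C y + dO C z"
  define c1 where "c1 = card (out C x \<inter> out C y) + card (out C x \<inter> out C z) + card (out C y \<inter> out C z)"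
  have hC: "3 * s \<le> 5 + 2 * X \<and> c1 \<le> 3 \<or> 3 * s \<le> 7 + 2 * X \<and> c1 \<le> 2 \<or> 3 * s \<le> 9 + 2 * X \<and> c1 = 0"
    using tC lC unfolding triple_bound_def X_def c1_def by (elim disjE conjE) auto
  note five = cap_two[OF B _ _ disj Q, of "[x, y, z]" "[a, b]"]
  have "card (out {a, b} a \<inter> out {a, b} b) \<le> 1" using card_out_Int ab by blast
  moreover have "s \<le> dO {a, b} a + dO {a, b} b + 1" by (rule pair_density[OF B(2) ab])
  ultimately have "X + 1 \<le> s + c1" using five C(1) unfolding X_def c1_def by simp
  then show False using hC s_ge by (elim disjE conjE) linarith+
qed

lemma no_triple_single:
  assumes B: "block C Q" "block {a} Q" and c3: "card C = 3" and disj: "a \<notin> C" and Q: "card Q \<le> \<omega>"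
  shows False
proof -
  obtain x y z where C: "C = {x, y, z}" "x \<noteq> y" "y \<noteq> z" "x \<noteq> z" and
    lC: "card (out C x \<inter> out C y) \<le> 1" "card (out C x \<inter> out C z) \<le> 1" "card (out C y \<inter> out C z) \<le> 1" and
    tC: "triple_bound C x y z"
    using triple_summary[OF B(1) c3(1)] .
  define X where "X = dO C x + dO C y + dO C z"
  define c1 where "c1 = card (out C x \<inter> out C y) + card (out C x \<inter> out C z) + card (out C y \<inter> out C z)"
  have hC: "3 * s \<le> 5 + 2 * X \<and> c1 \<le> 3 \<or> 3 * s \<le> 7 + 2 * X \<and> c1 \<le> 2 \<or> 3 * s \<le> 9 + 2 * X \<and> c1 = 0"
    using tC lC unfolding triple_bound_def X_def c1_def by (elim disjE conjE) auto
  have "X + dO {a} a + 6 \<le> 2 * s + c1"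
    using cap_two[OF B _ _ _ Q, of "[x, y, z]" "[a]"] disj C(1) unfolding X_def c1_def by simp
  moreover have "s \<le> 2 * dO {a} a" by (rule single_density[OF B(2)])
  ultimately have "2 * X + s + 12 \<le> 4 * s + 2 * c1" by linarith
  then show False using hC by (elim disjE conjE) linarith+
qed

lemma no_two_pairs:
  assumes B: "block {a, b} Q" "block {c, d} Q" and ne: "a \<noteq> b" "c \<noteq> d" and disj: "{a, b} \<inter> {c, d} = {}"
    and Q: "card Q \<le> \<omega>"
  shows False
proof -
  have "dO {a, b} a + dO {a, b} b + dO {c, d} c + dO {c, d} d + 5
    \<le> 2 * s + card (out {a, b} a \<inter> out {a, b} b) + card (out {c, d} c \<inter> out {c, d} d)"
    by (rule cap4[OF B(1,1) B(2,2)]) (use disj Q in auto)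
  moreover have "card (out {a, b} a \<inter> out {a, b} b) \<le> 1" "card (out {c, d} c \<inter> out {c, d} d) \<le> 1"
    using card_out_Int ne by blast+
  ultimately show False using pair_density[OF B(1) ne(1)] pair_density[OF B(2) ne(2)] by linarith
qed

lemma no_pair_two_singles:
  assumes B: "block {a, b} Q" "block {c} Q" "block {d} Q" and ne: "a \<noteq> b" "c \<noteq> d" "{a, b} \<inter> {c, d} = {}"
    and Q: "card Q \<le> \<omega>"
  shows False
proof -
  have "dO {a, b} a + dO {a, b} b + dO {c} c + dO {d} d + 5
    \<le> 2 * s + card (out {a, b} a \<inter> out {a, b} b) + card (out {c} c \<inter> out {d} d)"
    by (rule cap4[OF B(1,1) B(2,3)]) (use ne Q in auto)
  moreover have "card (out {a, b} a \<inter> out {a, b} b) \<le> 1" "card (out {c} c \<inter> out {d} d) \<le> 1"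
    using card_out_Int ne by blast+
  ultimately show False using pair_density[OF B(1) ne(1)] single_density[OF B(2)] single_density[OF B(3)] by linarith
qed

lemma no_four_singles:
  assumes B: "block {a} Q" "block {b} Q" "block {c} Q" "block {d} Q" and ne: "distinct [a, b, c, d]"
    and Q: "card Q \<le> \<omega>"
  shows False
proof -
  have "dO {a} a + dO {b} b + dO {c} c + dO {d} d + 5
    \<le> 2 * s + card (out {a} a \<inter> out {b} b) + card (out {c} c \<inter> out {d} d)"
    by (rule cap4[OF B]) (use ne Q in auto)
  moreover have "card (out {a} a \<inter> out {b} b) \<le> 1" "card (out {c} c \<inter> out {d} d) \<le> 1"
    using card_out_Int ne by auto
  ultimately show False using B[THEN single_density] by linarith
qed

text \<open>Sizes at most 3 with sum at least 4 contain 3+1, 3+2, 3+3, 2+2, 2+1+1 or 1+1+1+1, and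
  each of these has been excluded.\<close>

lemma no_forest:
  assumes fin: "finite \<B>" and block: "\<And>C. C \<in> \<B> \<Longrightarrow> block C Q" and size: "\<And>C. C \<in> \<B> \<Longrightarrow> 1 \<le> card C \<and> card C \<le> 3"
    and disj: "\<And>C F. C \<in> \<B> \<Longrightarrow> F \<in> \<B> \<Longrightarrow> C \<noteq> F \<Longrightarrow> C \<inter> F = {}"
    and Q: "card Q \<le> \<omega>" and big: "4 \<le> (\<Sum>C\<in>\<B>. card C)"
  shows False
proof -
  have one: "\<exists>F\<in>\<B>. F \<noteq> C" if C: "C \<in> \<B>" for C
  proof (rule ccontr)
    assume "\<not> ?thesis"
    then have "\<B> = {C}" using C by blast
    then show False using big size[OF C] by simp
  qed
  have c1: "card C \<in> {1, 2, 3}" if "C \<in> \<B>" for C using size[OF that] by auto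
  show False
  proof (cases "\<exists>C\<in>\<B>. card C = 3")
    case True
    then obtain C where C: "C \<in> \<B>" "card C = 3" by blast
    then obtain F where F: "F \<in> \<B>" "F \<noteq> C" using one by blast
    have d: "C \<inter> F = {}" using disj C F by blast
    have bs: "block C Q" "block F Q" using block C F by auto
    consider "card F = 1" | "card F = 2" | "card F = 3" using c1[OF F(1)] by blast
    then show False
    proof cases
      case 1
      then obtain a where "F = {a}" by (rule card_1_singletonE)
      then show False using no_triple_single[of C Q a] bs C d Q by auto
    next
      case 2
      then obtain a b where "F = {a, b}" "a \<noteq> b" by (auto simp: card_2_iff)
      then show False using no_triple_pair[of C Q a b] bs C d Q by auto
    next
      case 3
      then show False using no_two_triples[OF bs C(2) 3 d Q] by simp
    qed
  next
    case n3: False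
    then have c2: "card C = 1 \<or> card C = 2" if "C \<in> \<B>" for C using c1[OF that] that by auto
    show False
    proof (cases "\<exists>C\<in>\<B>. card C = 2")
      case True
      then obtain C where C: "C \<in> \<B>" "card C = 2" by blast
      obtain a b where ab: "C = {a, b}" "a \<noteq> b" using C(2) by (auto simp: card_2_iff)
      have others: "card F = 1" if F: "F \<in> \<B>" "F \<noteq> C" for F
      proof (rule ccontr)
        assume "card F \<noteq> 1"
        then obtain c d where cd: "F = {c, d}" "c \<noteq> d" using c2[OF F(1)] by (auto simp: card_2_iff)
        show False using no_two_pairs[of a b Q c d] block[OF C(1)] block[OF F(1)] disj[OF C(1) F(1)] F(2) Q ab cd by auto
      qed
      obtain F where F: "F \<in> \<B>" "F \<noteq> C" using one C by blast
      have "\<exists>G\<in>\<B>. G \<noteq> C \<and> G \<noteq> F"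
      proof (rule ccontr)
        assume "\<not> ?thesis"
        then have "\<B> = {C, F}" using C F by blast
        then show False using big C others[OF F] F by simp
      qed
      then obtain G where G: "G \<in> \<B>" "G \<noteq> C" "G \<noteq> F" by blast
      obtain c where c: "F = {c}" using others[OF F] by (rule card_1_singletonE)
      obtain d where d: "G = {d}" using others[OF G(1,2)] by (rule card_1_singletonE)
      show False
        using no_pair_two_singles[of a b Q c d] block[OF C(1)] block[OF F(1)] block[OF G(1)]
          disj[OF C(1) F(1)] disj[OF C(1) G(1)] disj[OF F(1) G(1)] F G Q ab c d by auto
    next
      case False
      then have all1: "card C = 1" if "C \<in> \<B>" for C using c2[OF that] that by auto
      then have "4 \<le> card \<B>" using big by simp
      then obtain \<C> where \<C>: "\<C> \<subseteq> \<B>" "card \<C> = 4" using obtain_subset_with_card_n by metis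
      then obtain A B C F where Cs: "\<C> = {A, B, C, F}" "distinct [A, B, C, F]"
        by (auto simp: card_Suc_eq numeral_eq_Suc)
      have inB: "A \<in> \<B>" "B \<in> \<B>" "C \<in> \<B>" "F \<in> \<B>" using \<C> Cs by auto
      obtain a where a: "A = {a}" using all1[OF inB(1)] by (rule card_1_singletonE)
      obtain b where b: "B = {b}" using all1[OF inB(2)] by (rule card_1_singletonE)
      obtain c where c: "C = {c}" using all1[OF inB(3)] by (rule card_1_singletonE)
      obtain d where d: "F = {d}" using all1[OF inB(4)] by (rule card_1_singletonE)
      from a b c d show False using no_four_singles[of a Q b c d] inB[THEN block] Q Cs by auto
    qed
  qed
qed

text \<open>At the lowest \<open>u\<close> with a subtree of at least four vertices,
  \<open>no_forest\<close> leaves at most three vertices to the subtrees of the children. The clique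
  above \<open>T u\<close> is then \<open>K u\<close> without \<open>u\<close>, which gains one in
  the later count.\<close>

lemma quad_T:
  obtains u where "u \<in> V" "card (T u) = 4"
proof -
  obtain u where u: "u \<in> V" "4 \<le> card (T u)" "\<And>v. (v, u) \<in> R \<Longrightarrow> card (T v) \<le> 3" by (rule lowest_big_T) blast
  let ?ch = "{v. (v, u) \<in> R}"
  have finT: "finite (T v)" if "v \<in> V" for v using T_sub[OF that] finV finite_subset by blast
  have chV: "?ch \<subseteq> V" using R_D E_V by blast
  then have finch: "finite ?ch" using finV finite_subset by blast
  have un: "u \<notin> (\<Union>v\<in>?ch. T v)" using T_root by blast
  have finU: "finite (\<Union>v\<in>?ch. T v)" using finch finT chV by auto
  have card_U: "card (\<Union>v\<in>?ch. T v) = (\<Sum>v\<in>?ch. card (T v))"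
  proof (rule card_UN_disjoint[OF finch])
    show "\<forall>v\<in>?ch. finite (T v)" using finT chV by blast
    show "\<forall>v\<in>?ch. \<forall>w\<in>?ch. v \<noteq> w \<longrightarrow> T v \<inter> T w = {}" using T_disjoint by blast
  qed
  have card_T: "card (T u) = Suc (\<Sum>v\<in>?ch. card (T v))"
    using card_insert_disjoint[OF finU un] T_children[of u] card_U by simp
  have selfT: "v \<in> T v" for v by (simp add: T_def)
  have injT: "inj_on T ?ch" using T_disjoint selfT by (intro inj_onI) blast
  have "\<not> 4 \<le> (\<Sum>v\<in>?ch. card (T v))"
  proof
    assume b: "4 \<le> (\<Sum>v\<in>?ch. card (T v))"
    show False
    proof (rule no_forest[of "T ` ?ch" "insert u (K u)"])
      show "finite (T ` ?ch)" using finch by simp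
      show "block C (insert u (K u))" if "C \<in> T ` ?ch" for C using that block_child by blast
      show "1 \<le> card C \<and> card C \<le> 3" if CT: "C \<in> T ` ?ch" for C
      proof -
        obtain v where v: "(v, u) \<in> R" "C = T v" using CT by blast
        then have "v \<in> V" using chV by blast
        then have "card (T v) \<noteq> 0" using finT selfT[of v] by auto
        then show ?thesis using u(3)[OF v(1)] v(2) by simp
      qed
      show "C \<inter> F = {}" if "C \<in> T ` ?ch" "F \<in> T ` ?ch" "C \<noteq> F" for C F using that T_disjoint by blast
      show "card (insert u (K u)) \<le> \<omega>" using card_K[of u] finK[of u] by (simp add: card_insert_if)
      show "4 \<le> (\<Sum>C\<in>T ` ?ch. card C)" using b by (simp add: sum.reindex[OF injT])
    qed
  qed
  then have "card (T u) = 4" using card_T u(2) by linarith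
  then show ?thesis using that u(1) by blast
qed

end

section \<open>Subtrees with four vertices\<close>

context critical
begin

lemma K_T_disjoint: "T u \<inter> K u = {}"
proof -
  have "f x \<le> f u" if "x \<in> T u" for x using that trancl_le by (simp add: T_def)
  then show ?thesis by (fastforce simp: K_def)
qed

end

text \<open>A colouring \<open>col\<close> of the rest is fixed from here on, so that the argument
  can speak of the actual colours on \<open>K u\<close> and not only of degrees.\<close>

locale quad = critical +
  fixes u :: 'a and col :: "'a \<Rightarrow> nat"
  assumes u_V: "u \<in> V" and card_T: "card (T u) = 4"
    and col: "ok (\<lambda>_. {1..k}) (V - T u) col"
    and not_lcol_T: "\<not> lcol (res (\<lambda>_. {1..k}) col (V - T u)) (T u)"
begin

abbreviation W :: "'a set" where "W \<equiv> T u"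
abbreviation Q :: "'a set" where "Q \<equiv> K u"
abbreviation L :: "'a \<Rightarrow> nat set" where "L \<equiv> res (\<lambda>_. {1..k}) col (V - W)"
abbreviation B :: "'a \<Rightarrow> 'a set" where "B w \<equiv> K w - W"

lemma blk: "block W Q"
  by (rule block_T[OF u_V])

lemma finW: "finite W"
  by (rule block_fin[OF blk])

lemma W_V: "W \<subseteq> V"
  by (rule T_sub[OF u_V])

lemma finL: "finite (L w)"
  by (simp add: res_def)

lemma L_ge: "w \<in> W \<Longrightarrow> k \<le> card (L w) + card (B w) + 2 * dO W w"
  using card_res[of "V - W" "\<lambda>_. {1..k}" w col] finV K_split(4,5)[OF blk] by simp

lemma L_ge_up: "w \<in> W \<Longrightarrow> s + up W w \<le> card (L w) + 2 * dO W w"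
  using L_ge[of w] K_split(1)[OF blk, of w] card_K[of w] k_eq by linarith

lemma Q_le: "card Q + 10 \<le> 2 * s"
  using card_K[of u] \<omega>_le by linarith

text \<open>If \<open>T u\<close> is not critical for \<open>L\<close>, a critical proper part
  \<open>N\<close> brings in the surplus of \<open>density_step\<close>, the edges leaving
  \<open>N\<close>. The counts on four vertices have no room for it.\<close>

lemma not_minimal:
  assumes M: "M \<subset> W" and nl: "\<not> lcol L M"
  obtains N where "N \<subset> W" "N \<noteq> {}"
    "4 * s + (\<Sum>w\<in>N. dE (W - N) w) \<le> (\<Sum>w\<in>W. up W w) + (\<Sum>w\<in>W. dD W w) + 2 * (\<Sum>w\<in>W. dO W w)"
proof -
  have fM: "finite M" using M finW finite_subset by blast
  obtain N where N: "N \<subseteq> M" "\<not> lcol L N" "\<And>S. S \<subset> N \<Longrightarrow> lcol L S"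
    using minimal_not_lcol[OF fM nl] by blast
  have ne: "N \<noteq> {}" using N(2) lcol_empty by blast
  have NW: "N \<subset> W" using N(1) M by blast
  have fN: "finite N" using NW finW finite_subset by blast
  have "(\<Sum>w\<in>N. card (L w) + dD N w) \<le> (\<Sum>w\<in>N. dE N w + 2 * dD N w)"
    by (rule density[OF fN finL N(2,3)]) auto
  then have full: "(\<Sum>w\<in>N. card (L w)) \<le> (\<Sum>w\<in>N. dE N w + dD N w)"
    by (simp add: sum.distrib sum_distrib_left[symmetric])
  have VU: "(V - W) \<union> W = V" using W_V by blast
  have "(\<Sum>w\<in>W - N. k + dD (W - N) w) \<le> (\<Sum>w\<in>W - N. dE V w + 2 * dD V w)"
    by (rule V_density) (use W_V in blast)
  then have "(\<Sum>w\<in>W. k + dD W w) + (\<Sum>w\<in>N. dE (W - N) w) \<le> (\<Sum>w\<in>W. dE V w + 2 * dD V w)"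
    using density_step[of "V - W" W "\<lambda>_. {1..k}" N col] finV finW NW full unfolding VU by auto
  from block_count[OF blk this] show ?thesis using that[OF NW ne] card_T by simp
qed

text \<open>The case of equality in counting the backbone neighbours of \<open>W\<close> in \<open>Q\<close>.\<close>

definition tight :: bool where
  "tight \<longleftrightarrow> (\<forall>w\<in>W. card (L w) + 2 * dO W w = s + up W w) \<and> card Q + 1 = \<omega> \<and> \<omega> + 9 = 2 * s
     \<and> (\<Union>w\<in>W. out W w) = Q"

text \<open>Summing \<open>L_ge_up\<close> over \<open>W\<close> and bounding the
  \<open>dO W w\<close> by |Q| + \<open>p\<close> closes up: 4s plus the sum of \<open>up\<close> is
  at most 20 + 2|Q| plus the sum of \<open>up\<close>, and 2|Q| \<le> 4s - 20 by
  \<open>Q_le\<close>. Hence equality holds throughout.\<close>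

lemma tightI:
  assumes ps: "(\<Sum>w\<in>W. dO W w) \<le> card (\<Union>w\<in>W. out W w) + p"
    and le: "(\<Sum>w\<in>W. card (L w)) + 2 * p \<le> 20 + (\<Sum>w\<in>W. up W w)"
  shows tight
proof -
  let ?U = "\<Union>w\<in>W. out W w"
  have UQ: "?U \<subseteq> Q" using out_block[OF blk] by blast
  have cU: "card ?U \<le> card Q" by (rule card_mono[OF finK UQ])
  have ge: "(\<Sum>w\<in>W. s + up W w) \<le> (\<Sum>w\<in>W. card (L w) + 2 * dO W w)"
    by (rule sum_mono) (rule L_ge_up)
  have l: "(\<Sum>w\<in>W. s + up W w) = 4 * s + (\<Sum>w\<in>W. up W w)" using card_T by (simp add: sum.distrib)
  have r: "(\<Sum>w\<in>W. card (L w) + 2 * dO W w) = (\<Sum>w\<in>W. card (L w)) + 2 * (\<Sum>w\<in>W. dO W w)"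
    by (simp add: sum.distrib sum_distrib_left)
  have eq: "(\<Sum>w\<in>W. s + up W w) = (\<Sum>w\<in>W. card (L w) + 2 * dO W w)"
    using ge l r ps le cU Q_le by linarith
  have cUQ: "card ?U = card Q" "card Q + 10 = 2 * s" using ge l r ps le cU Q_le by linarith+
  then have "?U = Q" using card_subset_eq[OF finK UQ] by blast
  moreover have "s + up W w = card (L w) + 2 * dO W w" if "w \<in> W" for w
    using sum_mono_inv[OF eq L_ge_up that finW] .
  ultimately show ?thesis using cUQ card_K[of u] \<omega>_le unfolding tight_def by auto
qed

lemma exact:
  assumes tight and w: "w \<in> W"
  shows "card (L w) + card (B w) + 2 * dO W w = k" "card (B w) + up W w + 1 = \<omega>"
    "card (L w) + 2 * dO W w = s + up W w"
proof -
  show 1: "card (L w) + 2 * dO W w = s + up W w" using assms by (simp add: tight_def)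
  then show "card (L w) + card (B w) + 2 * dO W w = k" "card (B w) + up W w + 1 = \<omega>"
    using L_ge[OF w] K_split(1)[OF blk w] card_K[of w] k_eq by linarith+
qed

lemma res_cover:
  assumes w: "w \<in> W"
  shows "{1..k} \<subseteq> L w \<union> col ` B w \<union> (\<lambda>y. col y + 1) ` out W w \<union> (\<lambda>y. col y - 1) ` out W w"
proof
  fix i assume i: "i \<in> {1..k}"
  show "i \<in> L w \<union> col ` B w \<union> (\<lambda>y. col y + 1) ` out W w \<union> (\<lambda>y. col y - 1) ` out W w"
  proof (rule ccontr)
    assume n: "\<not> ?thesis"
    have "(E w y \<longrightarrow> i \<noteq> col y) \<and> (D w y \<longrightarrow> far i (col y))" if y: "y \<in> V - W" for y
    proof -
      have E: "i \<noteq> col y" if "E w y"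
      proof -
        have "f w < f y" using blk w y that by (auto simp: block_def)
        then have "y \<in> B w" using that y by (simp add: K_def)
        then show ?thesis using n by blast
      qed
      have "far i (col y)" if "D w y"
      proof -
        have "y \<in> out W w" using that y by (simp add: out_def)
        then have "i \<noteq> col y + 1" "i \<noteq> col y - 1" using n by blast+
        moreover have "i \<noteq> col y" by (rule E[OF D_imp_E[OF that]])
        ultimately show ?thesis by (auto simp: far_def)
      qed
      then show ?thesis using E by blast
    qed
    then have "i \<in> L w" using i by (simp add: res_def)
    then show False using n by blast
  qed
qed

lemma out_sub_B: "w \<in> W \<Longrightarrow> out W w \<subseteq> B w"
proof
  fix y assume w: "w \<in> W" and y: "y \<in> out W w"
  then have "E w y" using D_imp_E by (simp add: out_def)
  moreover have "y \<notin> W" using y by (simp add: out_def)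
  ultimately show "y \<in> B w" using blk w by (auto simp: block_def K_def)
qed

text \<open>In the tight case the colours blocked at \<open>w\<close> are pairwise distinct.\<close>

lemma tight_no_overlap:
  assumes t: tight and w: "w \<in> W" and y: "y \<in> out W w"
  shows "col y + 1 \<le> k" "2 \<le> col y" "\<And>x. x \<in> B w \<Longrightarrow> col x \<noteq> col y + 1" "\<And>x. x \<in> B w \<Longrightarrow> col x + 1 \<noteq> col y"
proof -
  let ?N = "out W w"
  have fB: "finite (B w)" using finK by simp
  \<comment> \<open>If the shifted colour of \<open>y\<close> fell outside 1..k or on a colour of
    \<open>B w\<close>, it could be dropped from the cover, and the sets left would have fewer than
    \<open>k\<close> elements in all.\<close>
  have half: "g y \<in> {1..k} - col ` B w"
    if cover: "{1..k} \<subseteq> L w \<union> col ` B w \<union> g ` ?N \<union> h ` ?N" for g h :: "'a \<Rightarrow> nat"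
  proof (rule ccontr)
    assume "\<not> ?thesis"
    then have "{1..k} \<subseteq> L w \<union> col ` B w \<union> g ` (?N - {y}) \<union> h ` ?N" using cover by blast
    from card_mono[OF _ this] have "k \<le> card (L w \<union> col ` B w \<union> g ` (?N - {y}) \<union> h ` ?N)"
      using fB fin_out finL by simp
    also have "\<dots> \<le> card (L w) + card (col ` B w) + card (g ` (?N - {y})) + card (h ` ?N)"
      by (meson add_le_mono card_Un_le le_refl le_trans)
    also have "\<dots> \<le> card (L w) + card (B w) + card (?N - {y}) + card ?N"
      by (intro add_le_mono card_image_le le_refl) (use fB fin_out in auto)
    finally show False using card_Suc_Diff1[OF fin_out y] exact(1)[OF t w] by linarith
  qed
  have up: "col y + 1 \<in> {1..k} - col ` B w"
    by (rule half[of "\<lambda>y. col y + 1" "\<lambda>y. col y - 1"]) (rule res_cover[OF w])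
  have dn: "col y - 1 \<in> {1..k} - col ` B w"
    by (rule half[of "\<lambda>y. col y - 1" "\<lambda>y. col y + 1"]) (use res_cover[OF w] in blast)
  show "col y + 1 \<le> k" "2 \<le> col y" using up dn by auto
  show "col x \<noteq> col y + 1" if "x \<in> B w" for x using up that by force
  show "col x + 1 \<noteq> col y" if "x \<in> B w" for x using dn that by force
qed

lemma tight_cover:
  assumes tight and y: "y \<in> Q"
  obtains w where "w \<in> W" "y \<in> out W w"
proof -
  have "(\<Union>w\<in>W. out W w) = Q" using assms(1) by (simp add: tight_def)
  then show ?thesis using y that by (metis UN_E)
qed

definition consec :: "'a set" where
  "consec = {y \<in> Q. \<exists>x\<in>Q. col x = col y + 1}"

lemma Q_sub: "Q \<subseteq> V - W"
  using K_sub K_T_disjoint by blast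

lemma inj_col: "inj_on col Q"
proof (rule inj_onI, rule ccontr)
  fix x y assume xy: "x \<in> Q" "y \<in> Q" "col x = col y" "x \<noteq> y"
  then have "E x y" using peo[of u x y] by (auto simp: K_def)
  then show False using col xy Q_sub by (auto simp: ok_def)
qed

text \<open>The colours on \<open>Q\<close> and their successors lie in 2..k by
  \<open>tight_no_overlap\<close>. Two sets of size \<omega> - 1 among s + \<omega> - 2 numbers
  overlap in at least \<omega> - s = s - 9 of them.\<close>

lemma card_consec: "tight \<Longrightarrow> s \<le> card consec + 9"
proof -
  assume t: tight
  have rng: "2 \<le> col y \<and> col y + 1 \<le> k" if "y \<in> Q" for y
  proof -
    obtain w where "w \<in> W" "y \<in> out W w" by (rule tight_cover[OF t \<open>y \<in> Q\<close>])
    then show ?thesis using tight_no_overlap(1,2)[OF t] by blast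
  qed
  let ?S = "(\<lambda>y. col y + 1)"
  have injS: "inj_on ?S Q" using inj_col by (auto simp: inj_on_def)
  have sub: "col ` Q \<union> ?S ` Q \<subseteq> {2..k}" using rng by fastforce
  have int: "col ` Q \<inter> ?S ` Q \<subseteq> ?S ` consec" by (auto simp: consec_def)
  have fO: "finite consec" using finK by (simp add: consec_def)
  have "card (col ` Q) + card (?S ` Q) = card (col ` Q \<union> ?S ` Q) + card (col ` Q \<inter> ?S ` Q)"
    by (rule card_Un_Int) (use finK in auto)
  moreover have "card (col ` Q \<inter> ?S ` Q) \<le> card consec"
    using card_mono[OF _ int] fO card_image_le[OF fO, of ?S] by (meson finite_imageI order_trans)
  moreover have "card (col ` Q \<union> ?S ` Q) \<le> k - 1" using card_mono[OF _ sub] by simp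
  moreover have "card (col ` Q) = card Q" "card (?S ` Q) = card Q"
    using card_image[OF inj_col] card_image[OF injS] by auto
  ultimately show ?thesis using t k_eq s_ge unfolding tight_def by linarith
qed

text \<open>\<open>y\<close> is a backbone neighbour of some \<open>v\<close>, where it blocks the
  colour of \<open>x\<close> as a successor colour; since blocked colours do not coincide,
  \<open>x\<close> is not in \<open>B v\<close>. The same holds with \<open>x\<close> and
  \<open>y\<close> exchanged.\<close>

lemma consec_witness:
  assumes t: tight and y: "y \<in> consec"
  obtains x v w where "x \<in> Q" "col x = col y + 1" "v \<in> W" "w \<in> W" "y \<in> B v" "x \<in> B w" "x \<notin> B v" "y \<notin> B w"
proof -
  obtain x where x: "x \<in> Q" "col x = col y + 1" and yQ: "y \<in> Q" using y by (auto simp: consec_def)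
  obtain v where v: "v \<in> W" "y \<in> out W v" by (rule tight_cover[OF t yQ])
  obtain w where w: "w \<in> W" "x \<in> out W w" by (rule tight_cover[OF t x(1)])
  have "y \<in> B v" "x \<in> B w" using out_sub_B v w by blast+
  moreover have "x \<notin> B v" using tight_no_overlap(3)[OF t v] x by blast
  moreover have "y \<notin> B w" using tight_no_overlap(4)[OF t w] x by fastforce
  ultimately show ?thesis using that x v w by blast
qed

text \<open>A colour and its successor on \<open>Q\<close> are blocked at vertices with incomparable neighbourhoods, and there are not enough colours to avoid such pairs.\<close>

lemma nested:
  assumes t: tight and "\<And>v w. v \<in> W \<Longrightarrow> w \<in> W \<Longrightarrow> B v \<subseteq> B w \<or> B w \<subseteq> B v"
  shows False
proof -
  have "consec \<noteq> {}" using card_consec[OF t] s_ge by auto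
  then obtain y where "y \<in> consec" by blast
  then show False by (rule consec_witness[OF t]) (use assms(2) in blast)
qed

lemma B_mono: "v \<in> W \<Longrightarrow> w \<in> W \<Longrightarrow> E v w \<Longrightarrow> f v < f w \<Longrightarrow> B v \<subseteq> B w"
proof
  fix x assume vw: "v \<in> W" "w \<in> W" "E v w" "f v < f w" and x: "x \<in> B v"
  then have "E w x" using peo[of v w x] by (auto simp: K_def)
  moreover have "f w < f x" using blk vw(2) x calculation by (auto simp: block_def)
  ultimately show "x \<in> B w" using x by (simp add: K_def)
qed

end

section \<open>List colourings of four vertices\<close>

lemma far_pair_card:
  assumes "finite A" "finite B" "1 \<le> card A" "1 \<le> card B" "5 \<le> card A + card B"
  shows "\<exists>a\<in>A. \<exists>b\<in>B. far a b"
proof -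
  have "A \<noteq> {}" "B \<noteq> {}" using assms by auto
  then show ?thesis using far_pair[OF assms(1,2) _ _ assms(5)] by blast
qed

text \<open>A complete graph on four vertices minus the edge of \<open>x\<close> and
  \<open>v\<close>, with backbone xy, zv. Giving the smallest colour \<open>m\<close> to
  \<open>x\<close> leaves a triangle, so the lists must be those of
  \<open>triangle_exception\<close>. Then \<open>z\<close> takes \<open>m\<close> and
  \<open>v\<close> takes \<open>b + 1\<close> instead.\<close>

lemma diamond_lists_aux:
  assumes fin: "finite X" "finite Y" "finite Z" "finite U"
    and card: "3 \<le> card X" "4 \<le> card Y" "4 \<le> card Z" "3 \<le> card U"
    and m: "m \<in> X" and min: "\<And>i. i \<in> X \<union> Y \<union> Z \<union> U \<Longrightarrow> m \<le> i"
  shows "\<exists>x\<in>X. \<exists>y\<in>Y. \<exists>z\<in>Z. \<exists>v\<in>U. far x y \<and> far z v \<and> y \<noteq> z \<and> x \<noteq> z \<and> v \<noteq> y"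
proof (rule ccontr)
  assume "\<not> ?thesis"
  then have none: "\<not> (far x y \<and> far z v)" if "x \<in> X" "y \<in> Y" "z \<in> Z" "v \<in> U" "y \<noteq> z" "x \<noteq> z" "v \<noteq> y" for x y z v
    using that by blast
  have far: "far m y" if "y \<in> Y - {m, m + 1}" for y
  proof -
    have "m \<le> y" "y \<noteq> m" "y \<noteq> m + 1" using that min by auto
    then show ?thesis by (simp add: far_def)
  qed
  obtain b where b: "Y - {m, m + 1} = {b, b + 2}" "Z - {m} = {b, b + 1, b + 2}" "U = {b, b + 1, b + 2}"
  proof (rule triangle_exception[of "Y - {m, m + 1}" "Z - {m}" U])
    show "2 \<le> card (Y - {m, m + 1})" by (rule card_Diff2_ge) (use fin card in auto)
    show "3 \<le> card (Z - {m})" by (rule card_Diff1_ge) (use fin card in auto)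
    fix p q r assume h: "p \<in> Y - {m, m + 1}" "q \<in> Z - {m}" "r \<in> U" "p \<noteq> q" "p \<noteq> r"
    show "\<not> far q r" using none[of m p q r] m h far[OF h(1)] by auto
  qed (use fin card that in auto)
  have "card (Z - {m}) = 3" unfolding b(2) by simp
  then have mZ: "m \<in> Z" using card(3) by (cases "m \<in> Z") auto
  have "b \<in> Y - {m, m + 1}" unfolding b(1) by simp
  then have bm: "m + 2 \<le> b" using min[of b] by auto
  have sub: "Y \<subseteq> insert m (insert (m + 1) {b, b + 2})" using b(1) by blast
  have "card Y = card (insert m (insert (m + 1) {b, b + 2}))"
    using card_mono[OF _ sub] card(2) bm by simp
  then have Y: "Y = insert m (insert (m + 1) {b, b + 2})" by (intro card_subset_eq) (use sub in auto)
  have X2: "2 \<le> card (X - {m})" by (rule card_Diff1_ge) (use fin card in auto)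
  moreover have c3: "card {m + 1, b, b + 2} = 3" using bm by simp
  ultimately have "\<exists>x\<in>X - {m}. \<exists>y\<in>{m + 1, b, b + 2}. far x y"
    by (intro far_pair_card) (use fin in simp_all)
  then obtain x y where xy: "x \<in> X - {m}" "y \<in> {m + 1, b, b + 2}" "far x y" by blast
  have "y \<in> Y" using xy(2) unfolding Y by blast
  moreover have "b + 1 \<in> U" unfolding b(3) by simp
  moreover have "far m (b + 1)" using bm by (simp add: far_def)
  moreover have "m \<noteq> y" "b + 1 \<noteq> y" using xy(2) bm by auto
  ultimately show False using none[of x y m "b + 1"] xy mZ by auto
qed

lemma diamond_lists:
  assumes fin: "finite X" "finite Y" "finite Z" "finite U"
    and card: "3 \<le> card X" "4 \<le> card Y" "4 \<le> card Z" "3 \<le> card U"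
  shows "\<exists>x\<in>X. \<exists>y\<in>Y. \<exists>z\<in>Z. \<exists>v\<in>U. far x y \<and> far z v \<and> y \<noteq> z \<and> x \<noteq> z \<and> v \<noteq> y"
proof -
  define m where "m = Min (X \<union> Y \<union> Z \<union> U)"
  have ne: "X \<union> Y \<union> Z \<union> U \<noteq> {}" using card by auto
  have min: "\<And>i. i \<in> X \<union> Y \<union> Z \<union> U \<Longrightarrow> m \<le> i" unfolding m_def using fin by simp
  \<comment> \<open>If neither outer list contains \<open>m\<close>, a central vertex takes it. Its
    partner then avoids only \<open>m + 1\<close>, and the other pair keeps at least 2 + 3
    colours.\<close>
  have centre: "\<exists>x\<in>X. \<exists>z\<in>Z. \<exists>v\<in>U. far x m \<and> far z v \<and> m \<noteq> z \<and> x \<noteq> z \<and> v \<noteq> m"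
    if fin: "finite X" "finite Z" "finite U" and card: "3 \<le> card X" "4 \<le> card Z" "3 \<le> card U"
      and m: "m \<notin> X" "m \<notin> U" and min: "\<And>i. i \<in> X \<Longrightarrow> m \<le> i" for X Z U :: "nat set"
  proof -
    have "1 \<le> card (X - {m + 1})" by (rule card_Diff1_ge) (use fin card in auto)
    then have "X - {m + 1} \<noteq> {}" by (metis card.empty not_one_le_zero)
    then obtain x where x: "x \<in> X" "x \<noteq> m + 1" by blast
    have "x \<noteq> m" "m \<le> x" using x m min by auto
    then have xm: "far x m" using x(2) by (simp add: far_def)
    have "2 \<le> card (Z - {m, x})" by (rule card_Diff2_ge) (use fin card in auto)
    then have "\<exists>z\<in>Z - {m, x}. \<exists>v\<in>U. far z v" by (intro far_pair_card) (use fin card in simp_all)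
    then obtain z v where "z \<in> Z - {m, x}" "v \<in> U" "far z v" by blast
    then show ?thesis using x xm m by blast
  qed
  have "m \<in> X \<union> Y \<union> Z \<union> U" unfolding m_def using fin ne by (intro Min_in) auto
  then consider "m \<in> X" | "m \<in> U" | "m \<notin> X" "m \<notin> U" "m \<in> Y" | "m \<notin> X" "m \<notin> U" "m \<in> Z" by blast
  then show ?thesis
  proof cases
    case 1
    show ?thesis by (rule diamond_lists_aux[OF fin card 1 min]) auto
  next
    case 2
    have "\<exists>v\<in>U. \<exists>z\<in>Z. \<exists>y\<in>Y. \<exists>x\<in>X. far v z \<and> far y x \<and> z \<noteq> y \<and> v \<noteq> y \<and> x \<noteq> z"
      by (rule diamond_lists_aux[OF fin(4,3,2,1) card(4,3,2,1) 2 min]) auto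
    then show ?thesis by (metis far_sym)
  next
    case 3
    then show ?thesis using centre[of X Z U] fin card min by (metis UnI1)
  next
    case 4
    then show ?thesis using centre[of U Y X] fin card min by (metis UnI2 far_sym)
  qed
qed

context backbone
begin

lemma lcol4:
  assumes d: "distinct [a, b, c, d]" and A: "i \<in> A a" "j \<in> A b" "k \<in> A c" "l \<in> A d"
    and "E a b \<longrightarrow> i \<noteq> j" "E a c \<longrightarrow> i \<noteq> k" "E a d \<longrightarrow> i \<noteq> l" "E b c \<longrightarrow> j \<noteq> k" "E b d \<longrightarrow> j \<noteq> l" "E c d \<longrightarrow> k \<noteq> l"
    and "D a b \<longrightarrow> far i j" "D a c \<longrightarrow> far i k" "D a d \<longrightarrow> far i l" "D b c \<longrightarrow> far j k" "D b d \<longrightarrow> far j l" "D c d \<longrightarrow> far k l"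
  shows "lcol A {a, b, c, d}"
proof -
  define g where "g v = (if v = a then i else if v = b then j else if v = c then k else l)" for v
  have g: "g a = i" "g b = j" "g c = k" "g d = l" using d by (auto simp: g_def)
  define P where "P v w \<longleftrightarrow> (E v w \<longrightarrow> g v \<noteq> g w) \<and> (D v w \<longrightarrow> far (g v) (g w))" for v w
  have refl: "P v v" for v using E_irrefl[of v] D_imp_E[of v v] by (auto simp: P_def)
  have sym: "P w v" if "P v w" for v w
    using that E_sym[of w v] D_sym[of w v] far_sym[of "g v" "g w"] unfolding P_def by metis
  have ex: "P a b" "P a c" "P a d" "P b c" "P b d" "P c d" unfolding P_def g using assms by blast+
  have "\<forall>v\<in>{a, b, c, d}. \<forall>w\<in>{a, b, c, d}. P v w" using refl ex ex[THEN sym] by simp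
  moreover have "\<forall>v\<in>{a, b, c, d}. g v \<in> A v" using A g by simp
  ultimately have "ok A {a, b, c, d} g" unfolding ok_def P_def by blast
  then show ?thesis unfolding lcol_def by blast
qed

lemma lcol_pair:
  assumes "finite (A x)" "finite (A y)" "1 \<le> card (A x)" "1 \<le> card (A y)" "5 \<le> card (A x) + card (A y)"
  shows "lcol A {x, y}"
proof (cases "x = y")
  case True
  have "A x \<noteq> {}" using assms(3) by auto
  then obtain i where "i \<in> A x" by blast
  then have "ok A {x, y} (\<lambda>_. i)" using True E_irrefl D_imp_E by (auto simp: ok_def)
  then show ?thesis by (auto simp: lcol_def)
next
  case False
  obtain i j where ij: "i \<in> A x" "j \<in> A y" "far i j" using far_pair_card[OF assms] by blast
  then have "ok A {x, y} (\<lambda>v. if v = x then i else j)"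
    using False E_irrefl D_imp_E by (auto simp: ok_def far_def)
  then show ?thesis by (auto simp: lcol_def)
qed

lemma lcol_two_pairs:
  assumes first: "lcol A {x, y}" and fin: "finite (A v)" "finite (A w)" and disj: "{x, y} \<inter> {v, w} = {}" and xy: "x \<noteq> y"
    and v: "dE {x, y} v + 2 * dD {x, y} v < card (A v)" and w: "dE {x, y} w + 2 * dD {x, y} w < card (A w)"
    and sum: "5 + (dE {x, y} v + 2 * dD {x, y} v) + (dE {x, y} w + 2 * dD {x, y} w) \<le> card (A v) + card (A w)"
  shows "lcol A ({x, y} \<union> {v, w})"
proof -
  obtain c where c: "ok A {x, y} c" using first by (auto simp: lcol_def)
  have f: "finite (res A c {x, y} v)" "finite (res A c {x, y} w)" using fin by (auto simp: res_def)
  have "card (A v) \<le> card (res A c {x, y} v) + dE {x, y} v + 2 * dD {x, y} v"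
    "card (A w) \<le> card (res A c {x, y} w) + dE {x, y} w + 2 * dD {x, y} w"
    using card_res[of "{x, y}" A v c] card_res[of "{x, y}" A w c] fin by auto
  then have "1 \<le> card (res A c {x, y} v)" "1 \<le> card (res A c {x, y} w)"
    "5 \<le> card (res A c {x, y} v) + card (res A c {x, y} w)" using v w sum by linarith+
  then have "lcol (res A c {x, y}) {v, w}" using lcol_pair[of "res A c {x, y}" v w] f by auto
  from lcol_extend[OF c this disj] show ?thesis .
qed

text \<open>Sums over all ordered pairs of \<open>W\<close> let simplification settle every subset
  \<open>N\<close> of a four-element set.\<close>

lemma cut_eq:
  assumes "finite W" "N \<subseteq> W"
  shows "(\<Sum>w\<in>N. dE (W - N) w) = (\<Sum>w\<in>W. \<Sum>v\<in>W. of_bool (w \<in> N \<and> v \<notin> N \<and> E w v))"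
    "(\<Sum>w\<in>N. dD (W - N) w) = (\<Sum>w\<in>W. \<Sum>v\<in>W. of_bool (w \<in> N \<and> v \<notin> N \<and> D w v))"
proof -
  have g: "(\<Sum>w\<in>N. card {v \<in> W - N. P w v}) = (\<Sum>w\<in>W. \<Sum>v\<in>W. of_bool (w \<in> N \<and> v \<notin> N \<and> P w v))" for P :: "'a \<Rightarrow> 'a \<Rightarrow> bool"
  proof -
    have "card {v \<in> W - N. P w v} = (\<Sum>v\<in>W. of_bool (v \<notin> N \<and> P w v))" for w
    proof -
      have "{v \<in> W - N. P w v} = W \<inter> {v. v \<notin> N \<and> P w v}" by blast
      then show ?thesis using assms(1) by (simp add: sum_of_bool_eq)
    qed
    then have "(\<Sum>w\<in>N. card {v \<in> W - N. P w v}) = (\<Sum>w\<in>N. \<Sum>v\<in>W. of_bool (w \<in> N \<and> v \<notin> N \<and> P w v))"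
      by (simp cong: sum.cong)
    also have "\<dots> = (\<Sum>w\<in>W. \<Sum>v\<in>W. of_bool (w \<in> N \<and> v \<notin> N \<and> P w v))"
      by (rule sum.mono_neutral_left) (use assms in auto)
    finally show ?thesis .
  qed
  show "(\<Sum>w\<in>N. dE (W - N) w) = (\<Sum>w\<in>W. \<Sum>v\<in>W. of_bool (w \<in> N \<and> v \<notin> N \<and> E w v))"
    "(\<Sum>w\<in>N. dD (W - N) w) = (\<Sum>w\<in>W. \<Sum>v\<in>W. of_bool (w \<in> N \<and> v \<notin> N \<and> D w v))"
    unfolding dE_def dD_def by (rule g)+
qed

end

section \<open>Counting on the four vertices of a subtree\<close>

abbreviation edges4 :: "('a \<Rightarrow> 'a \<Rightarrow> bool) \<Rightarrow> 'a \<Rightarrow> 'a \<Rightarrow> 'a \<Rightarrow> 'a \<Rightarrow> nat" where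
  "edges4 P a b c d \<equiv> of_bool (P a b) + of_bool (P a c) + of_bool (P a d) + of_bool (P b c) + of_bool (P b d) + of_bool (P c d)"

context quad
begin

definition pI :: "'a \<Rightarrow> 'a \<Rightarrow> nat" where
  "pI x y = card (out W x \<inter> out W y)"

abbreviation pI4 :: "'a \<Rightarrow> 'a \<Rightarrow> 'a \<Rightarrow> 'a \<Rightarrow> nat" where
  "pI4 a b c d \<equiv> pI a b + pI a c + pI a d + pI b c + pI b d + pI c d"

lemma pI_le: "x \<noteq> y \<Longrightarrow> pI x y \<le> 1"
  unfolding pI_def by (rule card_out_Int)

lemma pI_0: "x \<noteq> y \<Longrightarrow> z \<in> W \<Longrightarrow> D x z \<Longrightarrow> D z y \<Longrightarrow> pI x y = 0"
  unfolding pI_def using out_Int_empty[of x y z W W] by simp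

lemma sums:
  assumes W: "W = {a, b, c, d}" and d: "distinct [a, b, c, d]"
  shows "(\<Sum>w\<in>W. g w) = g a + g b + g c + (g d :: nat)"
    "(\<Sum>w\<in>W. dE W w) = 2 * edges4 E a b c d"
    "(\<Sum>w\<in>W. dD W w) = 2 * edges4 D a b c d"
    "(\<Sum>w\<in>W. up W w) = edges4 E a b c d"
    "(\<Sum>w\<in>W. dO W w) \<le> card (\<Union>w\<in>W. out W w) + pI4 a b c d"
proof -
  show S: "(\<Sum>w\<in>W. g w) = g a + g b + g c + (g d :: nat)" for g unfolding W using d by simp
  have E: "E b a = E a b" "E c a = E a c" "E d a = E a d" "E c b = E b c" "E d b = E b d" "E d c = E c d" using E_sym by blast+
  have D: "D b a = D a b" "D c a = D a c" "D d a = D a d" "D c b = D b c" "D d b = D b d" "D d c = D c d" using D_sym by blast+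
  have dE: "dE W x = of_bool (E x a) + of_bool (E x b) + of_bool (E x c) + of_bool (E x d)" for x
    unfolding W using d by (simp add: deg_simps of_bool_def)
  have dD: "dD W x = of_bool (D x a) + of_bool (D x b) + of_bool (D x c) + of_bool (D x d)" for x
    unfolding W using d by (simp add: deg_simps of_bool_def)
  show e: "(\<Sum>w\<in>W. dE W w) = 2 * edges4 E a b c d"
    unfolding S dE E using E_irrefl by simp
  show "(\<Sum>w\<in>W. dD W w) = 2 * edges4 D a b c d"
    unfolding S dD D using D_irrefl by simp
  show "(\<Sum>w\<in>W. up W w) = edges4 E a b c d"
    using e sum_dE_up[OF finW W_V] by simp
  have b: "(\<Sum>x\<leftarrow>[a, b, c, d]. dO W x) \<le> card (\<Union>x\<in>set [a, b, c, d]. out W x) + pair_sum (out W) [a, b, c, d]"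
    by (rule bonferroni) (rule fin_out)
  have l: "(\<Sum>x\<leftarrow>[a, b, c, d]. dO W x) = (\<Sum>w\<in>W. dO W w)" by (simp add: S)
  have r: "set [a, b, c, d] = W" unfolding W by simp
  have p: "pair_sum (out W) [a, b, c, d] = pI4 a b c d"
    by (simp add: pI_def)
  show "(\<Sum>w\<in>W. dO W w) \<le> card (\<Union>w\<in>W. out W w) + pI4 a b c d"
    using b unfolding l r p .
qed

lemma card_UN_out: "card (\<Union>w\<in>W. out W w) + 10 \<le> 2 * s"
proof -
  have "card (\<Union>w\<in>W. out W w) \<le> card Q" by (rule card_mono[OF finK]) (use out_block[OF blk] in blast)
  then show ?thesis using Q_le by linarith
qed

lemma count:
  assumes W: "W = {a, b, c, d}" and d: "distinct [a, b, c, d]"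
    and n: "4 * s + t \<le> (\<Sum>w\<in>W. up W w) + (\<Sum>w\<in>W. dD W w) + 2 * (\<Sum>w\<in>W. dO W w)"
  shows "20 + t \<le> edges4 E a b c d
    + 2 * edges4 D a b c d
    + 2 * pI4 a b c d"
proof -
  define S where "S = (\<Sum>w\<in>W. dO W w)"
  define p where "p = pI4 a b c d"
  have "S \<le> card (\<Union>w\<in>W. out W w) + p" unfolding S_def p_def by (rule sums(5)[OF W d])
  then have "S + 10 \<le> 2 * s + p" using card_UN_out by linarith
  then show ?thesis using n unfolding sums(3,4)[OF W d] S_def[symmetric] p_def[symmetric] by linarith
qed

lemma count0:
  assumes W: "W = {a, b, c, d}" and d: "distinct [a, b, c, d]"
  shows "20 \<le> edges4 E a b c d
    + 2 * edges4 D a b c d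
    + 2 * pI4 a b c d"
  using count[OF W d, of 0] block_density[OF blk] card_T by simp

text \<open>The backbone inside \<open>W\<close> is exactly a perfect matching, the one case that
  the bound 7 of \<open>backbone_pairs\<close> does not cover.\<close>

definition matching :: "'a \<Rightarrow> 'a \<Rightarrow> 'a \<Rightarrow> 'a \<Rightarrow> bool" where
  "matching a b c d \<longleftrightarrow> W = {a, b, c, d} \<and> distinct [a, b, c, d] \<and> D a b \<and> D c d
     \<and> \<not> D a c \<and> \<not> D a d \<and> \<not> D b c \<and> \<not> D b d"

text \<open>Ends of a two-edge backbone path in \<open>W\<close> share nothing outside, other pairs
  at most one vertex, and there is no 4-cycle. The rest is a check of all backbones on four
  vertices.\<close>

lemma backbone_pairs:
  assumes W: "W = {a, b, c, d}" and d: "distinct [a, b, c, d]"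
    and m: "\<not> matching a b c d" "\<not> matching a c b d" "\<not> matching a d b c"
  shows "edges4 D a b c d
    + pI4 a b c d \<le> (7 :: nat)"
proof -
  have ne: "a \<noteq> b" "a \<noteq> c" "a \<noteq> d" "b \<noteq> c" "b \<noteq> d" "c \<noteq> d" using d by auto
  have le: "pI a b \<le> 1" "pI a c \<le> 1" "pI a d \<le> 1" "pI b c \<le> 1" "pI b d \<le> 1" "pI c d \<le> 1"
    using pI_le ne by auto
  have D: "D b a = D a b" "D c a = D a c" "D d a = D a d" "D c b = D b c" "D d b = D b d" "D d c = D c d" using D_sym by blast+
  have in_W: "a \<in> W" "b \<in> W" "c \<in> W" "d \<in> W" using W by auto
  have z: "D a c \<and> D b c \<or> D a d \<and> D b d \<longrightarrow> pI a b = 0" "D a b \<and> D b c \<or> D a d \<and> D c d \<longrightarrow> pI a c = 0"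
    "D a b \<and> D b d \<or> D a c \<and> D c d \<longrightarrow> pI a d = 0" "D a b \<and> D a c \<or> D b d \<and> D c d \<longrightarrow> pI b c = 0"
    "D a b \<and> D a d \<or> D b c \<and> D c d \<longrightarrow> pI b d = 0" "D a c \<and> D a d \<or> D b c \<and> D b d \<longrightarrow> pI c d = 0"
    using pI_0[OF ne(1) in_W(3)] pI_0[OF ne(1) in_W(4)] pI_0[OF ne(2) in_W(2)] pI_0[OF ne(2) in_W(4)]
      pI_0[OF ne(3) in_W(2)] pI_0[OF ne(3) in_W(3)] pI_0[OF ne(4) in_W(1)] pI_0[OF ne(4) in_W(4)]
      pI_0[OF ne(5) in_W(1)] pI_0[OF ne(5) in_W(3)] pI_0[OF ne(6) in_W(1)] pI_0[OF ne(6) in_W(2)]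
    unfolding D by blast+
  have c4: "\<not> (D a b \<and> D b c \<and> D c d \<and> D a d)" "\<not> (D a b \<and> D b d \<and> D c d \<and> D a c)" "\<not> (D a c \<and> D b c \<and> D b d \<and> D a d)"
    using common[of a b c d] common[of a b d c] common[of a c b d] ne unfolding D by blast+
  have m': "\<not> (D a b \<and> D c d \<and> \<not> D a c \<and> \<not> D a d \<and> \<not> D b c \<and> \<not> D b d)"
    "\<not> (D a c \<and> D b d \<and> \<not> D a b \<and> \<not> D a d \<and> \<not> D b c \<and> \<not> D c d)"
    "\<not> (D a d \<and> D b c \<and> \<not> D a b \<and> \<not> D a c \<and> \<not> D b d \<and> \<not> D c d)"
    using m W d unfolding matching_def D by auto
  show ?thesis
    using le z c4 m'
    by (cases "D a b"; cases "D a c"; cases "D a d"; cases "D b c"; cases "D b d"; cases "D c d"; simp)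
qed

text \<open>The count 20 \<le> e + 14 forces a complete graph. Every proper nonempty part of it has
  an edge leaving it, so \<open>T u\<close> is critical for \<open>L\<close>; the resulting bound on
  the lists gives \<open>tight\<close>, and in a complete graph the sets \<open>B w\<close> form a
  chain.\<close>

lemma no_nonmatching:
  assumes W: "W = {a, b, c, d}" and d: "distinct [a, b, c, d]"
    and m: "\<not> matching a b c d" "\<not> matching a c b d" "\<not> matching a d b c"
  shows False
proof -
  define e :: nat where "e = edges4 E a b c d"
  define h :: nat where "h = edges4 D a b c d"
  define p where "p = pI4 a b c d"
  have hp: "h + p \<le> 7" using backbone_pairs[OF assms] unfolding h_def p_def .
  have ce: "20 \<le> e + 2 * h + 2 * p" using count0[OF W d] unfolding e_def h_def p_def .
  have e6: "e \<le> 6 \<and> (e = 6 \<longrightarrow> E a b \<and> E a c \<and> E a d \<and> E b c \<and> E b d \<and> E c d)"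
    unfolding e_def by (auto simp: of_bool_def)
  have e: "e = 6" and hp7: "h + p = 7" using hp ce e6 by linarith+
  then have E1: "E a b" "E a c" "E a d" "E b c" "E b d" "E c d" using e6 by auto
  then have K4: "E v w" if "v \<in> W" "w \<in> W" "v \<noteq> w" for v w
    using that E_sym unfolding W by auto
  have min: "lcol L M" if M: "M \<subset> W" for M
  proof (rule ccontr)
    assume "\<not> lcol L M"
    then obtain N where N: "N \<subset> W" "N \<noteq> {}"
      "4 * s + (\<Sum>w\<in>N. dE (W - N) w) \<le> (\<Sum>w\<in>W. up W w) + (\<Sum>w\<in>W. dD W w) + 2 * (\<Sum>w\<in>W. dO W w)"
      using not_minimal[OF M] by blast
    have "20 + (\<Sum>w\<in>N. dE (W - N) w) \<le> e + 2 * h + 2 * p" using count[OF W d N(3)] unfolding e_def h_def p_def .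
    then have z: "(\<Sum>w\<in>N. dE (W - N) w) = 0" using e hp7 by linarith
    obtain w v where wv: "w \<in> N" "v \<in> W" "v \<notin> N" using N(1,2) by blast
    then have "E w v" using K4 N(1) by blast
    then have "v \<in> {x \<in> W - N. E w x}" using wv by blast
    then have "dE (W - N) w \<noteq> 0" unfolding dE_def using finW by auto
    moreover have "finite N" using N(1) finW finite_subset by blast
    ultimately show False using z wv(1) by auto
  qed
  have "(\<Sum>w\<in>W. card (L w) + dD W w) \<le> (\<Sum>w\<in>W. dE W w + 2 * dD W w)"
    by (rule density[OF finW finL not_lcol_T min]) auto
  then have L: "(\<Sum>w\<in>W. card (L w)) \<le> 2 * e + 2 * h"
    using sums(2,3)[OF W d] unfolding e_def h_def by (simp add: sum.distrib sum_distrib_left[symmetric])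
  have up: "(\<Sum>w\<in>W. up W w) = e" using sums(4)[OF W d] unfolding e_def .
  have tight
  proof (rule tightI[where p = p])
    show "(\<Sum>w\<in>W. dO W w) \<le> card (\<Union>w\<in>W. out W w) + p" using sums(5)[OF W d] unfolding p_def .
    show "(\<Sum>w\<in>W. card (L w)) + 2 * p \<le> 20 + (\<Sum>w\<in>W. up W w)" using L up e hp7 by linarith
  qed
  then show False
  proof (rule nested)
    fix v w assume vw: "v \<in> W" "w \<in> W"
    show "B v \<subseteq> B w \<or> B w \<subseteq> B v"
    proof (cases "v = w")
      case False
      then have "E v w" "E w v" using K4 vw by auto
      then show ?thesis using B_mono vw f_neq[of v w] by (meson linorder_neqE_nat)
    qed simp
  qed
qed

end

context backbone
begin

lemma lcol_order4:
  assumes d: "distinct [a, b, c, d]" and fin: "\<And>w. finite (A w)" and S: "S = {a, b, c, d}"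
    and 1: "dD S a < card (A a)"
    and 2: "of_bool (E b a) + dD S b < card (A b)"
    and 3: "of_bool (E c a) + of_bool (E c b) + dD S c < card (A c)"
    and 4: "of_bool (E d a) + of_bool (E d b) + of_bool (E d c) + dD S d < card (A d)"
  shows "lcol A S"
proof -
  define r :: "'a \<Rightarrow> nat" where "r v = (if v = a then 0 else if v = b then 1 else if v = c then 2 else 3)" for v
  have r: "r a = 0" "r b = 1" "r c = 2" "r d = 3" using d by (auto simp: r_def)
  have cnt: "card {v \<in> S. E w v \<and> r v < r w} = of_bool (E w a \<and> r a < r w) + of_bool (E w b \<and> r b < r w)
      + of_bool (E w c \<and> r c < r w) + of_bool (E w d \<and> r d < r w)" for w
  proof -
    have "card {v \<in> S. E w v \<and> r v < r w} = (\<Sum>v\<in>S. of_bool (E w v \<and> r v < r w))"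
      unfolding S by (simp add: Int_def)
    then show ?thesis unfolding S using d by simp
  qed
  show ?thesis
  proof (rule lcol_rank[of S r])
    show "inj_on r S" unfolding S inj_on_def using r by auto
    show "card {v \<in> S. E w v \<and> r v < r w} + dD S w < card (A w)" if "w \<in> S" for w
    proof -
      have "w = a \<or> w = b \<or> w = c \<or> w = d" using that S by auto
      then show ?thesis using 1 2 3 4 cnt[of w] by (elim disjE) (simp_all add: r)
    qed
  qed (use fin S in auto)
qed

end

section \<open>The backbone of the subtree is a perfect matching\<close>

context quad
begin

lemma matching_sym:
  assumes "matching a b c d"
  shows "matching b a c d" "matching c d a b" "matching a b d c"
  using assms D_sym unfolding matching_def by auto

text \<open>A fact about graphs on four vertices containing the matching. The first bound
  contradicts the count 4 + t \<le> g with the cut as t, which makes \<open>T u\<close> critical;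
  the second supplies the strictness demanded by \<open>density_tight\<close>.\<close>

lemma matching_cut:
  assumes m: "matching a b c d" and N: "N \<subset> W" "N \<noteq> {}"
  defines "g \<equiv> edges4 E a b c d"
  shows "g \<le> (\<Sum>w\<in>N. dE (W - N) w) + 3" "(\<Sum>w\<in>N. dD (W - N) w) + g \<le> (\<Sum>w\<in>N. dE (W - N) w) + 4"
proof -
  have W: "W = {a, b, c, d}" and d: "distinct [a, b, c, d]" and Dab: "D a b" "D c d"
    and nD: "\<not> D a c" "\<not> D a d" "\<not> D b c" "\<not> D b d" using m by (auto simp: matching_def)
  have E: "E b a = E a b" "E c a = E a c" "E d a = E a d" "E c b = E b c" "E d b = E b d" "E d c = E c d" using E_sym by blast+
  have D: "D b a = D a b" "D c a = D a c" "D d a = D a d" "D c b = D b c" "D d b = D b d" "D d c = D c d" using D_sym by blast+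
  have E1: "E a b" "E c d" using Dab D_imp_E by auto
  have NW: "N \<subseteq> W" using N by blast
  have ex: "\<not> (a \<in> N \<and> b \<in> N \<and> c \<in> N \<and> d \<in> N)" "a \<in> N \<or> b \<in> N \<or> c \<in> N \<or> d \<in> N"
    using N unfolding W by blast+
  note eE = cut_eq(1)[OF finW NW, unfolded sums(1)[OF W d]]
  note eD = cut_eq(2)[OF finW NW, unfolded sums(1)[OF W d]]
  show "g \<le> (\<Sum>w\<in>N. dE (W - N) w) + 3" "(\<Sum>w\<in>N. dD (W - N) w) + g \<le> (\<Sum>w\<in>N. dE (W - N) w) + 4"
    unfolding eE eD g_def using ex E1 Dab nD
    by (cases "a \<in> N"; cases "b \<in> N"; cases "c \<in> N"; cases "d \<in> N"; simp add: E D E_irrefl D_irrefl)+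
qed

lemma matching_sums:
  assumes m: "matching a b c d"
  defines "g \<equiv> edges4 E a b c d"
  shows "(\<Sum>w\<in>W. dD W w) = 4" "(\<Sum>w\<in>W. dE W w) = 2 * g" "(\<Sum>w\<in>W. up W w) = g"
    "(\<Sum>w\<in>W. dO W w) \<le> card (\<Union>w\<in>W. out W w) + 6"
    "4 * s + t \<le> (\<Sum>w\<in>W. up W w) + (\<Sum>w\<in>W. dD W w) + 2 * (\<Sum>w\<in>W. dO W w) \<Longrightarrow> 4 + t \<le> g"
    "w \<in> W \<Longrightarrow> dD W w = 1"
proof -
  have W: "W = {a, b, c, d}" and d: "distinct [a, b, c, d]" and Dab: "D a b" "D c d"
    and nD: "\<not> D a c" "\<not> D a d" "\<not> D b c" "\<not> D b d" using m by (auto simp: matching_def)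
  have ne: "a \<noteq> b" "a \<noteq> c" "a \<noteq> d" "b \<noteq> c" "b \<noteq> d" "c \<noteq> d" using d by auto
  have le: "pI a b \<le> 1" "pI a c \<le> 1" "pI a d \<le> 1" "pI b c \<le> 1" "pI b d \<le> 1" "pI c d \<le> 1"
    using pI_le ne by auto
  show dD: "(\<Sum>w\<in>W. dD W w) = 4" using sums(3)[OF W d] Dab nD by simp
  show "(\<Sum>w\<in>W. dE W w) = 2 * g" "(\<Sum>w\<in>W. up W w) = g" unfolding g_def using sums(2,4)[OF W d] .
  show "(\<Sum>w\<in>W. dO W w) \<le> card (\<Union>w\<in>W. out W w) + 6" using sums(5)[OF W d] le by linarith
  show "4 + t \<le> g" if "4 * s + t \<le> (\<Sum>w\<in>W. up W w) + (\<Sum>w\<in>W. dD W w) + 2 * (\<Sum>w\<in>W. dO W w)"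
    using count[OF W d that] le Dab nD unfolding g_def by simp
  have D: "D b a" "D d c" "\<not> D c a" "\<not> D d a" "\<not> D c b" "\<not> D d b" using Dab nD D_sym by blast+
  show "dD W w = 1" if "w \<in> W" for w
    using that d D Dab nD unfolding W by (auto simp: deg_simps)
qed

lemma matching_minimal:
  assumes m: "matching a b c d" and M: "M \<subset> W"
  shows "lcol L M"
proof (rule ccontr)
  assume "\<not> lcol L M"
  then obtain N where N: "N \<subset> W" "N \<noteq> {}"
    "4 * s + (\<Sum>w\<in>N. dE (W - N) w) \<le> (\<Sum>w\<in>W. up W w) + (\<Sum>w\<in>W. dD W w) + 2 * (\<Sum>w\<in>W. dO W w)"
    using not_minimal[OF M] by blast
  show False using matching_sums(5)[OF m N(3)] matching_cut(1)[OF m N(1,2)] by linarith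
qed

lemma matching_L:
  assumes m: "matching a b c d" and w: "w \<in> W"
  shows "1 \<le> card (L w)" "card (L w) \<le> dE W w + 2"
proof -
  have "{w} \<subset> W" using w card_T by (metis card_1_singleton_iff insert_subset empty_subsetI psubsetI numeral_eq_one_iff semiring_norm(85) One_nat_def)
  then have "lcol L {w}" by (rule matching_minimal[OF m])
  then have "L w \<noteq> {}" by (auto simp: lcol_def ok_def)
  then show "1 \<le> card (L w)" using finL[of w] by (simp add: Suc_le_eq card_gt_0_iff)
  have "(\<Sum>v\<in>{w}. card (L v) + dD {w} v) \<le> (\<Sum>v\<in>{w}. dE W v + 2 * dD W v)"
    by (rule density[OF finW finL not_lcol_T matching_minimal[OF m]]) (use w in auto)
  then show "card (L w) \<le> dE W w + 2" using matching_sums(6)[OF m w] by simp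
qed

lemma no_K4:
  assumes m: "matching a b c d" and "3 \<le> card (L a)" "4 \<le> card (L b)" "4 \<le> card (L c)" "4 \<le> card (L d)"
  shows False
proof -
  have W: "W = {a, b, c, d}" and d: "distinct [a, b, c, d]" and nD: "\<not> D a c" "\<not> D a d" "\<not> D b c" "\<not> D b d"
    using m by (auto simp: matching_def)
  obtain x y z v where "x \<in> L a" "y \<in> L b" "z \<in> L c" "v \<in> L d" "distinct [x, y, z, v]" "far x y" "far z v"
    using two_far_pairs[OF finL finL finL finL assms(2-5)] by blast
  then have "lcol L {a, b, c, d}" using lcol4[OF d, of x L y z v] nD by auto
  then show False using not_lcol_T W by simp
qed

lemma no_diamond:
  assumes m: "matching a b c d" and "\<not> E a c" "3 \<le> card (L a)" "4 \<le> card (L b)" "3 \<le> card (L c)" "4 \<le> card (L d)"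
  shows False
proof -
  have W: "W = {a, b, c, d}" and d: "distinct [a, b, c, d]" and nD: "\<not> D a c" "\<not> D a d" "\<not> D b c" "\<not> D b d"
    using m by (auto simp: matching_def)
  obtain x y z v where x: "x \<in> L a" "y \<in> L b" "z \<in> L d" "v \<in> L c" and ne: "y \<noteq> z" "x \<noteq> z" "v \<noteq> y"
    and fr: "far x y" "far z v"
    using diamond_lists[OF finL finL finL finL assms(3,4,6,5)] by blast
  have n2: "x \<noteq> y" "z \<noteq> v" using fr by (auto simp: far_def)
  have "lcol L {a, b, c, d}"
    by (rule lcol4[OF d x(1,2,4,3)]) (use nD ne n2 fr assms(2) far_sym in auto)
  then show False using not_lcol_T W by simp
qed

text \<open>A larger sum forces g \<ge> 5 by \<open>density\<close>, so at most one edge is missing.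
  By \<open>density_tight\<close> no list exceeds \<open>dE W w + 1\<close>, so the sizes are at
  least 3, 4, 4, 4 in a complete graph and 3, 4, 3, 4 in a diamond, where colourings exist.\<close>

lemma matching_sum_L:
  assumes m: "matching a b c d"
  defines "g \<equiv> edges4 E a b c d"
  shows "(\<Sum>w\<in>W. card (L w)) \<le> 8 + g"
proof (rule ccontr)
  assume n: "\<not> ?thesis"
  have W: "W = {a, b, c, d}" and d: "distinct [a, b, c, d]" and Dab: "D a b" "D c d" using m by (auto simp: matching_def)
  have Eab: "E a b" "E c d" using Dab D_imp_E by auto
  have E: "E b a = E a b" "E c a = E a c" "E d a = E a d" "E c b = E b c" "E d b = E b d" "E d c = E c d" using E_sym by blast+
  have ms: "(\<Sum>w\<in>W. dD W w) = 4" "(\<Sum>w\<in>W. dE W w) = 2 * g" using matching_sums(1,2)[OF m] unfolding g_def by auto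
  have "(\<Sum>w\<in>W. card (L w) + dD W w) \<le> (\<Sum>w\<in>W. dE W w + 2 * dD W w)"
    by (rule density[OF finW finL not_lcol_T matching_minimal[OF m]]) auto
  then have "(\<Sum>w\<in>W. card (L w)) \<le> 2 * g + 4"
    using ms by (simp add: sum.distrib sum_distrib_left[symmetric])
  then have g5: "5 \<le> g" using n by linarith
  have tot: "9 + g \<le> card (L a) + card (L b) + card (L c) + card (L d)" using n sums(1)[OF W d] by simp
  have Lw: "card (L w) \<le> dE W w + 1" if w: "w \<in> W" for w
  proof -
    have "card (L w) \<le> dE W w + dD W w"
    proof (rule density_tight[OF finW finL not_lcol_T matching_minimal[OF m] _ w])
      fix X assume X: "X \<subset> W" "X \<noteq> {}"
      have "(\<Sum>w\<in>W. dE W w + dD W w) = 2 * g + 4" using ms by (simp add: sum.distrib)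
      moreover have "(\<Sum>w\<in>X. dD (W - X) w) + g \<le> (\<Sum>w\<in>X. dE (W - X) w) + 4"
        using matching_cut(2)[OF m X] unfolding g_def .
      ultimately show "(\<Sum>w\<in>W. dE W w + dD W w) + (\<Sum>w\<in>X. dD (W - X) w) < (\<Sum>w\<in>W. card (L w)) + (\<Sum>w\<in>X. dE (W - X) w)"
        using n by linarith
    qed
    then show ?thesis using matching_sums(6)[OF m w] by simp
  qed
  have dE: "dE W x = of_bool (E x a) + of_bool (E x b) + of_bool (E x c) + of_bool (E x d)" for x
    unfolding W using d by (simp add: deg_simps of_bool_def)
  have le: "card (L a) \<le> 2 + of_bool (E a c) + of_bool (E a d)" "card (L b) \<le> 2 + of_bool (E b c) + of_bool (E b d)"
    "card (L c) \<le> 2 + of_bool (E a c) + of_bool (E b c)" "card (L d) \<le> 2 + of_bool (E a d) + of_bool (E b d)"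
    using Lw[of a] Lw[of b] Lw[of c] Lw[of d] Eab W unfolding dE E by (simp_all add: E_irrefl)
  have g: "g = 2 + of_bool (E a c) + of_bool (E a d) + of_bool (E b c) + of_bool (E b d)"
    unfolding g_def using Eab by simp
  consider "E a c" "E a d" "E b c" "E b d" | "\<not> E a c" "E a d" "E b c" "E b d" | "E a c" "\<not> E a d" "E b c" "E b d"
    | "E a c" "E a d" "\<not> E b c" "E b d" | "E a c" "E a d" "E b c" "\<not> E b d"
    using g5 unfolding g by (cases "E a c"; cases "E a d"; cases "E b c"; cases "E b d") auto
  then show False
  proof cases
    case 1
    then have l4: "card (L a) \<le> 4" "card (L b) \<le> 4" "card (L c) \<le> 4" "card (L d) \<le> 4"
      and t: "15 \<le> card (L a) + card (L b) + card (L c) + card (L d)"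
      using le tot g by auto
    then consider "4 \<le> card (L b)" "4 \<le> card (L c)" "4 \<le> card (L d)" | "4 \<le> card (L a)" "4 \<le> card (L c)" "4 \<le> card (L d)"
      | "4 \<le> card (L a)" "4 \<le> card (L b)" "4 \<le> card (L d)" | "4 \<le> card (L a)" "4 \<le> card (L b)" "4 \<le> card (L c)"
      by linarith
    then show False
    proof cases
      case 1 then show False using no_K4[OF m] l4 t by linarith
    next
      case 2 then show False using no_K4[OF matching_sym(1)[OF m]] l4 t by linarith
    next
      case 3 then show False using no_K4[OF matching_sym(2)[OF m]] l4 t by linarith
    next
      case 4 then show False using no_K4[OF matching_sym(1)[OF matching_sym(2)[OF m]]] l4 t by linarith
    qed
  next
    case 2
    then have "3 \<le> card (L a)" "4 \<le> card (L b)" "3 \<le> card (L c)" "4 \<le> card (L d)" using le tot g by auto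
    then show False using no_diamond[OF m] 2 by blast
  next
    case 3
    then have "3 \<le> card (L a)" "4 \<le> card (L b)" "4 \<le> card (L c)" "3 \<le> card (L d)" using le tot g by auto
    then show False using no_diamond[OF matching_sym(3)[OF m]] 3 by blast
  next
    case 4
    then have "4 \<le> card (L a)" "3 \<le> card (L b)" "3 \<le> card (L c)" "4 \<le> card (L d)" using le tot g by auto
    then show False using no_diamond[OF matching_sym(1)[OF m]] 4 by blast
  next
    case 5
    then have "4 \<le> card (L a)" "3 \<le> card (L b)" "4 \<le> card (L c)" "3 \<le> card (L d)" using le tot g by auto
    then show False using no_diamond[OF matching_sym(1)[OF matching_sym(3)[OF m]]] 5 by blast
  qed
qed

lemma matching_tight:
  assumes m: "matching a b c d"
  shows tight
proof (rule tightI[where p = 6])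
  show "(\<Sum>w\<in>W. dO W w) \<le> card (\<Union>w\<in>W. out W w) + 6" by (rule matching_sums(4)[OF m])
  show "(\<Sum>w\<in>W. card (L w)) + 2 * 6 \<le> 20 + (\<Sum>w\<in>W. up W w)"
    using matching_sum_L[OF m] matching_sums(3)[OF m] by linarith
qed

text \<open>Tightness turns the bound into an equality. Together with the parities in
  \<open>exact\<close> it leaves few patterns of list sizes.\<close>

lemma matching_sum_L_eq:
  assumes m: "matching a b c d"
  shows "(\<Sum>w\<in>W. card (L w)) = 8 + (\<Sum>w\<in>W. up W w)"
proof -
  have t: tight by (rule matching_tight[OF m])
  have "(\<Sum>w\<in>W. card (L w) + 2 * dO W w) = (\<Sum>w\<in>W. s + up W w)"
    by (rule sum.cong) (use exact(3)[OF t] in auto)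
  then have "(\<Sum>w\<in>W. card (L w)) + 2 * (\<Sum>w\<in>W. dO W w) = 4 * s + (\<Sum>w\<in>W. up W w)"
    using card_T by (simp add: sum.distrib sum_distrib_left[symmetric])
  then show ?thesis
    using matching_sum_L[OF m] matching_sums(3,4)[OF m] card_UN_out by linarith
qed

end

section \<open>The possible shapes of a matched subtree with top vertex \<open>u\<close>\<close>

context quad
begin

lemma below_u: "w \<in> W \<Longrightarrow> w \<noteq> u \<Longrightarrow> f w < f u"
proof -
  assume w: "w \<in> W" "w \<noteq> u"
  then have "f w \<le> f u" using trancl_le by (simp add: T_def)
  moreover have "f w \<noteq> f u" using inj_onD[OF inj_f, of w u] w W_V u_V by blast
  ultimately show ?thesis by simp
qed

lemma B_sub_Q: "w \<in> W \<Longrightarrow> B w \<subseteq> Q"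
  using blk by (auto simp: block_def K_def)

lemma u_W: "u \<in> W"
  by (simp add: T_def)

lemma B_u: "B u = Q"
  using K_T_disjoint by blast

lemma up4:
  assumes "W = {a, b, c, d}" "distinct [a, b, c, d]"
  shows "up W w = of_bool (E w a \<and> f w < f a) + of_bool (E w b \<and> f w < f b) + of_bool (E w c \<and> f w < f c) + of_bool (E w d \<and> f w < f d)"
  using assms by (simp add: deg_simps of_bool_def)

lemma dE4:
  assumes "W = {a, b, c, d}" "distinct [a, b, c, d]"
  shows "dE W w = of_bool (E w a) + of_bool (E w b) + of_bool (E w c) + of_bool (E w d)"
  using assms by (simp add: deg_simps of_bool_def)

text \<open>\<open>B u = Q\<close> contains everything and \<open>B a \<subseteq> B b\<close> holds
  along the edge ab, so only the comparisons with \<open>c\<close> are missing for a chain.\<close>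

lemma nested_abc:
  assumes m: "matching a b c u" and ab: "f a < f b"
    and "B c \<subseteq> B b \<or> B b \<subseteq> B c" "B c \<subseteq> B a \<or> B a \<subseteq> B c"
  shows False
proof (rule nested[OF matching_tight[OF m]])
  have W: "W = {a, b, c, u}" and E: "E a b" using m D_imp_E by (auto simp: matching_def)
  have aW: "a \<in> W" "b \<in> W" "c \<in> W" using W by auto
  have "B a \<subseteq> B b" by (rule B_mono[OF aW(1,2) E ab])
  moreover have "B a \<subseteq> B u" "B b \<subseteq> B u" "B c \<subseteq> B u" unfolding B_u using B_sub_Q aW by auto
  ultimately show "B v \<subseteq> B w \<or> B w \<subseteq> B v" if "v \<in> W" "w \<in> W" for v w
  proof -
    have "v = a \<or> v = b \<or> v = c \<or> v = u" "w = a \<or> w = b \<or> w = c \<or> w = u" using that W by auto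
    then show ?thesis using \<open>B a \<subseteq> B b\<close> \<open>B a \<subseteq> B u\<close> \<open>B b \<subseteq> B u\<close> \<open>B c \<subseteq> B u\<close> assms(3,4)
      by (elim disjE) (simp_all only:, blast+)
  qed
qed

text \<open>A triangle abu with a pendant edge cu. The lists have 12 colours in all and those of
  \<open>a\<close> and \<open>b\<close> an odd number, so the two pairs have 5 and 7. The pair with
  5 is coloured first; it takes at most two colours from the other pair.\<close>

lemma disjoint_pairs_shape:
  assumes m: "matching a b c u" and ab: "f a < f b" and E: "\<not> E a c" "\<not> E b c" "E a u" "E b u"
  shows False
proof -
  have W: "W = {a, b, c, u}" and d: "distinct [a, b, c, u]" and D: "D a b" "D c u"
    and nD: "\<not> D a c" "\<not> D a u" "\<not> D b c" "\<not> D b u" using m by (auto simp: matching_def)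
  have E': "E a b" "E b a" "E c u" "E u c" "E u a" "E u b" "\<not> E c a" "\<not> E c b" using D E D_imp_E E_sym by blast+
  have D': "D b a" "D u c" "\<not> D c a" "\<not> D u a" "\<not> D c b" "\<not> D u b" using D nD D_sym by blast+
  have mem: "a \<in> W" "b \<in> W" "c \<in> W" "u \<in> W" using W by auto
  have fu: "f a < f u" "f b < f u" "f c < f u" using below_u mem d by auto
  note t = matching_tight[OF m]
  have up: "up W a = 2" "up W b = 1" "up W c = 1" "up W u = 0"
    using E E' ab fu E_irrefl unfolding up4[OF W d] by simp_all
  have cap: "card (L a) \<le> 4" "card (L b) \<le> 4" "card (L c) \<le> 3" "card (L u) \<le> 5"
    using matching_L(2)[OF m mem(1)] matching_L(2)[OF m mem(2)] matching_L(2)[OF m mem(3)] matching_L(2)[OF m mem(4)]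
    unfolding dE4[OF W d] using E E' E_irrefl by simp_all
  note ge = matching_L(1)[OF m mem(1)] matching_L(1)[OF m mem(2)] matching_L(1)[OF m mem(3)] matching_L(1)[OF m mem(4)]
  have sum: "card (L a) + card (L b) + card (L c) + card (L u) = 12"
    using matching_sum_L_eq[OF m] up by (simp add: sums(1)[OF W d])
  have "card (L a) + card (L b) + 2 * dO W a + 2 * dO W b = 2 * s + 3"
    using exact(3)[OF t mem(1)] exact(3)[OF t mem(2)] up by linarith
  moreover have "odd (x + y)" if "x + y + 2 * z + 2 * v = 2 * s + 3" for x y z v :: nat using that by presburger
  ultimately have odd: "odd (card (L a) + card (L b))" by blast
  have "card (L a) + card (L b) = 5 \<or> card (L a) + card (L b) = 7"
  proof -
    have "4 \<le> card (L a) + card (L b)" "card (L a) + card (L b) \<le> 8" using sum cap by linarith+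
    moreover have "n = 5 \<or> n = 7" if "4 \<le> n" "n \<le> 8" "odd n" for n :: nat using that by presburger
    ultimately show ?thesis using odd by blast
  qed
  then show False
  proof
    assume 5: "card (L a) + card (L b) = 5"
    have "lcol L {a, b}" by (rule lcol_pair) (use finL ge 5 in auto)
    then have "lcol L ({a, b} \<union> {c, u})"
      by (rule lcol_two_pairs) (use finL d 5 sum cap E' D' ge in \<open>auto simp: deg_simps\<close>)
    moreover have "{a, b} \<union> {c, u} = W" using W by auto
    ultimately show False using not_lcol_T by simp
  next
    assume 7: "card (L a) + card (L b) = 7"
    have "lcol L {c, u}" by (rule lcol_pair) (use finL ge 7 sum in auto)
    then have "lcol L ({c, u} \<union> {a, b})"
      by (rule lcol_two_pairs) (use finL d 7 sum cap E E' nD ge in \<open>auto simp: deg_simps\<close>)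
    moreover have "{c, u} \<union> {a, b} = W" using W by auto
    ultimately show False using not_lcol_T by simp
  qed
qed

text \<open>Only \<open>B a\<close> and \<open>B c\<close> are incomparable, and each misses just
  one vertex of \<open>B b\<close>. This permits at most one pair of consecutive colours, so
  \<open>card_consec\<close> forces \<open>s = 10\<close>. Parity then leaves six patterns of list
  sizes, and each can be coloured.\<close>

lemma diamond_shape:
  assumes m: "matching a b c u" and ab: "f a < f b" and cb: "f c < f b"
    and E: "\<not> E a c" "E b c" "E a u" "E b u"
  shows False
proof -
  have W: "W = {a, b, c, u}" and d: "distinct [a, b, c, u]" and D: "D a b" "D c u"
    and nD: "\<not> D a c" "\<not> D a u" "\<not> D b c" "\<not> D b u" using m by (auto simp: matching_def)
  have E': "E a b" "E b a" "E c u" "E u c" "E u a" "E u b" "\<not> E c a" "E c b" using D E D_imp_E E_sym by blast+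
  have D': "D b a" "D u c" "\<not> D c a" "\<not> D u a" "\<not> D c b" "\<not> D u b" using D nD D_sym by blast+
  have mem: "a \<in> W" "b \<in> W" "c \<in> W" "u \<in> W" using W by auto
  have fu: "f a < f u" "f b < f u" "f c < f u" using below_u mem d by auto
  note t = matching_tight[OF m]
  have up: "up W a = 2" "up W b = 1" "up W c = 2" "up W u = 0"
    using E E' ab cb fu E_irrefl unfolding up4[OF W d] by simp_all
  have cap: "card (L a) \<le> 4" "card (L b) \<le> 5" "card (L c) \<le> 4" "card (L u) \<le> 5"
    using matching_L(2)[OF m mem(1)] matching_L(2)[OF m mem(2)] matching_L(2)[OF m mem(3)] matching_L(2)[OF m mem(4)]
    unfolding dE4[OF W d] using E E' E_irrefl by simp_all
  note ge = matching_L(1)[OF m mem(1)] matching_L(1)[OF m mem(2)] matching_L(1)[OF m mem(3)] matching_L(1)[OF m mem(4)]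
  have sum: "card (L a) + card (L b) + card (L c) + card (L u) = 13"
    using matching_sum_L_eq[OF m] up by (simp add: sums(1)[OF W d])
  have ex: "card (L a) + 2 * dO W a = s + 2" "card (L b) + 2 * dO W b = s + 1"
    "card (L c) + 2 * dO W c = s + 2" "card (L u) + 2 * dO W u = s"
    using exact(3)[OF t mem(1)] exact(3)[OF t mem(2)] exact(3)[OF t mem(3)] exact(3)[OF t mem(4)] up by linarith+
  have "s = 10"
  proof (rule ccontr)
    assume "s \<noteq> 10"
    then have c2: "2 \<le> card consec" using card_consec[OF t] s_ge by linarith
    have BB: "B a \<subseteq> B b" "B c \<subseteq> B b" using B_mono mem E' ab cb by blast+
    have BQ: "B a \<subseteq> Q" "B b \<subseteq> Q" "B c \<subseteq> Q" using B_sub_Q mem by auto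
    have fB: "finite (B b)" using finK by simp
    have sz: "card (B a) + 1 = card (B b)" "card (B c) + 1 = card (B b)"
      using exact(2)[OF t mem(1)] exact(2)[OF t mem(2)] exact(2)[OF t mem(3)] up by linarith+
    have "card (B b - B a) = 1" "card (B b - B c) = 1"
      using card_Diff_subset[OF finite_subset[OF BB(1) fB] BB(1)] card_Diff_subset[OF finite_subset[OF BB(2) fB] BB(2)] sz
      by linarith+
    then obtain p q where pq: "B b - B a = {p}" "B b - B c = {q}" by (auto simp: card_1_singleton_iff)
    have wit: "\<exists>x. col x = col y + 1 \<and> (y = q \<and> x = p \<or> y = p \<and> x = q)" if y: "y \<in> consec" for y
    proof -
      obtain x v w where x: "x \<in> Q" "col x = col y + 1" "v \<in> W" "w \<in> W" "y \<in> B v" "x \<in> B w" "x \<notin> B v" "y \<notin> B w"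
        by (rule consec_witness[OF t y])
      have "v = a \<or> v = b \<or> v = c \<or> v = u" "w = a \<or> w = b \<or> w = c \<or> w = u" using x(3,4) W by auto
      then have "v = a \<and> w = c \<or> v = c \<and> w = a"
        using x(5-8) BB BQ B_u by (elim disjE) (simp_all only:, blast+)
      then show ?thesis
      proof (elim disjE conjE)
        assume "v = a" "w = c"
        then have "y \<in> B b - B c" "x \<in> B b - B a" using x BB by auto
        then have "y = q" "x = p" unfolding pq by auto
        then show ?thesis using x(2) by blast
      next
        assume "v = c" "w = a"
        then have "y \<in> B b - B a" "x \<in> B b - B c" using x BB by auto
        then have "y = p" "x = q" unfolding pq by auto
        then show ?thesis using x(2) by blast
      qed
    qed
    have "consec \<subseteq> {p} \<or> consec \<subseteq> {q}"
    proof (rule ccontr)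
      assume "\<not> ?thesis"
      then obtain y z where yz: "y \<in> consec" "y \<noteq> p" "z \<in> consec" "z \<noteq> q" by blast
      have "col p = col q + 1" using wit[OF yz(1)] yz(2) by auto
      moreover have "col q = col p + 1" using wit[OF yz(3)] yz(4) by auto
      ultimately show False by simp
    qed
    then have "card consec \<le> 1" using card_mono[of "{p}" consec] card_mono[of "{q}" consec] by auto
    then show False using c2 by simp
  qed
  then have ex10: "card (L a) + 2 * dO W a = 12" "card (L b) + 2 * dO W b = 11"
    "card (L c) + 2 * dO W c = 12" "card (L u) + 2 * dO W u = 10" using ex by simp_all
  have four: "n = 2 \<or> n = 4" if "n + 2 * m = 12" "1 \<le> n" "n \<le> 4" for n m :: nat using that by presburger
  have five: "n = 1 \<or> n = 3 \<or> n = 5" if "n + 2 * m = 11" "n \<le> 5" for n m :: nat using that by presburger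
  have four': "n = 2 \<or> n = 4" if "n + 2 * m = 10" "1 \<le> n" "n \<le> 5" for n m :: nat using that by presburger
  have ac: "card (L a) = 2 \<or> card (L a) = 4" "card (L c) = 2 \<or> card (L c) = 4"
    "card (L u) = 2 \<or> card (L u) = 4" "card (L b) = 1 \<or> card (L b) = 3 \<or> card (L b) = 5"
    using four[OF ex10(1) ge(1) cap(1)] four[OF ex10(3) ge(3) cap(3)] four'[OF ex10(4) ge(4) cap(4)]
      five[OF ex10(2) cap(2)] by blast+
  have dD1: "dD W a = 1" "dD W b = 1" "dD W c = 1" "dD W u = 1" using matching_sums(6)[OF m] mem by auto
  have order: False if "distinct [w1, w2, w3, w4]" "W = {w1, w2, w3, w4}"
      "2 \<le> card (L w1)" "of_bool (E w2 w1) + 2 \<le> card (L w2)" "of_bool (E w3 w1) + of_bool (E w3 w2) + 2 \<le> card (L w3)"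
      "of_bool (E w4 w1) + of_bool (E w4 w2) + of_bool (E w4 w3) + 2 \<le> card (L w4)" for w1 w2 w3 w4
  proof -
    have "w1 \<in> W" "w2 \<in> W" "w3 \<in> W" "w4 \<in> W" using that(2) by auto
    then have "dD W w1 = 1" "dD W w2 = 1" "dD W w3 = 1" "dD W w4 = 1" using matching_sums(6)[OF m] by auto
    then have "lcol L W" by (intro lcol_order4[OF that(1) finL that(2)]) (use that(3-6) in linarith)+
    then show False using not_lcol_T by simp
  qed
  have pairs: "{a, b} \<union> {c, u} = W" "{c, u} \<union> {a, b} = W" using W by auto
  consider "card (L a) + card (L b) = 5" "card (L c) = 4" "card (L u) = 4"
    | "card (L a) = 4" "card (L b) = 5" "card (L c) + card (L u) = 4"
    | "card (L a) = 4" "card (L b) = 3" "card (L c) = 2" "card (L u) = 4"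
    | "card (L a) = 4" "card (L b) = 3" "card (L c) = 4" "card (L u) = 2"
    | "card (L a) = 2" "card (L b) = 5" "card (L c) = 2" "card (L u) = 4"
    | "card (L a) = 2" "card (L b) = 5" "card (L c) = 4" "card (L u) = 2"
    using ac sum by (elim disjE) simp_all
  then show False
  proof cases
    case 1
    have "lcol L {a, b}" by (rule lcol_pair) (use finL ge 1 in auto)
    then have "lcol L ({a, b} \<union> {c, u})"
      by (rule lcol_two_pairs) (use finL d 1 E E' D' in \<open>auto simp: deg_simps\<close>)
    then show False using not_lcol_T pairs by simp
  next
    case 2
    \<comment> \<open>Four colours in all are too few for \<open>lcol_pair\<close>; that
      \<open>T u\<close> is critical colours this pair.\<close>
    have "{c, u} \<subset> W" using W d by auto
    then have "lcol L {c, u}" by (rule matching_minimal[OF m])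
    then have "lcol L ({c, u} \<union> {a, b})"
      by (rule lcol_two_pairs) (use finL d 2 E E' nD in \<open>auto simp: deg_simps\<close>)
    then show False using not_lcol_T pairs by simp
  next
    case 3
    show False by (rule order[of c b u a]) (use d W E E' 3 in auto)
  next
    case 4
    show False by (rule order[of u b a c]) (use d W E E' 4 in auto)
  next
    case 5
    show False by (rule order[of a c u b]) (use d W E E' 5 in auto)
  next
    case 6
    \<comment> \<open>Here \<open>a\<close> and \<open>u\<close> are adjacent with lists of size 2,
      so no ranking satisfies \<open>lcol_rank\<close>.\<close>
    obtain i j l n where il: "i \<in> L a" "j \<in> L b" "l \<in> L u" "n \<in> L c" "far i j" "far n l" "i \<noteq> l" "j \<noteq> l" "j \<noteq> n"
      using leaf_apex_lists[OF finL finL finL finL, of a b u c] 6 by auto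
    have "i \<noteq> j" "n \<noteq> l" using il(5,6) by (auto simp: far_def)
    then have "lcol L {a, b, c, u}"
      by (intro lcol4[OF d il(1,2,4,3)]) (use il(5-9) E(1) nD in auto)
    then show False using not_lcol_T W by simp
  qed
qed

text \<open>Counting yields at least two edges between the pairs ab and cu. Unless one of the two
  shapes above arises, the elimination order makes the sets \<open>B w\<close> a chain.\<close>

lemma no_matching:
  assumes m: "matching a b c u" and ab: "f a < f b"
  shows False
proof -
  have W: "W = {a, b, c, u}" and d: "distinct [a, b, c, u]" and D: "D a b" "D c u"
    using m by (auto simp: matching_def)
  have E: "E a b" "E c u" using D D_imp_E by auto
  have mem: "a \<in> W" "b \<in> W" "c \<in> W" "u \<in> W" using W by auto
  have fu: "f a < f u" "f b < f u" "f c < f u" using below_u mem d by auto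
  have ne: "a \<noteq> b" "a \<noteq> c" "a \<noteq> u" "b \<noteq> c" "b \<noteq> u" "c \<noteq> u" using d by auto
  have sym: "E c a = E a c" "E c b = E b c" using E_sym by blast+
  have "B a \<subseteq> B b" by (rule B_mono[OF mem(1,2) E(1) ab])
  have edges: "2 \<le> of_bool (E a c) + of_bool (E b c) + of_bool (E a u) + (of_bool (E b u) :: nat)"
    using matching_sums(5)[OF m, of 0] block_density[OF blk] card_T E by simp
  show False
  proof (cases "E b c")
    case bc: True
    have c_b: "B c \<subseteq> B b \<or> B b \<subseteq> B c"
      using B_mono[OF mem(2,3) bc] B_mono[OF mem(3,2)] bc sym f_neq[OF bc] by (meson linorder_neqE_nat)
    show False
    proof (cases "E a c \<or> f b < f c")
      case True
      have "B c \<subseteq> B a \<or> B a \<subseteq> B c"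
      proof (cases "E a c")
        case True
        then show ?thesis using B_mono[OF mem(1,3) True] B_mono[OF mem(3,1)] sym f_neq[OF True] by (meson linorder_neqE_nat)
      next
        case False
        then have "B b \<subseteq> B c" using B_mono[OF mem(2,3) bc] \<open>E a c \<or> f b < f c\<close> by blast
        then show ?thesis using \<open>B a \<subseteq> B b\<close> by blast
      qed
      then show False using nested_abc[OF m ab c_b] by blast
    next
      case False
      then have ac: "\<not> E a c" and cb: "f c < f b" using f_neq[OF bc] by auto
      have cEb: "E c b" using bc sym by simp
      have bu: "E b u" using peo[OF cEb cb E(2) fu(3) ne(5)] .
      show False
      proof (cases "E a u")
        case True
        then show False using diamond_shape[OF m ab cb ac bc _ bu] by blast
      next
        case au: False
        have ba: "E b a" using E(1) E_sym by blast
        \<comment> \<open>Both have the same number of higher neighbours outside \<open>W\<close>,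
          so \<open>B a = B b\<close>, and comparing \<open>c\<close> with \<open>b\<close> is
          enough.\<close>
        have "up W a = 1" "up W b = 1"
          using E ac au bc bu ba ab cb fu E_irrefl unfolding up4[OF W d] by simp_all
        then have "card (B a) = card (B b)"
          using exact(2)[OF matching_tight[OF m] mem(1)] exact(2)[OF matching_tight[OF m] mem(2)] by linarith
        moreover have "finite (B b)" using finK by simp
        ultimately have "B a = B b" using card_subset_eq \<open>B a \<subseteq> B b\<close> by metis
        then show False using nested_abc[OF m ab c_b] c_b by blast
      qed
    qed
  next
    case bc: False
    show False
    proof (cases "E a c")
      case True
      have ca: "f c < f a"
      proof (rule ccontr)
        assume "\<not> f c < f a"
        then have "f a < f c" using f_neq[OF True] by simp
        then show False using peo[OF E(1) ab True _ ne(4)] bc by blast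
      qed
      have "B c \<subseteq> B a" using B_mono[OF mem(3,1)] True sym ca by blast
      then show False using nested_abc[OF m ab] \<open>B a \<subseteq> B b\<close> by blast
    next
      case False
      then have "E a u" "E b u" using bc edges by (auto simp: of_bool_def split: if_splits)
      then show False using disjoint_pairs_shape[OF m ab False bc] by blast
    qed
  qed
qed

lemma quad_False: False
proof -
  have no: False if m: "matching a b c u" for a b c
  proof -
    have W: "W = {a, b, c, u}" and E: "E a b" using m D_imp_E by (auto simp: matching_def)
    consider "f a < f b" | "f b < f a" using f_neq[OF E] by linarith
    then show False
      by cases (use no_matching m matching_sym(1)[OF m] in blast)+
  qed
  have no2: "\<not> matching a b c d" for a b c d
  proof
    assume m: "matching a b c d"
    then have "u = a \<or> u = b \<or> u = c \<or> u = d" using u_W by (auto simp: matching_def)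
    then show False
    proof (elim disjE)
      assume "u = d" then show False using no[of a b c] m by simp
    next
      assume "u = c" then show False using no[of a b d] matching_sym(3)[OF m] by simp
    next
      assume "u = b" then show False using no[of c d a] matching_sym(2)[OF m] matching_sym(3)[OF matching_sym(2)[OF m]] by simp
    next
      assume "u = a" then show False using no[of c d b] matching_sym(2)[OF m] matching_sym(3)[OF matching_sym(2)[OF m]] by simp
    qed
  qed
  obtain a b c d where "W = {a, b, c, d}" "distinct [a, b, c, d]"
    using card_T by (auto simp: card_Suc_eq numeral_eq_Suc)
  then show False using no_nonmatching no2 by blast
qed

end

context critical
begin

theorem critical_False: False
proof -
  obtain u where u: "u \<in> V" "card (T u) = 4" by (rule quad_T)
  have ne: "T u \<noteq> {}" using u(2) by auto
  obtain c where "ok (\<lambda>_. {1..k}) (V - T u) c" "\<not> lcol (res (\<lambda>_. {1..k}) c (V - T u)) (T u)"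
    using residual[OF block_T[OF u(1)] ne] by blast
  then interpret quad E D V f k s \<omega> u c using u by unfold_locales
  show False by (rule quad_False)
qed

end

section \<open>Perfect elimination orders of chordal graphs\<close>

text \<open>An induced cycle of length \<open>n + 2 \<ge> 4\<close>, split into \<open>v\<close> and
  an induced path. This suits the argument below, where the path runs through non-neighbours of
  \<open>v\<close>.\<close>

definition hole :: "('a \<Rightarrow> 'a \<Rightarrow> bool) \<Rightarrow> 'a set \<Rightarrow> 'a \<Rightarrow> (nat \<Rightarrow> 'a) \<Rightarrow> nat \<Rightarrow> bool" where
  "hole E S v g n \<longleftrightarrow> 2 \<le> n \<and> v \<in> S \<and> (\<forall>i\<le>n. g i \<in> S \<and> g i \<noteq> v) \<and> inj_on g {..n}
     \<and> E v (g 0) \<and> E v (g n) \<and> (\<forall>i. 0 < i \<and> i < n \<longrightarrow> \<not> E v (g i))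
     \<and> (\<forall>i j. i < j \<and> j \<le> n \<longrightarrow> (E (g i) (g j) \<longleftrightarrow> j = i + 1))"

definition simplicial :: "('a \<Rightarrow> 'a \<Rightarrow> bool) \<Rightarrow> 'a set \<Rightarrow> 'a \<Rightarrow> bool" where
  "simplicial E S w \<longleftrightarrow> w \<in> S \<and> (\<forall>x\<in>S. \<forall>y\<in>S. E w x \<longrightarrow> E w y \<longrightarrow> x \<noteq> y \<longrightarrow> E x y)"

text \<open>A shortest walk through \<open>C\<close> between two nonadjacent vertices is induced.\<close>

lemma induced_path_exists:
  assumes sym: "\<And>u v. E u v \<Longrightarrow> E v u"
    and C: "a \<in> C" "(a, b) \<in> {(p, q). p \<in> C \<and> q \<in> C \<and> E p q}\<^sup>*"
    and ends: "E x a" "E b y" and xy: "x \<noteq> y" "\<not> E x y" "x \<notin> C" "y \<notin> C"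
  shows "\<exists>g n. 2 \<le> n \<and> g 0 = x \<and> g n = y \<and> (\<forall>i. 0 < i \<and> i < n \<longrightarrow> g i \<in> C) \<and> inj_on g {..n :: nat}
    \<and> (\<forall>i j. i < j \<and> j \<le> n \<longrightarrow> (E (g i) (g j) \<longleftrightarrow> j = i + 1))"
proof -
  define walk where "walk g n \<longleftrightarrow> g 0 = x \<and> g n = y \<and> (\<forall>i. 0 < i \<and> i < n \<longrightarrow> g i \<in> C) \<and> (\<forall>i<n. E (g i) (g (i + 1)))"
    for g and n :: nat
  let ?r = "{(p, q). p \<in> C \<and> q \<in> C \<and> E p q}"
  obtain m where "(a, b) \<in> ?r ^^ m" using rtrancl_imp_relpow[OF C(2)] by blast
  then obtain h where h: "h 0 = a" "h m = b" "\<And>i. i < m \<Longrightarrow> (h i, h (Suc i)) \<in> ?r"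
    unfolding relpow_fun_conv by blast
  have hC: "h i \<in> C" if "i \<le> m" for i
  proof (cases i)
    case 0 then show ?thesis using h C by simp
  next
    case (Suc j) then show ?thesis using h(3)[of j] that by auto
  qed
  define g0 where "g0 i = (if i = 0 then x else if i \<le> m + 1 then h (i - 1) else y)" for i
  have "walk g0 (m + 2)"
    unfolding walk_def
  proof (intro conjI allI impI)
    show "g0 0 = x" "g0 (m + 2) = y" by (auto simp: g0_def)
    show "g0 i \<in> C" if "0 < i \<and> i < m + 2" for i using that hC by (auto simp: g0_def)
    show "E (g0 i) (g0 (i + 1))" if im: "i < m + 2" for i
    proof -
      consider "i = 0" | "0 < i" "i \<le> m" | "i = m + 1" using im by linarith
      then show ?thesis
      proof cases
        case 1 then show ?thesis using ends h by (simp add: g0_def)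
      next
        case 2
        then have "(h (i - 1), h (Suc (i - 1))) \<in> ?r" by (intro h(3)) auto
        then show ?thesis using 2 by (simp add: g0_def)
      next
        case 3 then show ?thesis using ends h by (simp add: g0_def)
      qed
    qed
  qed
  then obtain n where n: "\<exists>g. walk g n" and least: "\<And>k. k < n \<Longrightarrow> \<not> (\<exists>g. walk g k)"
    using exists_least_iff[of "\<lambda>n. \<exists>g. walk g n"] by blast
  then obtain g where g: "walk g n" by blast
  then have g0: "g 0 = x" "g n = y" and gC: "\<And>i. 0 < i \<Longrightarrow> i < n \<Longrightarrow> g i \<in> C" and gE: "\<And>i. i < n \<Longrightarrow> E (g i) (g (i + 1))"
    by (auto simp: walk_def)
  have "n \<noteq> 0"
  proof
    assume "n = 0"
    then show False using g0 xy(1) by simp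
  qed
  moreover have "n \<noteq> 1"
  proof
    assume "n = 1"
    then show False using gE[of 0] g0 xy by simp
  qed
  ultimately have n2: "2 \<le> n" by linarith
  have chord: "j = i + 1" if "i < j" "j \<le> n" "E (g i) (g j)" for i j
  proof (rule ccontr)
    assume "j \<noteq> i + 1"
    \<comment> \<open>A chord is a shortcut that skips \<open>l\<close> vertices of the shortest
      walk.\<close>
    define l where "l = j - i - 1"
    have l: "0 < l" "j = i + 1 + l" "l \<le> n" using that \<open>j \<noteq> i + 1\<close> by (auto simp: l_def)
    have "walk (\<lambda>k. if k \<le> i then g k else g (k + l)) (n - l)"
      unfolding walk_def
    proof (intro conjI allI impI)
      show "(if 0 \<le> i then g 0 else g (0 + l)) = x" using g0 by simp
      show "(if n - l \<le> i then g (n - l) else g (n - l + l)) = y" using g0 l that by auto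
      show "(if k \<le> i then g k else g (k + l)) \<in> C" if "0 < k \<and> k < n - l" for k
        using that gC[of k] gC[of "k + l"] by auto
      show "E (if k \<le> i then g k else g (k + l)) (if k + 1 \<le> i then g (k + 1) else g (k + 1 + l))" if "k < n - l" for k
      proof -
        consider "k + 1 \<le> i" | "k = i" | "i < k" by linarith
        then show ?thesis
          using that gE[of k] gE[of "k + l"] \<open>E (g i) (g j)\<close> l by cases (auto simp: algebra_simps)
      qed
    qed
    then show False using least[of "n - l"] l by auto
  qed
  \<comment> \<open>A repeated vertex before the end yields a chord too: \<open>g i = g j\<close> is
    adjacent to \<open>g (j + 1)\<close>.\<close>
  have repeat: False if ij: "i < j" "j \<le> n" "g i = g j" for i j
  proof (cases "j < n")
    case True
    then show False using chord[of i "j + 1"] gE[of j] ij by simp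
  next
    case False
    then have "g i = y" using ij g0 by simp
    then show False using g0 xy gC[of i] ij by (cases "i = 0") auto
  qed
  have "inj_on g {..n}"
  proof (rule inj_onI)
    fix i j assume "i \<in> {..n}" "j \<in> {..n}" "g i = g j"
    then show "i = j" using repeat[of i j] repeat[of j i] by (cases i j rule: linorder_cases) auto
  qed
  moreover have "E (g i) (g j) \<longleftrightarrow> j = i + 1" if "i < j \<and> j \<le> n" for i j
    using chord[of i j] gE[of i] that by auto
  ultimately show ?thesis using n2 g0 gC by blast
qed

text \<open>Dirac's argument. \<open>C\<close> is a component of the non-neighbours of
  \<open>v\<close>, and its boundary \<open>N\<close> consists of neighbours of \<open>v\<close>.
  Two nonadjacent vertices of \<open>N\<close> would give a hole through \<open>C\<close> and
  \<open>v\<close>, so \<open>N\<close> is a clique. Induction on \<open>C \<union> N\<close>, or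
  completeness of that graph, yields a simplicial vertex in \<open>C\<close>; it stays simplicial in
  \<open>S\<close> because all its neighbours lie in \<open>C \<union> N\<close>.\<close>

lemma simplicial_away:
  assumes "finite S" and sym: "\<And>u v. E u v \<Longrightarrow> E v u" and irr: "\<And>u. \<not> E u u"
    and "\<And>v g n. \<not> hole E S v g n"
    and "v \<in> S" and "\<exists>z\<in>S. z \<noteq> v \<and> \<not> E v z"
  shows "\<exists>w. simplicial E S w \<and> w \<noteq> v \<and> \<not> E v w"
  using assms(1,4-6)
proof (induction "card S" arbitrary: S v rule: less_induct)
  case less
  note fin = less.prems(1) and nohole = less.prems(2) and vS = less.prems(3)
  obtain z where z: "z \<in> S" "z \<noteq> v" "\<not> E v z" using less.prems(4) by blast
  define A where "A = {w \<in> S. w \<noteq> v \<and> \<not> E v w}"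
  let ?r = "{(p, q). p \<in> A \<and> q \<in> A \<and> E p q}"
  define C where "C = {x. (z, x) \<in> ?r\<^sup>*}"
  have zA: "z \<in> A" using z by (simp add: A_def)
  have CA: "C \<subseteq> A"
  proof
    fix x assume "x \<in> C"
    then have "(z, x) \<in> ?r\<^sup>*" by (simp add: C_def)
    then show "x \<in> A" by (cases rule: rtranclE) (use zA in auto)
  qed
  have zC: "z \<in> C" by (simp add: C_def)
  have closed: "y \<in> C" if "x \<in> C" "y \<in> A" "E x y" for x y
    using that CA unfolding C_def by (auto intro: rtrancl_into_rtrancl)
  define N where "N = {y \<in> S - C. \<exists>x\<in>C. E x y}"
  have N: "E v y \<and> y \<in> S \<and> y \<notin> C \<and> y \<noteq> v" if yN: "y \<in> N" for y
  proof -
    obtain x where x: "x \<in> C" "E x y" "y \<in> S" "y \<notin> C" using yN by (auto simp: N_def)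
    have "y \<notin> A" using closed x by blast
    moreover have "y \<noteq> v" using x CA sym by (auto simp: A_def)
    ultimately show ?thesis using x by (auto simp: A_def)
  qed
  have reach: "(x, y) \<in> {(p, q). p \<in> C \<and> q \<in> C \<and> E p q}\<^sup>*" if xC: "x \<in> C" and yC: "y \<in> C" for x y
  proof -
    have to_z: "(z, w) \<in> {(p, q). p \<in> C \<and> q \<in> C \<and> E p q}\<^sup>*" if "(z, w) \<in> ?r\<^sup>*" for w
      using that
    proof (induction rule: rtrancl_induct)
      case (step p q)
      then have "p \<in> C" by (simp add: C_def)
      moreover have "q \<in> C" using step(1,2) unfolding C_def by (auto intro: rtrancl_into_rtrancl)
      ultimately show ?case using step by (auto intro: rtrancl_into_rtrancl)
    qed simp
    have sC: "sym {(p, q). p \<in> C \<and> q \<in> C \<and> E p q}" using sym by (auto intro: symI)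
    have "(z, x) \<in> ?r\<^sup>*" "(z, y) \<in> ?r\<^sup>*" using xC yC by (simp_all add: C_def)
    then show ?thesis
      using symD[OF sym_rtrancl[OF sC] to_z[of x]] to_z[of y] by (rule_tac rtrancl_trans)
  qed
  have clique: "E x y" if x: "x \<in> N" and y: "y \<in> N" and xy: "x \<noteq> y" for x y
  proof (rule ccontr)
    assume nE: "\<not> E x y"
    obtain a where a: "a \<in> C" "E a x" using x by (auto simp: N_def)
    obtain b where b: "b \<in> C" "E b y" using y by (auto simp: N_def)
    have nC: "x \<notin> C" "y \<notin> C" using N x y by blast+
    have "\<exists>g n. 2 \<le> n \<and> g 0 = x \<and> g n = y \<and> (\<forall>i. 0 < i \<and> i < n \<longrightarrow> g i \<in> C) \<and> inj_on g {..n :: nat}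
        \<and> (\<forall>i j. i < j \<and> j \<le> n \<longrightarrow> (E (g i) (g j) \<longleftrightarrow> j = i + 1))"
      by (rule induced_path_exists[OF _ a(1) reach[OF a(1) b(1)] sym[OF a(2)] b(2) xy nE nC]) (rule sym)
    then obtain g :: "nat \<Rightarrow> 'a" and n :: nat where g: "2 \<le> n" "g 0 = x" "g n = y" "\<forall>i. 0 < i \<and> i < n \<longrightarrow> g i \<in> C" "inj_on g {..n}"
      "\<forall>i j. i < j \<and> j \<le> n \<longrightarrow> (E (g i) (g j) \<longleftrightarrow> j = i + 1)"
      by blast
    have gi: "g i \<in> S \<and> g i \<noteq> v" if i: "i \<le> n" for i
    proof -
      consider "i = 0" | "i = n" | "0 < i" "i < n" using i by linarith
      then show ?thesis by cases (use g N x y CA in \<open>auto simp: A_def\<close>)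
    qed
    have "\<not> E v (g i)" if "0 < i \<and> i < n" for i using g(4) that CA by (auto simp: A_def)
    then have "hole E S v g n" unfolding hole_def using g gi N x y vS by auto
    then show False using nohole by blast
  qed
  let ?S = "C \<union> N"
  have SS: "?S \<subseteq> S" using CA N by (auto simp: A_def)
  have vn: "v \<notin> ?S" using CA N by (auto simp: A_def)
  have smaller: "card ?S < card S" by (rule psubset_card_mono[OF fin]) (use SS vn vS in blast)
  have fS: "finite ?S" using SS fin finite_subset by blast
  have noh: "\<not> hole E ?S x g n" for x g n
  proof
    assume "hole E ?S x g n"
    then have "hole E S x g n" using SS unfolding hole_def by blast
    then show False using nohole by blast
  qed
  note IH = less.hyps[OF smaller fS noh]
  have lift: "\<exists>w. simplicial E S w \<and> w \<noteq> v \<and> \<not> E v w" if w: "simplicial E ?S w" "w \<in> C" for w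
  proof -
    have nb: "x \<in> ?S" if "x \<in> S" "E w x" for x
      using that w(2) by (cases "x \<in> C") (auto simp: N_def)
    have "simplicial E S w" using w nb SS unfolding simplicial_def by blast
    moreover have "w \<noteq> v \<and> \<not> E v w" using w(2) CA by (auto simp: A_def)
    ultimately show ?thesis by blast
  qed
  show ?case
  proof (cases "\<exists>x\<in>N. \<exists>t\<in>?S. t \<noteq> x \<and> \<not> E x t")
    case True
    then obtain x where x: "x \<in> N" "\<exists>t\<in>?S. t \<noteq> x \<and> \<not> E x t" by blast
    then obtain w where w: "simplicial E ?S w" "w \<noteq> x" "\<not> E x w" using IH[of x] by blast
    then have "w \<in> C" using clique[OF x(1)] by (auto simp: simplicial_def)
    then show ?thesis using lift w by blast
  next
    case False
    then have univ': "E p t" if "p \<in> N" "t \<in> ?S" "t \<noteq> p" for p t using that by blast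
    show ?thesis
    proof (cases "\<exists>x\<in>C. \<exists>t\<in>?S. t \<noteq> x \<and> \<not> E x t")
      case True
      then obtain x where x: "x \<in> C" "\<exists>t\<in>?S. t \<noteq> x \<and> \<not> E x t" by blast
      then obtain w where w: "simplicial E ?S w" "w \<noteq> x" "\<not> E x w" using IH[of x] by blast
      have "w \<notin> N"
      proof
        assume "w \<in> N"
        then have "E w x" by (rule univ') (use x(1) w(2) in simp_all)
        from sym[OF this] show False using w(3) by simp
      qed
      then have "w \<in> C" using w by (auto simp: simplicial_def)
      then show ?thesis using lift w by blast
    next
      case False
      then have univC: "E p t" if "p \<in> C" "t \<in> ?S" "t \<noteq> p" for p t using that by blast
      have "E p t" if "p \<in> ?S" "t \<in> ?S" "p \<noteq> t" for p t
        using that univ'[of p t] univC[of p t] by auto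
      then have "simplicial E ?S z" using zC unfolding simplicial_def by simp
      then show ?thesis using lift zC by blast
    qed
  qed
qed

lemma perfect_elimination:
  assumes "finite S" and sym: "\<And>u v. E u v \<Longrightarrow> E v u" and irr: "\<And>u. \<not> E u u"
    and "\<And>v g n. \<not> hole E S v g n"
  shows "\<exists>f :: 'a \<Rightarrow> nat. inj_on f S \<and> (\<forall>v\<in>S. \<forall>x\<in>S. \<forall>y\<in>S. E v x \<longrightarrow> f v < f x \<longrightarrow> E v y \<longrightarrow> f v < f y \<longrightarrow> x \<noteq> y \<longrightarrow> E x y)"
  using assms(1,4)
proof (induction "card S" arbitrary: S)
  case 0
  then show ?case by simp
next
  case (Suc n)
  then obtain v where v: "v \<in> S" by (metis card.empty equals0I nat.distinct(1))
  obtain w where w: "simplicial E S w"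
  proof (cases "\<exists>x\<in>S. \<exists>z\<in>S. z \<noteq> x \<and> \<not> E x z")
    case True
    then obtain x where "x \<in> S" "\<exists>z\<in>S. z \<noteq> x \<and> \<not> E x z" by blast
    then show ?thesis using simplicial_away[OF Suc.prems(1) sym irr Suc.prems(2)] that by blast
  next
    case False
    then have univ: "E p t" if "p \<in> S" "t \<in> S" "t \<noteq> p" for p t using that by blast
    then have "simplicial E S v" using v unfolding simplicial_def by simp
    then show ?thesis by (rule that)
  qed
  then have wS: "w \<in> S" by (simp add: simplicial_def)
  have "\<not> hole E (S - {w}) x g m" for x g m
    using Suc.prems(2)[of x g m] unfolding hole_def by blast
  moreover have "n = card (S - {w})" using Suc.hyps(2) Suc.prems(1) wS by simp
  ultimately obtain f :: "'a \<Rightarrow> nat" where f: "inj_on f (S - {w})"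
    "\<forall>v\<in>S - {w}. \<forall>x\<in>S - {w}. \<forall>y\<in>S - {w}. E v x \<longrightarrow> f v < f x \<longrightarrow> E v y \<longrightarrow> f v < f y \<longrightarrow> x \<noteq> y \<longrightarrow> E x y"
    using Suc.hyps(1)[of "S - {w}"] Suc.prems(1) by blast
  define h where "h x = (if x = w then 0 else f x + 1)" for x
  have "inj_on h S" using f(1) by (auto simp: inj_on_def h_def)
  moreover have "E x y" if "v \<in> S" "x \<in> S" "y \<in> S" "E v x" "h v < h x" "E v y" "h v < h y" "x \<noteq> y" for v x y
  proof (cases "v = w")
    case True
    then show ?thesis using w that unfolding simplicial_def by blast
  next
    case False
    then have "x \<noteq> w" "y \<noteq> w" using that by (auto simp: h_def)
    then have m: "v \<in> S - {w}" "x \<in> S - {w}" "y \<in> S - {w}" "f v < f x" "f v < f y"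
      using that(1-3,5,7) False by (simp_all add: h_def)
    show ?thesis by (rule f(2)[rule_format, OF m(1-3) that(4) m(4) that(6) m(5) that(8)])
  qed
  ultimately show ?case by blast
qed

lemma walk_of_list:
  fixes G :: "'a pair_pre_digraph"
  assumes "xs \<noteq> []"
  shows "pre_digraph.cas (with_proj G) (hd xs) (zip xs (tl xs)) (last xs)"
    "pre_digraph.awalk_verts (with_proj G) (hd xs) (zip xs (tl xs)) = xs"
proof -
  have "pre_digraph.cas (with_proj G) (hd xs) (zip xs (tl xs)) (last xs)
    \<and> pre_digraph.awalk_verts (with_proj G) (hd xs) (zip xs (tl xs)) = xs"
    using assms
  proof (induction xs)
    case (Cons x xs)
    then show ?case
      by (cases xs) (auto simp: pre_digraph.cas.simps pre_digraph.awalk_verts.simps)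
  qed simp
  then show "pre_digraph.cas (with_proj G) (hd xs) (zip xs (tl xs)) (last xs)"
    "pre_digraph.awalk_verts (with_proj G) (hd xs) (zip xs (tl xs)) = xs" by auto
qed

text \<open>The path closed up at \<open>v\<close> becomes an arc walk of length
  \<open>n + 2\<close>. Every arc between its vertices belongs to the cycle or reverses one of its
  arcs, since a hole has no chords.\<close>

lemma chordal_no_hole:
  assumes G: "pair_graph G" and ch: "chordal G"
  shows "\<not> hole (\<lambda>u v. (u, v) \<in> parcs G) (pverts G) v g n"
proof
  let ?E = "\<lambda>u v. (u, v) \<in> parcs G"
  assume h: "hole ?E (pverts G) v g n"
  interpret pair_graph G by (fact G)
  have n: "2 \<le> n" and vV: "v \<in> pverts G" and gv: "\<And>i. i \<le> n \<Longrightarrow> g i \<noteq> v" and inj: "inj_on g {..n}"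
    and ends: "?E v (g 0)" "?E v (g n)" and inner: "\<And>i. 0 < i \<Longrightarrow> i < n \<Longrightarrow> \<not> ?E v (g i)"
    and path: "\<And>i j. i < j \<Longrightarrow> j \<le> n \<Longrightarrow> ?E (g i) (g j) \<longleftrightarrow> j = i + 1"
    using h unfolding hole_def by blast+
  have sym: "?E x y \<Longrightarrow> ?E y x" for x y by (rule arcs_symmetric)
  define xs where "xs = v # map g [0..<n + 1] @ [v]"
  define p where "p = zip xs (tl xs)"
  have len: "length xs = n + 3" by (simp add: xs_def)
  have lenp: "length p = n + 2" by (simp add: p_def len)
  have nth: "xs ! i = (if i = 0 \<or> i = n + 2 then v else g (i - 1))" if "i < n + 3" for i
    using that by (auto simp: xs_def nth_Cons' nth_append simp del: upt_Suc)
  have setp: "set p = {(v, g 0), (g n, v)} \<union> (\<lambda>i. (g i, g (i + 1))) ` {..<n}" (is "_ = ?P")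
  proof -
    have "set p = (\<lambda>i. (xs ! i, xs ! (i + 1))) ` {..<n + 2}"
      by (auto simp: p_def set_zip len nth_tl)
    also have "{..<n + 2} = insert 0 (insert (n + 1) (Suc ` {..<n}))"
    proof (intro equalityI subsetI)
      fix i assume "i \<in> {..<n + 2}"
      then show "i \<in> insert 0 (insert (n + 1) (Suc ` {..<n}))" by (cases i) auto
    qed auto
    also have "(\<lambda>i. (xs ! i, xs ! (i + 1))) ` \<dots> = ?P"
    proof -
      have e: "xs ! 0 = v" "xs ! 1 = g 0" "xs ! (n + 1) = g n" "xs ! (n + 2) = v" using nth n by auto
      have "(\<lambda>i. (xs ! i, xs ! (i + 1))) ` Suc ` {..<n} = (\<lambda>i. (g i, g (i + 1))) ` {..<n}"
        unfolding image_image by (rule image_cong) (use nth in auto)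
      then show ?thesis using e by auto
    qed
    finally show ?thesis .
  qed
  have fst_p: "fst ` set p = insert v (g ` {..n})"
  proof -
    have "insert n {..<n} = {..n}" by auto
    then have "g ` {..n} = insert (g n) (g ` {..<n})" by (metis image_insert)
    then show ?thesis unfolding setp by (auto simp: image_image)
  qed
  have arcs_p: "set p \<subseteq> parcs G"
    unfolding setp using ends sym path by auto
  have "pre_digraph.cycle (with_proj G) p"
    unfolding cycle_def
  proof (intro exI conjI)
    have ne: "xs \<noteq> []" and hd: "hd xs = v" and la: "last xs = v" by (auto simp: xs_def)
    have w: "cas v p v" "awalk_verts v p = xs"
      using walk_of_list[OF ne] unfolding p_def hd la by simp_all
    show "awalk v p v" unfolding awalk_def using vV arcs_p w by simp
    have set_upt: "set [0..<n + 1] = {..n}" by auto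
    then have "distinct (map g [0..<n + 1])" using inj unfolding distinct_map by (simp del: upt_Suc)
    moreover have "v \<notin> set (map g [0..<n + 1])" unfolding set_map set_upt using gv by (metis atMost_iff imageE)
    ultimately show "distinct (tl (awalk_verts v p))" unfolding w xs_def by (simp del: upt_Suc)
    show "p \<noteq> []" using lenp by auto
  qed
  moreover have "arcs (with_proj G \<restriction> (fst ` set p)) = set p \<union> (set p)\<inverse>"
  proof (intro equalityI subsetI)
    fix e assume "e \<in> arcs (with_proj G \<restriction> (fst ` set p))"
    then obtain x y where e: "e = (x, y)" "?E x y" "x \<in> insert v (g ` {..n})" "y \<in> insert v (g ` {..n})"
      unfolding fst_p by (cases e) auto
    have vg: "(v, g i) \<in> set p \<union> (set p)\<inverse> \<and> (g i, v) \<in> set p \<union> (set p)\<inverse>" if "i \<le> n" "?E v (g i)" for i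
    proof -
      have "i = 0 \<or> i = n" using inner[of i] that by linarith
      then show ?thesis unfolding setp by auto
    qed
    have gg: "(g i, g j) \<in> set p" if "i < j" "j \<le> n" "?E (g i) (g j)" for i j
      using path[OF that(1,2)] that unfolding setp by auto
    show "e \<in> set p \<union> (set p)\<inverse>"
    proof (cases "x = v")
      case True
      then have "y \<noteq> v" using e(2) no_loops' by blast
      then obtain i where "i \<le> n" "y = g i" using e(4) by auto
      then show ?thesis using vg e True by auto
    next
      case False
      then obtain i where i: "i \<le> n" "x = g i" using e(3) by auto
      show ?thesis
      proof (cases "y = v")
        case True
        then show ?thesis using vg[of i] e i sym by auto
      next
        case False
        then obtain j where j: "j \<le> n" "y = g j" using e(4) by auto
        have "i \<noteq> j" using e(2) i j no_loops' by blast
        then consider "i < j" | "j < i" by linarith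
        then show ?thesis
        proof cases
          case 1 then show ?thesis using gg[of i j] e i j by auto
        next
          case 2 then show ?thesis using gg[of j i] e i j sym by auto
        qed
      qed
    qed
  next
    fix e assume e: "e \<in> set p \<union> (set p)\<inverse>"
    have ss: "snd ` set p \<subseteq> fst ` set p" unfolding fst_p unfolding setp by auto
    have "e \<in> parcs G" using e arcs_p sym by auto
    moreover have "fst e \<in> fst ` set p" "snd e \<in> fst ` set p" using e ss by force+
    ultimately show "e \<in> arcs (with_proj G \<restriction> (fst ` set p))" by simp
  qed
  ultimately have "induced_cycle G p" by (simp add: induced_cycle_def)
  then show False using ch lenp n unfolding chordal_def by auto
qed

section \<open>The bound\<close>

lemma C4_free_common_neighbours:
  assumes H: "pair_graph H" and C: "C4_free H"
    and "(u, x) \<in> parcs H" "(x, v) \<in> parcs H" "(v, y) \<in> parcs H" "(y, u) \<in> parcs H"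
    and "u \<noteq> v"
  shows "x = y"
proof (rule ccontr)
  assume "x \<noteq> y"
  interpret pair_graph H by (fact H)
  let ?p = "[(u, x), (x, v), (v, y), (y, u)]"
  have "u \<noteq> x" "x \<noteq> v" "v \<noteq> y" "y \<noteq> u"
    using assms(3-6) no_loops' by blast+
  moreover have "u \<in> pverts H" using assms(3) in_arcsD1 by blast
  ultimately have "pre_digraph.cycle (with_proj H) ?p"
    using assms(3-7) \<open>x \<noteq> y\<close>
    by (auto simp: cycle_def awalk_def intro!: exI[of _ u])
  then show False using C by (auto simp: C4_free_def intro!: exI[of _ ?p])
qed

definition elimination_order :: "'a pair_pre_digraph \<Rightarrow> ('a \<Rightarrow> nat) \<Rightarrow> bool" where
  "elimination_order G f \<longleftrightarrow> inj_on f (pverts G) \<and> (\<forall>v x y. (v, x) \<in> parcs G \<longrightarrow> f v < f x \<longrightarrow>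
     (v, y) \<in> parcs G \<longrightarrow> f v < f y \<longrightarrow> x \<noteq> y \<longrightarrow> (x, y) \<in> parcs G)"

lemma card_clique_le: "finite (pverts G) \<Longrightarrow> is_clique G K \<Longrightarrow> card K \<le> clique_number G"
proof -
  assume fin: "finite (pverts G)" and K: "is_clique G K"
  have "{K. is_clique G K} \<subseteq> Pow (pverts G)" by (auto simp: is_clique_def)
  then have "finite {K. is_clique G K}" using fin finite_subset by blast
  then show ?thesis unfolding clique_number_def using K by (intro Max_ge) auto
qed

context
  fixes G H :: "'a pair_pre_digraph"
  assumes G: "pair_graph G" and ch: "chordal G"
    and H: "pair_graph H" and span: "spanning (with_proj H) (with_proj G)" and C4: "C4_free H"
begin

interpretation G: pair_graph G by (rule G)

interpretation H: pair_graph H by (rule H)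

lemma H_sub_G: "(u, v) \<in> parcs H \<Longrightarrow> (u, v) \<in> parcs G"
  using span by (auto simp: spanning_def subgraph_def)

lemma elimination_order_exists: "\<exists>f. elimination_order G f"
proof -
  have "\<exists>f :: 'a \<Rightarrow> nat. inj_on f (pverts G) \<and> (\<forall>v\<in>pverts G. \<forall>x\<in>pverts G. \<forall>y\<in>pverts G.
      (v, x) \<in> parcs G \<longrightarrow> f v < f x \<longrightarrow> (v, y) \<in> parcs G \<longrightarrow> f v < f y \<longrightarrow> x \<noteq> y \<longrightarrow> (x, y) \<in> parcs G)"
    by (rule perfect_elimination)
      (use G.pair_finite_verts G.arcs_symmetric G.no_loops' chordal_no_hole[OF G ch] in blast)+
  then obtain f :: "'a \<Rightarrow> nat" where f: "inj_on f (pverts G)" "\<forall>v\<in>pverts G. \<forall>x\<in>pverts G. \<forall>y\<in>pverts G.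
      (v, x) \<in> parcs G \<longrightarrow> f v < f x \<longrightarrow> (v, y) \<in> parcs G \<longrightarrow> f v < f y \<longrightarrow> x \<noteq> y \<longrightarrow> (x, y) \<in> parcs G"
    by blast
  have "(x, y) \<in> parcs G"
    if h: "(v, x) \<in> parcs G" "f v < f x" "(v, y) \<in> parcs G" "f v < f y" "x \<noteq> y" for v x y
  proof -
    have "v \<in> pverts G" "x \<in> pverts G" "y \<in> pverts G" using h G.in_arcsD1 G.in_arcsD2 by blast+
    then show ?thesis using f(2)[rule_format, OF _ _ _ h] by simp
  qed
  then have "elimination_order G f" using f(1) unfolding elimination_order_def by blast
  then show ?thesis by blast
qed

lemma card_higher_less:
  assumes f: "elimination_order G f"
    and v: "v \<in> pverts G"
  shows "card {x. (v, x) \<in> parcs G \<and> f v < f x} < clique_number G"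
proof -
  let ?K = "{x. (v, x) \<in> parcs G \<and> f v < f x}"
  have sub: "?K \<subseteq> pverts G" using G.in_arcsD2 by blast
  then have fin: "finite ?K" using G.pair_finite_verts finite_subset by blast
  have "is_clique G (insert v ?K)"
    unfolding is_clique_def pairwise_def using sub v f G.arcs_symmetric
    unfolding elimination_order_def by blast
  then have "card (insert v ?K) \<le> clique_number G" by (rule card_clique_le[OF G.pair_finite_verts])
  moreover have "card (insert v ?K) = card ?K + 1" using fin by simp
  ultimately show ?thesis by linarith
qed

text \<open>Greedy colouring from the top of the elimination order, as the case of
  \<open>lcol_rank\<close> with empty backbone. The rank reverses \<open>f\<close>, so earlier
  neighbours are the higher ones, fewer than the clique number.\<close>

lemma proper_colouring:
  "\<exists>c. (\<forall>v\<in>pverts G. c v \<in> {1..clique_number G}) \<and> (\<forall>u v. (u, v) \<in> parcs G \<longrightarrow> c u \<noteq> c v)"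
proof -
  obtain f where f: "elimination_order G f" using elimination_order_exists by blast
  then have inj: "inj_on f (pverts G)" by (simp add: elimination_order_def)
  interpret b: backbone "\<lambda>u v. (u, v) \<in> parcs G" "\<lambda>_ _. False"
    by unfold_locales (use G.arcs_symmetric G.no_loops' in auto)
  define M where "M = Max (f ` pverts G)"
  have fM: "f v \<le> M" if "v \<in> pverts G" for v unfolding M_def using that G.pair_finite_verts by simp
  have "b.lcol (\<lambda>_. {1..clique_number G}) (pverts G)"
  proof (rule b.lcol_rank[where r = "\<lambda>v. M - f v"])
    show "inj_on (\<lambda>v. M - f v) (pverts G)"
    proof (rule inj_onI)
      fix x y assume "x \<in> pverts G" "y \<in> pverts G" "M - f x = M - f y"
      then show "x = y" using inj_onD[OF inj, of x y] fM[of x] fM[of y] by simp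
    qed
    fix w assume w: "w \<in> pverts G"
    have "card {v \<in> pverts G. (w, v) \<in> parcs G \<and> M - f v < M - f w} \<le> card {x. (w, x) \<in> parcs G \<and> f w < f x}"
    proof (rule card_mono)
      show "finite {x. (w, x) \<in> parcs G \<and> f w < f x}"
        by (rule finite_subset[OF _ G.pair_finite_verts]) (use G.in_arcsD2 in blast)
    qed auto
    then show "card {v \<in> pverts G. (w, v) \<in> parcs G \<and> M - f v < M - f w} + b.dD (pverts G) w < card {1..clique_number G}"
      using card_higher_less[OF f w] by (simp add: b.dD_def)
  qed (use G.pair_finite_verts in auto)
  then obtain c where c: "b.ok (\<lambda>_. {1..clique_number G}) (pverts G) c" by (auto simp: b.lcol_def)
  have "c u \<noteq> c v" if "(u, v) \<in> parcs G" for u v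
    using c that G.in_arcsD1[OF that] G.in_arcsD2[OF that] unfolding b.ok_def by blast
  moreover have "\<forall>v\<in>pverts G. c v \<in> {1..clique_number G}" using c by (simp add: b.ok_def)
  ultimately show ?thesis by blast
qed

lemma BBC_le: "backbone_colouring 2 k G H c \<Longrightarrow> 0 < k \<Longrightarrow> BBC 2 G H \<le> k"
  unfolding BBC_def by (rule Least_le) blast

text \<open>Odd colours are pairwise far. The \<open>max 1\<close> serves the graph without
  vertices, because \<open>BBC\<close> asks for a positive number of colours.\<close>

lemma spaced_bound: "BBC 2 G H \<le> max 1 (2 * clique_number G - 1)"
proof -
  obtain c where c: "\<forall>v\<in>pverts G. c v \<in> {1..clique_number G}" "\<forall>u v. (u, v) \<in> parcs G \<longrightarrow> c u \<noteq> c v"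
    using proper_colouring by blast
  have "backbone_colouring 2 (max 1 (2 * clique_number G - 1)) G H (\<lambda>v. 2 * c v - 1)"
    unfolding backbone_colouring_def
  proof (intro conjI ballI)
    show "2 * c v - 1 \<in> {1..max 1 (2 * clique_number G - 1)}" if "v \<in> pverts G" for v
      using c(1)[rule_format, OF that] by auto
    have two: "2 * c u - 1 \<noteq> 2 * c v - 1 \<and> int 2 \<le> \<bar>int (2 * c u - 1) - int (2 * c v - 1)\<bar>" if "(u, v) \<in> parcs G" for u v
      using c(1)[rule_format, OF G.in_arcsD1[OF that]] c(1)[rule_format, OF G.in_arcsD2[OF that]] c(2)[rule_format, OF that] by auto
    show "case e of (u, v) \<Rightarrow> 2 * c u - 1 \<noteq> 2 * c v - 1" if "e \<in> parcs G" for e using that two by auto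
    show "case e of (u, v) \<Rightarrow> int 2 \<le> \<bar>int (2 * c u - 1) - int (2 * c v - 1)\<bar>" if "e \<in> parcs H" for e
      using that two H_sub_G by auto
  qed
  then show ?thesis by (rule BBC_le) simp
qed

lemma backbone_bound:
  assumes k: "k + 1 = s + clique_number G" and s: "clique_number G + 9 \<le> 2 * s" "10 \<le> s"
  shows "BBC 2 G H \<le> k"
proof -
  obtain f where f: "elimination_order G f" using elimination_order_exists by blast
  then have inj: "inj_on f (pverts G)" by (simp add: elimination_order_def)
  interpret b: backbone "\<lambda>u v. (u, v) \<in> parcs G" "\<lambda>u v. (u, v) \<in> parcs H"
    by unfold_locales (use G.arcs_symmetric G.no_loops' H.arcs_symmetric H_sub_G in auto)
  have "b.lcol (\<lambda>_. {1..k}) (pverts G)"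
  proof (rule ccontr)
    assume "\<not> ?thesis"
    then obtain V where V: "V \<subseteq> pverts G" "\<not> b.lcol (\<lambda>_. {1..k}) V" "\<And>S. S \<subset> V \<Longrightarrow> b.lcol (\<lambda>_. {1..k}) S"
      using b.minimal_not_lcol[OF G.pair_finite_verts] by blast
    \<comment> \<open>Both relations are cut down to the minimal uncolourable set, so that
      neighbourhoods are taken inside it.\<close>
    let ?E = "\<lambda>u v. u \<in> V \<and> v \<in> V \<and> (u, v) \<in> parcs G"
    let ?D = "\<lambda>u v. u \<in> V \<and> v \<in> V \<and> (u, v) \<in> parcs H"
    interpret r: backbone ?E ?D
    proof
      show "?E v u" if "?E u v" for u v using that b.E_sym[of u v] by simp
      show "\<not> ?E u u" for u using b.E_irrefl[of u] by simp
      show "?D v u" if "?D u v" for u v using that b.D_sym[of u v] by simp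
      show "?E u v" if "?D u v" for u v using that b.D_imp_E[of u v] by simp
    qed
    have same_ok: "r.ok A S c \<longleftrightarrow> b.ok A S c" if SV: "S \<subseteq> V" for A S c
    proof -
      have "x \<in> V" if "x \<in> S" for x using that SV by blast
      then show ?thesis unfolding r.ok_def b.ok_def by (simp cong: ball_cong)
    qed
    have same: "r.lcol A S \<longleftrightarrow> b.lcol A S" if "S \<subseteq> V" for A S
      unfolding r.lcol_def b.lcol_def same_ok[OF that] by (rule refl)
    have neV: "V \<noteq> {}" using V(2) b.lcol_empty by auto
    interpret critical ?E ?D V f k s "clique_number G"
    proof unfold_locales
      show "finite V" using V(1) G.pair_finite_verts finite_subset by blast
      show "inj_on f V" using inj V(1) by (rule inj_on_subset)
      show "?E x y" if "?E v x" "f v < f x" "?E v y" "f v < f y" "x \<noteq> y" for v x y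
        using that f unfolding elimination_order_def by blast
      show "card {x. ?E v x \<and> f v < f x} < clique_number G" for v
      proof (cases "v \<in> V")
        case True
        then have v: "v \<in> pverts G" using V(1) by blast
        have "finite {x. (v, x) \<in> parcs G \<and> f v < f x}"
          by (rule finite_subset[OF _ G.pair_finite_verts]) (use G.in_arcsD2 in blast)
        then have "card {x. ?E v x \<and> f v < f x} \<le> card {x. (v, x) \<in> parcs G \<and> f v < f x}"
          by (rule card_mono) auto
        then show ?thesis using card_higher_less[OF f v] by simp
      next
        case False
        obtain w where "w \<in> pverts G" using neV V(1) by blast
        then have "0 < clique_number G" using card_higher_less[OF f, of w] by simp
        then show ?thesis using False by simp
      qed
      show "x = y" if "?D u x" "?D x v" "?D u y" "?D y v" "u \<noteq> v" for u v x y
        using C4_free_common_neighbours[OF H C4, of u x v y] that H.arcs_symmetric by blast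
      show "\<not> r.lcol (\<lambda>_. {1..k}) V" using V(2) same by blast
      show "r.lcol (\<lambda>_. {1..k}) S" if "S \<subset> V" for S using V(3)[OF that] same that by blast
    qed (use k s in auto)
    show False by (rule critical_False)
  qed
  then obtain c where c: "b.ok (\<lambda>_. {1..k}) (pverts G) c" by (auto simp: b.lcol_def)
  have edge: "u \<in> pverts G" "v \<in> pverts G" if "(u, v) \<in> parcs G" for u v
    using G.in_arcsD1[OF that] G.in_arcsD2[OF that] by auto
  have "backbone_colouring 2 k G H c"
    unfolding backbone_colouring_def
  proof (intro conjI ballI)
    show "c v \<in> {1..k}" if "v \<in> pverts G" for v using c that by (simp add: b.ok_def)
    show "case e of (u, v) \<Rightarrow> c u \<noteq> c v" if "e \<in> parcs G" for e
      using that c edge unfolding b.ok_def by auto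
    show "case e of (u, v) \<Rightarrow> int 2 \<le> \<bar>int (c u) - int (c v)\<bar>" if e: "e \<in> parcs H" for e
    proof -
      obtain u v where uv: "e = (u, v)" by (cases e)
      then have "u \<in> pverts G" "v \<in> pverts G" using edge H_sub_G e by blast+
      then have "far (c u) (c v)" using c e unfolding uv b.ok_def by blast
      then show ?thesis unfolding uv by (auto simp: far_def)
    qed
  qed
  then show ?thesis by (rule BBC_le) (use k s in linarith)
qed

end

theorem theorem3:
  fixes G H :: "'a pair_pre_digraph"
  assumes "pair_graph G" and "chordal G"
    and "pair_graph H" and "spanning (with_proj H) (with_proj G)" and "C4_free H"
  shows "real (BBC 2 G H) \<le> 3 / 2 * real (clique_number G) + 4"
proof (cases "clique_number G \<le> 10")
  \<comment> \<open>The number 2\<omega> - 1 is at most 3/2 \<omega> + 4 precisely up to \<omega> =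
    10.\<close>
  case True
  then show ?thesis using spaced_bound[OF assms] by linarith
next
  case False
  \<comment> \<open>This is the least \<open>s\<close> with \<omega> + 9 \<le> 2s, and \<omega>
    \<ge> 11 makes it at least 10.\<close>
  define s where "s = (clique_number G + 10) div 2"
  define k where "k = s + clique_number G - 1"
  have "BBC 2 G H \<le> k"
    by (rule backbone_bound[OF assms, of k s]) (use False in \<open>auto simp: s_def k_def\<close>)
  moreover have "2 * k \<le> 3 * clique_number G + 8" by (simp add: k_def s_def)
  ultimately show ?thesis by linarith
qed

end
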